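(* Let $Y$ be a MUCOGARCH(1,1) volatility process in $\mathbb{S}_d^+$ driven by a compound Poisson process $L$ in $\mathbb{R}^d$, with parameters $A\in GL_d(\mathbb{R})$, $B\in M_d(\mathbb{R})$ such that every eigenvalue of $B$ has strictly negative real part, and $C\in\mathbb{S}_d^{++}$. If the jump distribution of $L$ has a non-trivial absolutely continuous component equivalent to the Lebesgue measure on $\mathbb{R}^d$, then $Y$ is irreducible with respect to the Lebesgue measure on $\mathbb{S}_d^+$ and aperiodic.
   Context: Notation: $M_d(\mathbb{R})$ are the real $d\times d$ matrices, $GL_d(\mathbb{R})$ the invertible ones, $\mathbb{S}_d$ the symmetric ones, $\mathbb{S}_d^+$ the closed cone of positive semi-definite and $\mathbb{S}_d^{++}$ the open cone of positive definite matrices. The Lebesgue measure on $\mathbb{S}_d^+$ is the restriction to $\mathbb{S}_d^+$ of the Lebesgue measure on the vector space $\mathbb{S}_d\cong\mathbb{R}^{d(d+1)/2}$. MUCOGARCH(1,1) volatility process: $L$ is an $\mathbb{R}^d$-valued càdlàg Lévy process and $[L,L]^{\mathfrak d}_t=\sum_{0<s\le t}(\Delta L_s)(\Delta L_s)^\top$ is the discontinuous part of its quadratic variation. For $A,B\in M_d(\mathbb{R})$, $C\in\mathbb{S}_d^{++}$ and $Y_0\in\mathbb{S}_d^+$, the process $Y=(Y_t)_{t\ge0}$ is the unique $\mathbb{S}_d^+$-valued solution (known to exist) of $$dY_t=(BY_{t-}+Y_{t-}B^\top)\,dt+A(C+Y_{t-})^{1/2}\,d[L,L]^{\mathfrak d}_t\,(C+Y_{t-})^{1/2}A^\top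 .$$ It is a time-homogeneous strong Markov process on $X=\mathbb{S}_d^+$ with transition probabilities $\mathbb{P}^t(x,D)=\mathbb{P}_x(Y_t\in D)$, $D\in\mathcal{B}(X)$. Compound Poisson: $L_t=\sum_{i=1}^{N_t}X_i$ with $N$ a Poisson process of positive rate and $(X_i)$ i.i.d. with the jump distribution as law, independent of $N$. Markov process notions: for a $\sigma$-finite measure $\mu$ on $\mathcal{B}(X)$, the process is $\mu$-irreducible (irreducible with respect to $\mu$) if $\int_0^\infty\mathbb{P}^t(x,D)\,dt>0$ for all $x\in X$ and all $D\in\mathcal{B}(X)$ with $\mu(D)>0$. Then there is a maximal irreducibility measure $\psi$ (every other irreducibility measure is absolutely continuous with respect to $\psi$); $\mathcal{B}^+(X)$ denotes the sets $D\in\mathcal B(X)$ with $\psi(D)>0$. A nonempty $D\in\mathcal{B}(X)$ is small if there are $m>0$ and a nontrivial measure $\nu_m$ on $\mathcal{B}(X)$ with $\mathbb{P}^m(x,E)\ge\nu_m(E)$ for all $x\in D$, $E\in\mathcal{B}(X)$. A $\psi$-irreducible process is aperiodic if for some small set $D\in\mathcal{B}^+(X)$ there is $T$ with $\mathbb{P}^t(x,D)>0$ for all $t\ge T$ and all $x\in D$. *)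

theory Defs
  imports "HOL-Probability.Probability"
begin

section \<open>Matrices\<close>

definition symmetric_matrices :: "(real^'d^'d) set" where
  "symmetric_matrices = {S. transpose S = S}"

definition psd :: "(real^'d^'d) set" where
  "psd = {S \<in> symmetric_matrices. \<forall>v. 0 \<le> v \<bullet> (S *v v)}"

definition posdef :: "(real^'d^'d) set" where
  "posdef = {S \<in> symmetric_matrices. \<forall>v. v \<noteq> 0 \<longrightarrow> 0 < v \<bullet> (S *v v)}"

definition psd_sqrt :: "real^'d^'d \<Rightarrow> real^'d^'d" where
  "psd_sqrt S = (THE R. R \<in> psd \<and> R ** R = S)"

definition outer :: "real^'d \<Rightarrow> real^'d^'d" where
  "outer v = (\<chi> i j. v $ i * v $ j)"

definition complex_eigenvalue :: "real^'d^'d \<Rightarrow> complex \<Rightarrow> bool" where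
  "complex_eigenvalue B z \<longleftrightarrow>
     (\<exists>v :: complex^'d. v \<noteq> 0 \<and> map_matrix complex_of_real B *v v = z *s v)"

definition psd_borel :: "(real^'d^'d) measure" where
  "psd_borel = restrict_space borel psd"

text \<open>A symmetric matrix is identified with the family of its entries indexed by the unordered
  pairs \<open>{i, j}\<close>, singletons \<open>{i}\<close> included; there are \<open>d (d + 1) / 2\<close> of them.  Lebesgue measure
  on the symmetric matrices is the image of Lebesgue measure on these coordinates.\<close>

definition lebesgue_symmetric :: "(real^'d^'d) measure" where
  "lebesgue_symmetric =
     distr (PiM {{i, j} | i j :: 'd. True} (\<lambda>_. lborel :: real measure)) borel
       (\<lambda>f. \<chi> i j. f {i, j})"

definition lebesgue_psd :: "(real^'d^'d) measure" where
  "lebesgue_psd = restrict_space lebesgue_symmetric psd"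


section \<open>Paths and jumps\<close>

definition cadlag :: "(real \<Rightarrow> 'a::topological_space) \<Rightarrow> bool" where
  "cadlag f \<longleftrightarrow>
     (\<forall>t\<ge>0. (f \<longlongrightarrow> f t) (at_right t)) \<and> (\<forall>t>0. \<exists>l. (f \<longlongrightarrow> l) (at_left t))"

definition left_lim :: "(real \<Rightarrow> 'a::t2_space) \<Rightarrow> real \<Rightarrow> 'a" where
  "left_lim f t = Lim (at_left t) f"

definition jump :: "(real \<Rightarrow> 'a::real_normed_vector) \<Rightarrow> real \<Rightarrow> 'a" where
  "jump f t = f t - left_lim f t"

definition discontinuous_qv :: "(real \<Rightarrow> real^'d) \<Rightarrow> real \<Rightarrow> real^'d^'d" where
  "discontinuous_qv l t = (\<Sum>\<^sub>\<infinity>s\<in>{0<..t}. outer (jump l s))"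

text \<open>The integral over \<open>(0, t]\<close> of \<open>G dV H\<close> for a matrix-valued path \<open>V\<close> of finite variation that
  is the sum of its jumps, such as the discontinuous part of a quadratic variation: the
  Lebesgue-Stieltjes integral is then the sum of the integrand over the jumps of \<open>V\<close>.\<close>

definition pure_jump_integral ::
  "(real \<Rightarrow> real^'d^'d) \<Rightarrow> (real \<Rightarrow> real^'d^'d) \<Rightarrow> (real \<Rightarrow> real^'d^'d) \<Rightarrow> real \<Rightarrow> real^'d^'d" where
  "pure_jump_integral G V H t = (\<Sum>\<^sub>\<infinity>s\<in>{0<..t}. G s ** jump V s ** H s)"


section \<open>Compound Poisson processes\<close>

text \<open>Increments of \<open>N\<close> are formed in the integers, since subtraction of naturals truncates.\<close>

definition poisson_process :: "'w measure \<Rightarrow> real \<Rightarrow> (real \<Rightarrow> 'w \<Rightarrow> nat) \<Rightarrow> bool" where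
  "poisson_process M rate N \<longleftrightarrow>
     (\<forall>t\<ge>0. N t \<in> measurable M (count_space UNIV)) \<and>
     (AE w in M. N 0 w = 0 \<and> cadlag (\<lambda>t. real (N t w))) \<and>
     (\<forall>s t. 0 \<le> s \<longrightarrow> s < t \<longrightarrow>
        distr M (count_space UNIV) (\<lambda>w. int (N t w) - int (N s w)) =
        measure_pmf (map_pmf int (poisson_pmf (rate * (t - s))))) \<and>
     (\<forall>(n::nat) \<tau>. 0 \<le> \<tau> 0 \<longrightarrow> (\<forall>i<n. \<tau> i < \<tau> (Suc i)) \<longrightarrow>
        prob_space.indep_vars M (\<lambda>_. count_space UNIV)
          (\<lambda>i w. int (N (\<tau> (Suc i)) w) - int (N (\<tau> i) w)) {..<n})"

definition compound_poisson ::
  "'w measure \<Rightarrow> real \<Rightarrow> (real^'d) measure \<Rightarrow> (real \<Rightarrow> 'w \<Rightarrow> real^'d) \<Rightarrow> bool" where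
  "compound_poisson M rate F L \<longleftrightarrow>
     (\<forall>t\<ge>0. L t \<in> borel_measurable M) \<and>
     (\<exists>N X.
        poisson_process M rate N \<and>
        prob_space.indep_vars M (\<lambda>_. borel) X (UNIV :: nat set) \<and>
        (\<forall>i. distr M borel (X i) = F) \<and>
        prob_space.indep_set M
          (sets (vimage_algebra (space M) (\<lambda>w. \<lambda>t\<in>{0..}. N t w)
             (PiM {0..} (\<lambda>_. count_space UNIV))))
          (sets (vimage_algebra (space M) (\<lambda>w i. X i w) (PiM UNIV (\<lambda>_. borel)))) \<and>
        (AE w in M. \<forall>t\<ge>0. L t w = (\<Sum>i<N t w. X i w)))"


section \<open>Lebesgue decomposition\<close>

definition lebesgue_decomposition ::
  "'a measure \<Rightarrow> 'a measure \<Rightarrow> 'a measure \<Rightarrow> 'a measure \<Rightarrow> bool" where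
  "lebesgue_decomposition \<mu> F Fa Fs \<longleftrightarrow>
     sets F = sets \<mu> \<and> sets Fa = sets \<mu> \<and> sets Fs = sets \<mu> \<and>
     (\<forall>E\<in>sets \<mu>. emeasure F E = emeasure Fa E + emeasure Fs E) \<and>
     absolutely_continuous \<mu> Fa \<and>
     (\<exists>E\<in>null_sets \<mu>. emeasure Fs (space \<mu> - E) = 0)"

definition equivalent_measures :: "'a measure \<Rightarrow> 'a measure \<Rightarrow> bool" where
  "equivalent_measures \<mu> \<nu> \<longleftrightarrow>
     sets \<mu> = sets \<nu> \<and> absolutely_continuous \<mu> \<nu> \<and> absolutely_continuous \<nu> \<mu>"


section \<open>MUCOGARCH(1,1) volatility processes\<close>

definition mucogarch_volatility ::
  "'w measure \<Rightarrow> (real \<Rightarrow> 'w \<Rightarrow> real^'d) \<Rightarrow> real^'d^'d \<Rightarrow> real^'d^'d \<Rightarrow> real^'d^'d \<Rightarrow>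
   real^'d^'d \<Rightarrow> (real \<Rightarrow> 'w \<Rightarrow> real^'d^'d) \<Rightarrow> bool" where
  "mucogarch_volatility M L A B C x Y \<longleftrightarrow>
     (\<forall>t\<ge>0. Y t \<in> measurable M psd_borel) \<and>
     (AE w in M.
        cadlag (\<lambda>t. Y t w) \<and>
        Y 0 w = x \<and>
        (\<forall>t\<ge>0. Y t w = Y 0 w +
           integral {0..t} (\<lambda>s. B ** left_lim (\<lambda>r. Y r w) s + left_lim (\<lambda>r. Y r w) s ** transpose B) +
           pure_jump_integral
             (\<lambda>s. A ** psd_sqrt (C + left_lim (\<lambda>r. Y r w) s))
             (discontinuous_qv (\<lambda>r. L r w))
             (\<lambda>s. psd_sqrt (C + left_lim (\<lambda>r. Y r w) s) ** transpose A) t))"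

text \<open>\<open>Y x\<close> is the process started at \<open>x\<close>, so its law is that of the process under \<open>P\<^sub>x\<close>.\<close>

definition mucogarch_transition ::
  "'w measure \<Rightarrow> (real^'d^'d \<Rightarrow> real \<Rightarrow> 'w \<Rightarrow> real^'d^'d) \<Rightarrow>
   real \<Rightarrow> real^'d^'d \<Rightarrow> (real^'d^'d) measure" where
  "mucogarch_transition M Y t x = distr M psd_borel (Y x t)"


section \<open>Irreducibility and aperiodicity in continuous time\<close>

text \<open>Below, \<open>S\<close> is the measurable state space and \<open>P t x\<close> the law at time \<open>t\<close> from state \<open>x\<close>.\<close>

definition irreducible_wrt ::
  "'a measure \<Rightarrow> (real \<Rightarrow> 'a \<Rightarrow> 'a measure) \<Rightarrow> 'a measure \<Rightarrow> bool" where
  "irreducible_wrt S P \<mu> \<longleftrightarrow>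
     sigma_finite_measure \<mu> \<and> sets \<mu> = sets S \<and>
     (\<forall>x\<in>space S. \<forall>D\<in>sets S. 0 < emeasure \<mu> D \<longrightarrow>
        0 < (\<integral>\<^sup>+t\<in>{0..}. emeasure (P t x) D \<partial>lborel))"

definition maximal_irreducibility_measure ::
  "'a measure \<Rightarrow> (real \<Rightarrow> 'a \<Rightarrow> 'a measure) \<Rightarrow> 'a measure \<Rightarrow> bool" where
  "maximal_irreducibility_measure S P \<psi> \<longleftrightarrow>
     irreducible_wrt S P \<psi> \<and>
     (\<forall>\<phi>. irreducible_wrt S P \<phi> \<longrightarrow> absolutely_continuous \<psi> \<phi>)"

definition small_set ::
  "'a measure \<Rightarrow> (real \<Rightarrow> 'a \<Rightarrow> 'a measure) \<Rightarrow> 'a set \<Rightarrow> bool" where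
  "small_set S P D \<longleftrightarrow>
     D \<in> sets S \<and> D \<noteq> {} \<and>
     (\<exists>m>0. \<exists>\<nu>. sets \<nu> = sets S \<and> emeasure \<nu> (space S) \<noteq> 0 \<and>
        (\<forall>x\<in>D. \<forall>E\<in>sets S. emeasure \<nu> E \<le> emeasure (P m x) E))"

text \<open>Maximal irreducibility measures have the same null sets, so it does not matter which one
  is used to decide whether \<open>D\<close> has positive measure.\<close>

definition aperiodic_process :: "'a measure \<Rightarrow> (real \<Rightarrow> 'a \<Rightarrow> 'a measure) \<Rightarrow> bool" where
  "aperiodic_process S P \<longleftrightarrow>
     (\<exists>\<psi>. maximal_irreducibility_measure S P \<psi> \<and>
       (\<exists>D. small_set S P D \<and> 0 < emeasure \<psi> D \<and>
          (\<exists>T\<ge>0. \<forall>t\<ge>T. \<forall>x\<in>D. 0 < emeasure (P t x) D)))"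

end

theory Submission
  imports Defs "HOL-Computational_Algebra.Fundamental_Theorem_Algebra"
begin

text \<open>Between jumps \<open>Y\<^sub>s\<close> moves by \<open>Y \<mapsto> E Y E\<^sup>T\<close> with \<open>E\<close> a matrix exponential, so \<open>E(t - s) Y\<^sub>s E(t - s)\<^sup>T\<close>
  changes only at jumps, where it gains \<open>u u\<^sup>T\<close> with \<open>u = K v\<close>, \<open>v\<close> the jump of the driving process and \<open>K\<close> an
  invertible matrix depending on the past.  After \<open>d\<close> jumps \<open>Y\<^sub>t - E(t) Y\<^sub>0 E(t)\<^sup>T\<close> is the Gram matrix of
  \<open>u\<^sub>1, \<dots>, u\<^sub>d\<close>, whose joint law dominates a positive density by a triangular change of variables;
  hence the law of \<open>Y\<^sub>t\<close> charges every non-null part of \<open>E(t) Y\<^sub>0 E(t)\<^sup>T + \<close> the open cone.  Stability of \<open>B\<close> moves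
  the vertex of this cone to the origin, which gives irreducibility.  The Gram density is computed without
  differentiating matrix roots, by averaging \<open>U = S\<^sup>1\<^sup>/\<^sup>2 G\<close> over \<open>S\<close>.  A maximal irreducibility measure comes
  from an exhaustion argument, and a small set from a lower bound for two consecutive blocks of \<open>d\<close>
  jumps.\<close>

text \<open>The obstacle is the map from \<open>U\<close> to \<open>transpose U ** U\<close>: it
  lowers the dimension from d^2 to d (d + 1) / 2, so the image of a density under it is not given by
  a Jacobian determinant. Writing \<open>U\<close> as a root of \<open>S\<close> times
  \<open>G\<close> trades it for two linear substitutions: \<open>G\<close> to \<open>R ** G\<close>
  with \<open>S\<close> fixed, and \<open>S\<close> to \<open>congr G S\<close> with
  \<open>G\<close> fixed. A linear substitution changes a translation-invariant measure by a
  constant factor, and the argument only asks this factor to be measurable, positive and finite. The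
  densities are positive at almost every end point for every choice of jump times, so the Poisson
  process enters through a single event of positive probability: exactly one jump in each of n equal
  cells. Positivity almost everywhere is not yet a lower bound. For the small set it is made uniform
  on sets of positive measure, and both blocks of jumps are placed inside one time interval, so that
  the minorization concerns one transition kernel.\<close>

section \<open>Matrix operations as bounded bilinear maps; continuity and measurability\<close>

lemma bounded_bilinear_matrix_matrix_mult:
  "bounded_bilinear ((**) :: real^'n^'m \<Rightarrow> real^'p^'n \<Rightarrow> real^'p^'m)"
proof -
  have "bilinear ((**) :: real^'n^'m \<Rightarrow> real^'p^'n \<Rightarrow> real^'p^'m)"
    by (intro bilinear_def[THEN iffD2] conjI allI linearI)
      (simp_all add: vec_eq_iff matrix_matrix_mult_def sum.distrib algebra_simps sum_distrib_left)
  then show ?thesis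
    by (simp add: bilinear_conv_bounded_bilinear)
qed

lemma bounded_bilinear_matrix_vector_mult:
  "bounded_bilinear ((*v) :: real^'n^'m \<Rightarrow> real^'n \<Rightarrow> real^'m)"
proof -
  have "bilinear ((*v) :: real^'n^'m \<Rightarrow> real^'n \<Rightarrow> real^'m)"
    by (intro bilinear_def[THEN iffD2] conjI allI linearI)
      (simp_all add: vec_eq_iff matrix_vector_mult_def sum.distrib algebra_simps sum_distrib_left)
  then show ?thesis
    by (simp add: bilinear_conv_bounded_bilinear)
qed

lemma bounded_linear_transpose: "bounded_linear (transpose :: real^'n^'m \<Rightarrow> real^'m^'n)"
proof -
  have "linear (transpose :: real^'n^'m \<Rightarrow> real^'m^'n)"
    by (intro linearI) (simp_all add: vec_eq_iff transpose_def)
  then show ?thesis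
    by (simp add: linear_conv_bounded_linear)
qed

interpretation matrix_mult: bounded_bilinear "(**) :: real^'n^'m \<Rightarrow> real^'p^'n \<Rightarrow> real^'p^'m"
  by (rule bounded_bilinear_matrix_matrix_mult)

interpretation matrix_vector_mult: bounded_bilinear "(*v) :: real^'n^'m \<Rightarrow> real^'n \<Rightarrow> real^'m"
  by (rule bounded_bilinear_matrix_vector_mult)

lemmas transpose_add = linear_add[OF bounded_linear.linear[OF bounded_linear_transpose]]
  and transpose_minus = linear_neg[OF bounded_linear.linear[OF bounded_linear_transpose]]
  and transpose_scaleR = linear_cmul[OF bounded_linear.linear[OF bounded_linear_transpose]]
  and transpose_zero = linear_0[OF bounded_linear.linear[OF bounded_linear_transpose]]

lemmas matrix_continuous_intros [continuous_intros] =
  matrix_mult.continuous_on matrix_vector_mult.continuous_on bounded_linear.continuous_on[OF bounded_linear_transpose]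

lemma continuous_on_outer [continuous_intros]:
  "continuous_on S f \<Longrightarrow> continuous_on S (\<lambda>x. outer (f x :: real^'d))"
  unfolding outer_def by (intro continuous_intros)

lemma measurable_matrix_mult [measurable]:
  fixes f :: "'a \<Rightarrow> real^'n^'m" and g :: "'a \<Rightarrow> real^'p^'n"
  assumes "f \<in> borel_measurable M" "g \<in> borel_measurable M"
  shows "(\<lambda>x. f x ** g x) \<in> borel_measurable M"
  by (rule borel_measurable_continuous_Pair[OF assms]) (intro continuous_intros)

lemma measurable_matrix_vector_mult [measurable]:
  fixes f :: "'a \<Rightarrow> real^'n^'m" and g :: "'a \<Rightarrow> real^'n"
  assumes "f \<in> borel_measurable M" "g \<in> borel_measurable M"
  shows "(\<lambda>x. f x *v g x) \<in> borel_measurable M"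
  by (rule borel_measurable_continuous_Pair[OF assms]) (intro continuous_intros)

lemma measurable_transpose [measurable]:
  "(transpose :: real^'n^'m \<Rightarrow> real^'m^'n) \<in> borel_measurable borel"
  by (intro borel_measurable_continuous_onI continuous_intros)

lemma measurable_outer [measurable]:
  "(outer :: real^'d \<Rightarrow> real^'d^'d) \<in> borel_measurable borel"
  by (intro borel_measurable_continuous_onI continuous_intros)

lemma inner_transpose_mult: "(A *v x) \<bullet> y = x \<bullet> (transpose A *v y)" for A :: "real^'n^'m"
  by (metis adjoint_matrix adjoint_works inner_commute matrix_vector_mul_linear transpose_transpose)

lemma matrix_eqI_inner:
  assumes "\<And>x y. x \<bullet> (A *v y) = x \<bullet> (B *v y)"
  shows "A = (B :: real^'n^'m)"
  by (metis assms matrix_eq vector_eq_ldot)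

lemma transpose_matrix_mult [simp]: "transpose (A ** B) = transpose B ** transpose (A :: real^'n^'m)"
  by (rule matrix_transpose_mul)

lemma outer_mult_vec: "outer v *v w = (v \<bullet> w) *\<^sub>R v"
  by (simp add: vec_eq_iff outer_def matrix_vector_mult_def inner_vec_def sum_distrib_left
      sum_distrib_right mult_ac)

lemma transpose_outer [simp]: "transpose (outer v) = outer v"
  by (simp add: vec_eq_iff outer_def transpose_def mult.commute)

text \<open>The jump term of the equation is a congruence of \<open>outer v\<close>. In this form it
  is the outer square of one vector, so that sums of jump terms become Gram matrices.\<close>

lemma outer_matrix_vector: "outer (K *v v) = K ** outer v ** transpose K"
proof (rule matrix_eqI_inner)
  fix x y
  have "x \<bullet> ((K ** outer v ** transpose K) *v y) = x \<bullet> (K *v (outer v *v (transpose K *v y)))"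
    by (simp add: matrix_vector_mul_assoc matrix_mul_assoc del: transpose_matrix_vector)
  also have "\<dots> = (v \<bullet> (transpose K *v y)) * (x \<bullet> (K *v v))"
    by (simp add: outer_mult_vec matrix_vector_mult_scaleR del: transpose_matrix_vector)
  also have "\<dots> = ((K *v v) \<bullet> y) * (x \<bullet> (K *v v))"
    by (subst inner_transpose_mult) simp
  finally show "x \<bullet> (outer (K *v v) *v y) = x \<bullet> ((K ** outer v ** transpose K) *v y)"
    by (simp add: outer_mult_vec)
qed

section \<open>Symmetric, positive semidefinite and positive definite matrices\<close>

lemma symmetric_nth: "S \<in> symmetric_matrices \<Longrightarrow> S $ i $ j = S $ j $ i"
  unfolding symmetric_matrices_def transpose_def by (simp add: vec_eq_iff)

lemma symmetric_inner: "S \<in> symmetric_matrices \<Longrightarrow> (S *v x) \<bullet> y = x \<bullet> (S *v y)"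
  unfolding symmetric_matrices_def using inner_transpose_mult[of S x y] by simp

lemma psd_symmetric: "S \<in> psd \<Longrightarrow> S \<in> symmetric_matrices"
  and psd_nonneg: "S \<in> psd \<Longrightarrow> 0 \<le> v \<bullet> (S *v v)"
  and posdef_symmetric: "S \<in> posdef \<Longrightarrow> S \<in> symmetric_matrices"
  and posdef_pos: "S \<in> posdef \<Longrightarrow> v \<noteq> 0 \<Longrightarrow> 0 < v \<bullet> (S *v v)"
  by (auto simp: psd_def posdef_def)

lemma posdef_psd: "S \<in> posdef \<Longrightarrow> S \<in> psd"
proof -
  assume S: "S \<in> posdef"
  have "0 \<le> v \<bullet> (S *v v)" for v
    using posdef_pos[OF S, of v] by (cases "v = 0") auto
  then show ?thesis using S by (auto simp: psd_def posdef_def)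
qed

lemma subspace_symmetric_matrices: "subspace symmetric_matrices"
  by (auto simp: subspace_def symmetric_matrices_def transpose_add transpose_scaleR transpose_zero)

lemma symmetric_add: "S \<in> symmetric_matrices \<Longrightarrow> T \<in> symmetric_matrices \<Longrightarrow> S + T \<in> symmetric_matrices"
  and symmetric_diff: "S \<in> symmetric_matrices \<Longrightarrow> T \<in> symmetric_matrices \<Longrightarrow> S - T \<in> symmetric_matrices"
  and symmetric_scaleR: "S \<in> symmetric_matrices \<Longrightarrow> c *\<^sub>R S \<in> symmetric_matrices"
  by (simp_all add: subspace_symmetric_matrices subspace_add subspace_diff subspace_scale)

lemma symmetric_congruence: "S \<in> symmetric_matrices \<Longrightarrow> G ** S ** transpose G \<in> symmetric_matrices"
  by (simp add: symmetric_matrices_def matrix_mul_assoc)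

lemma inner_congruence: "v \<bullet> ((G ** S ** transpose G) *v v) = (transpose G *v v) \<bullet> (S *v (transpose G *v v))"
  for G :: "real^'d^'e" and S :: "real^'d^'d"
proof -
  have "v \<bullet> ((G ** S ** transpose G) *v v) = v \<bullet> (G *v (S *v (transpose G *v v)))"
    by (simp add: matrix_vector_mul_assoc matrix_mul_assoc del: transpose_matrix_vector)
  then show ?thesis
    by (metis inner_transpose_mult transpose_transpose)
qed

lemma psd_congruence: "S \<in> psd \<Longrightarrow> G ** S ** transpose G \<in> psd"
  unfolding psd_def
  by (auto simp only: symmetric_congruence inner_congruence mem_Collect_eq)

lemma psd_add: "S \<in> psd \<Longrightarrow> T \<in> psd \<Longrightarrow> S + T \<in> psd"
  by (simp add: psd_def symmetric_add matrix_vector_mult_add_rdistrib inner_add_right)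

lemma posdef_psd_add: "S \<in> posdef \<Longrightarrow> T \<in> psd \<Longrightarrow> S + T \<in> posdef"
  by (auto simp: psd_def posdef_def symmetric_add matrix_vector_mult_add_rdistrib inner_add_right
      intro!: add_pos_nonneg)

lemma psd_outer: "outer v \<in> psd"
  by (simp add: psd_def symmetric_matrices_def outer_mult_vec inner_commute)

lemma psd_sum: "(\<And>i. i \<in> I \<Longrightarrow> f i \<in> psd) \<Longrightarrow> sum f I \<in> (psd :: (real^'d^'d) set)"
proof (induction I rule: infinite_finite_induct)
  case (insert x F) then show ?case by (simp add: psd_add)
qed (auto simp: psd_def symmetric_matrices_def transpose_zero)

lemma invertible_kernel: "invertible A \<longleftrightarrow> (\<forall>v. A *v v = 0 \<longrightarrow> v = 0)" for A :: "real^'d^'d"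
  unfolding invertible_left_inverse matrix_left_invertible_ker ..

lemma posdef_invertible:
  assumes "S \<in> posdef" shows "invertible S"
  unfolding invertible_kernel
proof (intro allI impI, rule ccontr)
  fix v assume "S *v v = 0" "v \<noteq> 0"
  then show False using posdef_pos[OF assms, of v] by simp
qed

lemma posdef_congruence:
  fixes G S :: "real^'d^'d"
  assumes "S \<in> posdef" "invertible G"
  shows "G ** S ** transpose G \<in> posdef"
proof -
  have "transpose G *v v \<noteq> 0" if "v \<noteq> 0" for v
    using that transpose_invertible[OF assms(2)] unfolding invertible_kernel by metis
  then show ?thesis
    using assms(1) unfolding posdef_def
    by (simp only: symmetric_congruence inner_congruence mem_Collect_eq) simp
qed

section \<open>Eigenvectors of symmetric matrices and the square root\<close>

text \<open>Polarization: the form at \<open>x + y\<close> leaves twice the bilinear value at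
  \<open>x\<close>, \<open>y\<close>.\<close>

lemma symmetric_eq_0:
  assumes "S \<in> symmetric_matrices" "\<And>v. v \<bullet> (S *v v) = 0"
  shows "S = 0"
proof (rule matrix_eqI_inner)
  fix x y
  have "0 = (x + y) \<bullet> (S *v (x + y))" by (simp add: assms)
  also have "\<dots> = x \<bullet> (S *v y) + y \<bullet> (S *v x)"
    by (simp add: assms matrix_vector_right_distrib inner_add_left inner_add_right)
  also have "y \<bullet> (S *v x) = x \<bullet> (S *v y)"
    using symmetric_inner[OF assms(1), of x y] by (simp add: inner_commute)
  finally show "x \<bullet> (S *v y) = x \<bullet> (0 *v y)" by simp
qed

text \<open>A maximiser of the Rayleigh quotient is an eigenvector: the first variation vanishes.\<close>

lemma symmetric_top_eigenvector:
  fixes S :: "real^'d^'d"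
  assumes S: "S \<in> symmetric_matrices"
  obtains \<mu> v where "norm v = 1" "S *v v = \<mu> *\<^sub>R v" "\<And>w. w \<bullet> (S *v w) \<le> \<mu> * (w \<bullet> w)"
proof -
  define q where "q w = w \<bullet> (S *v w)" for w
  have "continuous_on (sphere 0 1) q" unfolding q_def by (intro continuous_intros)
  moreover have "sphere 0 1 \<noteq> ({} :: (real^'d) set)" by simp
  ultimately obtain v where v: "v \<in> sphere 0 1" and max: "\<And>w. w \<in> sphere 0 1 \<Longrightarrow> q w \<le> q v"
    using continuous_attains_sup[of "sphere (0 :: real^'d) 1" q] by auto
  have q_le: "q w \<le> q v * (w \<bullet> w)" for w
  proof (cases "w = 0")
    case False
    have "q ((1 / norm w) *\<^sub>R w) \<le> q v" by (rule max) (use False in simp)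
    moreover have "q ((1 / norm w) *\<^sub>R w) = q w / (norm w)\<^sup>2"
      by (simp add: q_def matrix_vector_mult_scaleR power2_eq_square)
    ultimately show ?thesis using False by (simp add: field_simps power2_norm_eq_inner)
  qed (simp add: q_def)
  have "S *v v = q v *\<^sub>R v"
  proof -
    define z where "z = S *v v - q v *\<^sub>R v"
    have vv: "v \<bullet> v = 1" using v by (simp add: dot_square_norm)
    \<comment> \<open>This is \<open>q_le\<close> at \<open>v + t *\<^sub>R z\<close>, expanded. The
      terms linear in \<open>t\<close> combine to \<open>2 * t * (z \<bullet> z)\<close> because
      \<open>z\<close> is the residual of the eigenvalue equation.\<close>
    have "2 * t * (z \<bullet> z) \<le> t\<^sup>2 * (q v * (z \<bullet> z) - q z)" for t
    proof -
      have "z \<bullet> (S *v v) = v \<bullet> (S *v z)"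
        using symmetric_inner[OF S, of v z] by (simp add: inner_commute)
      moreover have "z \<bullet> z = z \<bullet> (S *v v) - q v * (z \<bullet> v)" by (simp add: z_def inner_diff_right)
      moreover have "q (v + t *\<^sub>R z) = q v + t * (z \<bullet> (S *v v)) + t * (v \<bullet> (S *v z)) + t\<^sup>2 * q z"
        by (simp add: q_def matrix_vector_right_distrib matrix_vector_mult_scaleR inner_add_left
            inner_add_right algebra_simps power2_eq_square)
      moreover have "(v + t *\<^sub>R z) \<bullet> (v + t *\<^sub>R z) = 1 + 2 * t * (z \<bullet> v) + t\<^sup>2 * (z \<bullet> z)"
        using vv by (simp add: inner_add_left inner_add_right inner_commute[of z v]
            algebra_simps power2_eq_square)
      ultimately show ?thesis
        using q_le[of "v + t *\<^sub>R z"] by (simp only:) (simp add: algebra_simps)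
    qed note var = this
    define b where "b = \<bar>q v * (z \<bullet> z) - q z\<bar> + 1"
    have "z \<bullet> z = 0"
    proof (rule ccontr)
      assume "z \<bullet> z \<noteq> 0"
      then have pos: "z \<bullet> z > 0" by simp
      \<comment> \<open>For this \<open>t\<close> the quadratic term is at most
        \<open>t * (z \<bullet> z)\<close>, half of the linear one. The summand 1 in
        \<open>b\<close> keeps the denominator positive.\<close>
      define t where "t = (z \<bullet> z) / b"
      have b: "b > 0" "q v * (z \<bullet> z) - q z \<le> b" by (auto simp: b_def)
      have t: "t > 0" using pos b by (simp add: t_def)
      have "2 * t * (z \<bullet> z) \<le> t\<^sup>2 * b"
        using var[of t] mult_left_mono[OF b(2), of "t\<^sup>2"] by simp
      then have "2 * (z \<bullet> z) \<le> t * b" using t by (simp add: power2_eq_square)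
      then show False using b pos by (simp add: t_def)
    qed
    then show ?thesis by (simp add: z_def)
  qed
  then show ?thesis using that[of v "q v"] v q_le by (auto simp: q_def)
qed

text \<open>The top eigenvectors of \<open>S\<close> and of \<open>- S\<close> belong to the largest
  and the smallest eigenvalue of \<open>S\<close>. If both were 0, the quadratic form and hence
  \<open>S\<close> would vanish.\<close>

lemma symmetric_nonzero_eigenvector:
  fixes S :: "real^'d^'d"
  assumes S: "S \<in> symmetric_matrices" "S \<noteq> 0"
  obtains \<mu> v where "\<mu> \<noteq> 0" "v \<noteq> 0" "S *v v = \<mu> *\<^sub>R v"
proof -
  have mS: "- S \<in> symmetric_matrices" using S by (simp add: symmetric_matrices_def transpose_minus)
  obtain \<mu> v where 1: "norm v = 1" "S *v v = \<mu> *\<^sub>R v" "\<And>w. w \<bullet> (S *v w) \<le> \<mu> * (w \<bullet> w)"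
    using symmetric_top_eigenvector[OF S(1)] by blast
  obtain \<nu> u where 2: "norm u = 1" "- S *v u = \<nu> *\<^sub>R u" "\<And>w. w \<bullet> (- S *v w) \<le> \<nu> * (w \<bullet> w)"
    using symmetric_top_eigenvector[OF mS] by blast
  have "\<not> (\<mu> = 0 \<and> \<nu> = 0)"
  proof
    assume z: "\<mu> = 0 \<and> \<nu> = 0"
    have "w \<bullet> (S *v w) = 0" for w
      using 1(3)[of w] 2(3)[of w] z by (simp add: matrix_vector_mult.minus_left)
    then show False using symmetric_eq_0[OF S(1)] S(2) by blast
  qed
  then consider "\<mu> \<noteq> 0" | "\<nu> \<noteq> 0" by blast
  then show ?thesis
  proof cases
    case 1 then show ?thesis using that[of \<mu> v] \<open>norm v = 1\<close> \<open>S *v v = _\<close> by force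
  next
    case 2
    have "S *v u = (- \<nu>) *\<^sub>R u" using \<open>- S *v u = _\<close>
      by (metis add.inverse_inverse matrix_vector_mult.minus_left scaleR_left.minus)
    then show ?thesis using that[of "- \<nu>" u] \<open>norm u = 1\<close> 2 by force
  qed
qed

text \<open>A zero of a nonnegative form is a minimum, so its first variation, twice
  \<open>S *v v\<close>, vanishes there. The quantitative argument is the same as for the Rayleigh
  quotient.\<close>

lemma psd_kernel:
  assumes S: "S \<in> psd" and z: "v \<bullet> (S *v v) = 0"
  shows "S *v v = 0"
proof (rule ccontr)
  assume "S *v v \<noteq> 0"
  define z where "z = S *v v"
  have pos: "z \<bullet> z > 0" using \<open>S *v v \<noteq> 0\<close> by (simp add: z_def)
  have "0 \<le> 2 * t * (z \<bullet> z) + t\<^sup>2 * (z \<bullet> (S *v z))" for t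
    using psd_nonneg[OF S, of "v + t *\<^sub>R z"] z symmetric_inner[OF psd_symmetric[OF S], of v z]
    by (simp add: z_def[symmetric] matrix_vector_right_distrib matrix_vector_mult_scaleR
        inner_add_left inner_add_right inner_commute power2_eq_square algebra_simps)
  note var = this
  define b where "b = z \<bullet> (S *v z) + 1"
  have b: "b > 0" using psd_nonneg[OF S, of z] by (simp add: b_def)
  define t where "t = - (z \<bullet> z) / b"
  have "0 \<le> 2 * t * (z \<bullet> z) + t\<^sup>2 * b"
    using var[of t] mult_left_mono[of "z \<bullet> (S *v z)" b "t\<^sup>2"] by (simp add: b_def)
  also have "\<dots> = - (z \<bullet> z)\<^sup>2 / b"
    using b by (simp add: t_def power2_eq_square field_simps)
  finally show False using b pos by (simp add: field_simps)
qed

text \<open>Existence of square roots by deflation: subtracting \<open>\<mu> v v\<^sup>T\<close> for a unit eigenvector with top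
  eigenvalue \<open>\<mu>\<close> keeps the matrix positive semidefinite and lowers the rank.\<close>

lemma psd_sqrt_exists:
  fixes S :: "real^'d^'d"
  assumes "S \<in> psd"
  shows "\<exists>R\<in>psd. R ** R = S"
  using assms
proof (induction "dim (range ((*v) S))" arbitrary: S rule: less_induct)
  case less
  show ?case
  proof (cases "S = 0")
    case True
    have "(0 :: real^'d^'d) \<in> psd" by (simp add: psd_def symmetric_matrices_def transpose_zero)
    then show ?thesis using True by (intro bexI[of _ 0]) (simp_all add: matrix_mult.zero_left)
  next
    case False
    have sym: "S \<in> symmetric_matrices" using less.prems by (rule psd_symmetric)
    obtain \<mu> v where v: "norm v = 1" "S *v v = \<mu> *\<^sub>R v" and max: "\<And>w. w \<bullet> (S *v w) \<le> \<mu> * (w \<bullet> w)"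
      using symmetric_top_eigenvector[OF sym] by blast
    have vv: "v \<bullet> v = 1" using v by (simp add: dot_square_norm)
    have "\<mu> \<ge> 0" using psd_nonneg[OF less.prems, of v] v vv by simp
    moreover have "\<mu> \<noteq> 0"
    proof
      assume "\<mu> = 0"
      then have "w \<bullet> (S *v w) = 0" for w
        using max[of w] psd_nonneg[OF less.prems, of w] by simp
      then show False using symmetric_eq_0[OF sym] False by blast
    qed
    ultimately have mu: "\<mu> > 0" by simp
    define T where "T = S - \<mu> *\<^sub>R outer v"
    have symT: "T \<in> symmetric_matrices" unfolding T_def
      by (intro symmetric_diff symmetric_scaleR sym psd_symmetric psd_outer)
    have Tw: "T *v w = S *v w - (\<mu> * (v \<bullet> w)) *\<^sub>R v" for w
      by (simp add: T_def matrix_vector_mult_diff_rdistrib outer_mult_vec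
          scaleR_matrix_vector_assoc[symmetric])
    have Tv: "T *v v = 0" by (simp add: Tw v vv)
    have "0 \<le> w \<bullet> (T *v w)" for w
    proof -
      \<comment> \<open>\<open>T\<close> kills the component of \<open>w\<close> along
        \<open>v\<close> and agrees with \<open>S\<close> on the component \<open>u\<close>
        orthogonal to \<open>v\<close>.\<close>
      define u where "u = w - (v \<bullet> w) *\<^sub>R v"
      have w: "w = u + (v \<bullet> w) *\<^sub>R v" by (simp add: u_def)
      have vu: "v \<bullet> u = 0" by (simp add: u_def inner_diff_right vv)
      have Tu: "T *v u = S *v u" by (simp add: Tw vu)
      have "T *v w = T *v u"
        by (subst w) (simp add: matrix_vector_right_distrib matrix_vector_mult_scaleR Tv)
      moreover have "v \<bullet> (T *v u) = 0"
        using symmetric_inner[OF symT, of v u] Tv by simp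
      ultimately have "w \<bullet> (T *v w) = u \<bullet> (S *v u)"
        by (subst w) (simp add: inner_add_left Tu)
      then show ?thesis using psd_nonneg[OF less.prems] by simp
    qed
    then have T: "T \<in> psd" using symT by (simp add: psd_def)
    have "dim (range ((*v) T)) < dim (range ((*v) S))"
    proof (rule dim_psubset)
      have 1: "range ((*v) T) \<subseteq> range ((*v) S)"
      proof safe
        fix w
        have "T *v w = S *v (w - (v \<bullet> w) *\<^sub>R v)"
          by (simp add: Tw matrix_vector_mult_diff_distrib matrix_vector_mult_scaleR v mult.commute)
        then show "T *v w \<in> range ((*v) S)" by blast
      qed
      have 2: "v \<in> range ((*v) S)"
      proof -
        have "v = S *v ((1 / \<mu>) *\<^sub>R v)" using v mu by (simp add: matrix_vector_mult_scaleR)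
        then show ?thesis by blast
      qed
      \<comment> \<open>\<open>T\<close> is symmetric and kills \<open>v\<close>, so its range is
        orthogonal to \<open>v\<close>. This makes the rank drop strictly.\<close>
      have 3: "v \<notin> range ((*v) T)"
      proof
        assume "v \<in> range ((*v) T)"
        then obtain w where w: "v = T *v w" by blast
        have "v \<bullet> v = (T *v v) \<bullet> w" using symmetric_inner[OF symT, of v w] w by simp
        then show False using Tv vv by simp
      qed
      have "span (range ((*v) A)) = range ((*v) A)" for A :: "real^'d^'d"
        by (intro span_eq_iff[THEN iffD2] linear_subspace_image subspace_UNIV matrix_vector_mul_linear)
      then show "span (range ((*v) T)) \<subset> span (range ((*v) S))" using 1 2 3 by (metis psubsetI)
    qed
    then obtain R where R: "R \<in> psd" "R ** R = T" using less.hyps T by blast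
    \<comment> \<open>Then \<open>R\<close> and \<open>outer v\<close> annihilate each other, and
      the cross terms in the square of the candidate root vanish.\<close>
    have Rv: "R *v v = 0"
    proof -
      have "(R *v v) \<bullet> (R *v v) = v \<bullet> (T *v v)"
        using symmetric_inner[OF psd_symmetric[OF R(1)]] R(2) by (simp add: matrix_vector_mul_assoc)
      then show ?thesis using Tv by simp
    qed
    have sq: "sqrt \<mu> *\<^sub>R outer v \<in> psd"
      using psd_outer[of v] \<open>\<mu> \<ge> 0\<close>
      by (auto simp: psd_def symmetric_scaleR scaleR_matrix_vector_assoc[symmetric])
    have "R ** outer v = 0"
      by (simp add: matrix_eq matrix_vector_mul_assoc[symmetric] outer_mult_vec
          matrix_vector_mult_scaleR Rv)
    moreover have "outer v ** R = 0"
    proof -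
      have "transpose (R ** outer v) = outer v ** R"
        using psd_symmetric[OF R(1)] by (simp add: symmetric_matrices_def)
      then show ?thesis using \<open>R ** outer v = 0\<close> by (simp add: transpose_zero)
    qed
    moreover have "outer v ** outer v = outer v"
      by (simp add: matrix_eq matrix_vector_mul_assoc[symmetric] outer_mult_vec
          matrix_vector_mult_scaleR vv)
    ultimately have "(R + sqrt \<mu> *\<^sub>R outer v) ** (R + sqrt \<mu> *\<^sub>R outer v) = T + \<mu> *\<^sub>R outer v"
      using mu by (simp add: matrix_mult.add_left matrix_mult.add_right matrix_mult.scaleR_left
          matrix_mult.scaleR_right R)
    then show ?thesis
      by (intro bexI[of _ "R + sqrt \<mu> *\<^sub>R outer v"] psd_add R sq) (simp_all add: T_def)
  qed
qed

text \<open>Uniqueness: an eigenvector of \<open>R - Q\<close> with nonzero eigenvalue would lie in the kernels of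
  both \<open>R\<close> and \<open>Q\<close>.\<close>

lemma psd_sqrt_unique:
  fixes R Q :: "real^'d^'d"
  assumes R: "R \<in> psd" and Q: "Q \<in> psd" and eq: "R ** R = Q ** Q"
  shows "R = Q"
proof (rule ccontr)
  assume "R \<noteq> Q"
  then have "R - Q \<noteq> 0" by simp
  then obtain \<mu> v where v: "\<mu> \<noteq> 0" "v \<noteq> 0" "(R - Q) *v v = \<mu> *\<^sub>R v"
    using symmetric_nonzero_eigenvector[OF symmetric_diff[OF psd_symmetric[OF R] psd_symmetric[OF Q]]]
    by blast
  have d: "R *v v - Q *v v = \<mu> *\<^sub>R v" using v by (simp add: matrix_vector_mult_diff_rdistrib)
  have "(R *v v) \<bullet> (R *v v) = v \<bullet> ((R ** R) *v v)"
    using symmetric_inner[OF psd_symmetric[OF R]] by (simp add: matrix_vector_mul_assoc)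
  moreover have "(Q *v v) \<bullet> (Q *v v) = v \<bullet> ((Q ** Q) *v v)"
    using symmetric_inner[OF psd_symmetric[OF Q]] by (simp add: matrix_vector_mul_assoc)
  ultimately have "(R *v v - Q *v v) \<bullet> (R *v v + Q *v v) = 0"
    using eq by (simp add: inner_diff_left inner_diff_right inner_add_right inner_commute)
  then have "v \<bullet> (R *v v) + v \<bullet> (Q *v v) = 0"
    unfolding d using v by (simp add: inner_add_right distrib_left[symmetric] del: mult_eq_0_iff)
  then have "v \<bullet> (R *v v) = 0" "v \<bullet> (Q *v v) = 0"
    using psd_nonneg[OF R, of v] psd_nonneg[OF Q, of v] by auto
  then have "R *v v = 0" "Q *v v = 0" using psd_kernel R Q by blast+
  then show False using d v by simp
qed

lemma psd_sqrt_works: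
  assumes "S \<in> psd"
  shows psd_sqrt_psd: "psd_sqrt S \<in> psd" and psd_sqrt_square: "psd_sqrt S ** psd_sqrt S = S"
proof -
  have "\<exists>!R. R \<in> psd \<and> R ** R = S"
    using psd_sqrt_exists[OF assms] psd_sqrt_unique by blast
  from theI'[OF this] show "psd_sqrt S \<in> psd" "psd_sqrt S ** psd_sqrt S = S"
    by (auto simp: psd_sqrt_def)
qed

lemma psd_sqrt_eqI: "R \<in> psd \<Longrightarrow> psd_sqrt (R ** R) = R"
  unfolding psd_sqrt_def using psd_sqrt_unique by (intro the_equality) auto

lemma closed_psd: "closed (psd :: (real^'d^'d) set)"
proof -
  have "(psd :: (real^'d^'d) set) = {S. transpose S = S} \<inter> (\<Inter>v. {S. 0 \<le> v \<bullet> (S *v v)})"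
    by (auto simp: psd_def symmetric_matrices_def)
  also have "closed \<dots>"
    by (intro closed_Int closed_INT ballI closed_Collect_eq closed_Collect_le continuous_intros)
  finally show ?thesis .
qed

lemma transpose_psd_sqrt: "S \<in> psd \<Longrightarrow> transpose (psd_sqrt S) = psd_sqrt S"
  using psd_symmetric[OF psd_sqrt_psd] by (simp add: symmetric_matrices_def)

text \<open>The squared Euclidean norm of the root is the trace of \<open>S\<close>. Roots of a
  bounded set therefore stay bounded, which is the compactness input for continuity.\<close>

lemma psd_sqrt_norm:
  assumes "S \<in> psd"
  shows "(norm (psd_sqrt S))\<^sup>2 \<le> real CARD('d) * norm (S :: real^'d^'d)"
proof -
  let ?R = "psd_sqrt S"
  have "?R $ i \<bullet> ?R $ i = S $ i $ i" for i
  proof -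
    have "(?R ** ?R) $ i $ i = (\<Sum>k\<in>UNIV. ?R $ i $ k * ?R $ k $ i)"
      by (simp add: matrix_matrix_mult_def)
    also have "\<dots> = (\<Sum>k\<in>UNIV. ?R $ i $ k * ?R $ i $ k)"
      using symmetric_nth[OF psd_symmetric[OF psd_sqrt_psd[OF assms]]] by simp
    finally show ?thesis by (simp add: inner_vec_def psd_sqrt_square[OF assms])
  qed
  then have "(norm ?R)\<^sup>2 = (\<Sum>i\<in>UNIV. S $ i $ i)"
    by (simp add: power2_norm_eq_inner inner_vec_def[of ?R])
  also have "\<dots> \<le> (\<Sum>i\<in>(UNIV::'d set). norm S)"
  proof (intro sum_mono)
    fix i
    have "S $ i $ i \<le> norm (S $ i)" using component_le_norm_cart[of "S $ i" i] by linarith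
    also have "\<dots> \<le> norm S" by (rule Finite_Cartesian_Product.norm_nth_le)
    finally show "S $ i $ i \<le> norm S" .
  qed
  finally show ?thesis by simp
qed

text \<open>Compactness plus uniqueness: the roots along a convergent sequence are bounded, and
  every limit point of them is a semidefinite matrix whose square is the limit, hence equals its
  root.\<close>

lemma continuous_on_psd_sqrt: "continuous_on psd (psd_sqrt :: real^'d^'d \<Rightarrow> real^'d^'d)"
proof (rule continuous_on_sequentiallyI)
  fix u :: "nat \<Rightarrow> real^'d^'d" and a
  assume u: "\<forall>n. u n \<in> psd" and a: "a \<in> psd" and lim: "u \<longlonglongrightarrow> a"
  obtain b where b: "\<And>n. norm (u n) \<le> b"
    using convergent_imp_bounded[OF lim] by (auto simp: bounded_iff)
  define K where "K = cball 0 (sqrt (real CARD('d) * b)) \<inter> (psd :: (real^'d^'d) set)"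
  have K: "compact K" unfolding K_def by (intro compact_Int_closed compact_cball closed_psd)
  have inK: "psd_sqrt (u n) \<in> K" for n
  proof -
    have "(norm (psd_sqrt (u n)))\<^sup>2 \<le> real CARD('d) * b"
      by (rule order_trans[OF psd_sqrt_norm mult_left_mono[OF b]]) (use u in auto)
    then show ?thesis using u by (simp add: K_def real_le_rsqrt psd_sqrt_psd)
  qed
  show "(\<lambda>n. psd_sqrt (u n)) \<longlonglongrightarrow> psd_sqrt a"
  proof (rule ccontr)
    assume "\<not> ?thesis"
    then obtain e where e: "e > 0" "\<exists>\<^sub>F n in sequentially. e \<le> dist (psd_sqrt (u n)) (psd_sqrt a)"
      by (auto simp: tendsto_iff frequently_def not_less not_le)
    then have "infinite {n. e \<le> dist (psd_sqrt (u n)) (psd_sqrt a)}"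
      by (simp add: frequently_cofinite[symmetric] cofinite_eq_sequentially)
    from infinite_enumerate[OF this] obtain r :: "nat \<Rightarrow> nat" where r: "strict_mono r"
      "\<And>n. e \<le> dist (psd_sqrt (u (r n))) (psd_sqrt a)" by blast
    obtain l s where l: "l \<in> K" "strict_mono s" "(\<lambda>n. psd_sqrt (u (r (s n)))) \<longlonglongrightarrow> l"
      using seq_compactE[OF compact_imp_seq_compact[OF K], of "\<lambda>n. psd_sqrt (u (r n))"] inK
      unfolding o_def by metis
    have "(\<lambda>n. psd_sqrt (u (r (s n))) ** psd_sqrt (u (r (s n)))) \<longlonglongrightarrow> l ** l"
      by (intro matrix_mult.tendsto l)
    then have "(\<lambda>n. u (r (s n))) \<longlonglongrightarrow> l ** l"
      using u by (simp add: psd_sqrt_square)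
    moreover have "(\<lambda>n. u (r (s n))) \<longlonglongrightarrow> a"
      using LIMSEQ_subseq_LIMSEQ[OF LIMSEQ_subseq_LIMSEQ[OF lim r(1)] l(2)] by (simp add: o_def)
    ultimately have "l ** l = a" using LIMSEQ_unique by blast
    then have "l = psd_sqrt a" using l(1) psd_sqrt_eqI[of l] by (simp add: K_def)
    then have "(\<lambda>n. dist (psd_sqrt (u (r (s n)))) (psd_sqrt a)) \<longlonglongrightarrow> 0"
      using l(3) by (simp only: tendsto_dist_iff[symmetric])
    then have "e \<le> 0" by (rule LIMSEQ_le_const) (use r in auto)
    then show False using e by simp
  qed
qed

lemma psd_sets [measurable]: "psd \<in> sets borel"
  by (rule borel_closed[OF closed_psd])

lemma posdef_sqrt_invertible:
  assumes "S \<in> posdef" shows "invertible (psd_sqrt S)"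
proof -
  have "psd_sqrt S ** psd_sqrt S = S" using assms by (simp add: posdef_psd psd_sqrt_square)
  then show ?thesis using posdef_invertible[OF assms]
    by (metis invertible_kernel matrix_vector_mul_assoc matrix_vector_mult_0_right)
qed

section \<open>The matrix exponential\<close>

primrec mat_pow :: "real^'d^'d \<Rightarrow> nat \<Rightarrow> real^'d^'d" where
  "mat_pow B 0 = mat 1"
| "mat_pow B (Suc k) = B ** mat_pow B k"

text \<open>An entrywise power series, so that the scalar theorem on termwise differentiation
  applies to each entry.\<close>

definition mat_exp :: "real^'d^'d \<Rightarrow> real \<Rightarrow> real^'d^'d" where
  "mat_exp B t = (\<chi> i j. \<Sum>k. mat_pow B k $ i $ j / fact k * t ^ k)"

lemma mat_pow_commute: "B ** mat_pow B k = mat_pow B k ** B"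
proof (induction k)
  case (Suc k)
  have "B ** mat_pow B (Suc k) = B ** (mat_pow B k ** B)" by (simp add: Suc)
  then show ?case by (simp add: matrix_mul_assoc)
qed simp

lemma norm_mat_pow_le: "\<exists>c\<ge>0. \<forall>k. norm (mat_pow B k) \<le> c ^ k * norm (mat 1 :: real^'d^'d)"
  for B :: "real^'d^'d"
proof -
  obtain K where K: "K > 0" "\<And>(a :: real^'d^'d) (b :: real^'d^'d). norm (a ** b) \<le> norm a * norm b * K"
    using bounded_bilinear.pos_bounded[OF bounded_bilinear_matrix_matrix_mult] by blast
  have "norm (mat_pow B k) \<le> (norm B * K) ^ k * norm (mat 1 :: real^'d^'d)" for k
  proof (induction k)
    case (Suc k)
    have "norm (mat_pow B (Suc k)) \<le> (norm B * K) * norm (mat_pow B k)"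
      using K(2)[of B "mat_pow B k"] by (simp add: mult_ac)
    also have "\<dots> \<le> (norm B * K) * ((norm B * K) ^ k * norm (mat 1 :: real^'d^'d))"
      using Suc K(1) by (intro mult_left_mono) auto
    finally show ?case by (simp add: mult_ac)
  qed simp
  then show ?thesis using K(1) by (intro exI[of _ "norm B * K"]) auto
qed

lemma summable_mat_exp:
  fixes B :: "real^'d^'d"
  shows "summable (\<lambda>k. mat_pow B k $ i $ j / fact k * t ^ k)"
proof -
  obtain c where c: "c \<ge> 0" "\<And>k. norm (mat_pow B k) \<le> c ^ k * norm (mat 1 :: real^'d^'d)"
    using norm_mat_pow_le by blast
  have "summable (\<lambda>k. norm (mat 1 :: real^'d^'d) * (inverse (fact k) * (c * \<bar>t\<bar>) ^ k))"
    by (intro summable_mult summable_exp)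
  then show ?thesis
  proof (rule summable_comparison_test'[where N = 0])
    fix k
    have "\<bar>mat_pow B k $ i $ j\<bar> \<le> norm (mat_pow B k $ i)" by (rule component_le_norm_cart)
    also have "\<dots> \<le> norm (mat_pow B k)" by (rule Finite_Cartesian_Product.norm_nth_le)
    also note c(2)
    finally have "\<bar>mat_pow B k $ i $ j\<bar> * (inverse (fact k) * \<bar>t\<bar> ^ k)
        \<le> c ^ k * norm (mat 1 :: real^'d^'d) * (inverse (fact k) * \<bar>t\<bar> ^ k)"
      by (intro mult_right_mono) auto
    then show "norm (mat_pow B k $ i $ j / fact k * t ^ k)
        \<le> norm (mat 1 :: real^'d^'d) * (inverse (fact k) * (c * \<bar>t\<bar>) ^ k)"
      by (simp add: abs_mult power_abs divide_inverse mult_ac power_mult_distrib)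
  qed
qed

text \<open>Termwise differentiation shifts the powers of \<open>B\<close> by one. Pulling the extra
  factor out of the series on the left or on the right gives the two products, which therefore
  agree.\<close>

lemma mat_exp_component_deriv:
  fixes B :: "real^'d^'d"
  shows
  "((\<lambda>t. mat_exp B t $ i $ j) has_field_derivative (mat_exp B t ** B) $ i $ j) (at t)"
  "mat_exp B t ** B = B ** mat_exp B t"
proof -
  have diffs: "diffs (\<lambda>k. mat_pow B k $ i $ j / fact k) k = mat_pow B (Suc k) $ i $ j / fact k" for k i j
    by (simp add: diffs_def field_simps del: of_nat_Suc)
  have 1: "(\<Sum>k. mat_pow B (Suc k) $ i $ j / fact k * t ^ k) = (B ** mat_exp B t) $ i $ j" for i j
  proof -
    have "(\<Sum>k. mat_pow B (Suc k) $ i $ j / fact k * t ^ k)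
        = (\<Sum>k. \<Sum>l\<in>UNIV. B $ i $ l * (mat_pow B k $ l $ j / fact k * t ^ k))"
      by (simp add: matrix_matrix_mult_def sum_distrib_left sum_divide_distrib mult_ac)
    also have "\<dots> = (\<Sum>l\<in>UNIV. \<Sum>k. B $ i $ l * (mat_pow B k $ l $ j / fact k * t ^ k))"
      by (intro suminf_sum summable_mult summable_mat_exp)
    also have "\<dots> = (\<Sum>l\<in>UNIV. B $ i $ l * (\<Sum>k. mat_pow B k $ l $ j / fact k * t ^ k))"
      by (intro sum.cong refl suminf_mult summable_mat_exp)
    finally show ?thesis by (simp add: matrix_matrix_mult_def mat_exp_def)
  qed
  have 2: "(\<Sum>k. mat_pow B (Suc k) $ i $ j / fact k * t ^ k) = (mat_exp B t ** B) $ i $ j" for i j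
  proof -
    have "(\<Sum>k. mat_pow B (Suc k) $ i $ j / fact k * t ^ k)
        = (\<Sum>k. \<Sum>l\<in>UNIV. (mat_pow B k $ i $ l / fact k * t ^ k) * B $ l $ j)"
      unfolding mat_pow.simps mat_pow_commute
      by (simp add: matrix_matrix_mult_def sum_distrib_left sum_divide_distrib mult_ac)
    also have "\<dots> = (\<Sum>l\<in>UNIV. \<Sum>k. (mat_pow B k $ i $ l / fact k * t ^ k) * B $ l $ j)"
      by (intro suminf_sum summable_mult2 summable_mat_exp)
    also have "\<dots> = (\<Sum>l\<in>UNIV. (\<Sum>k. mat_pow B k $ i $ l / fact k * t ^ k) * B $ l $ j)"
      by (intro sum.cong refl suminf_mult2[symmetric] summable_mat_exp)
    finally show ?thesis by (simp add: matrix_matrix_mult_def mat_exp_def)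
  qed
  show "mat_exp B t ** B = B ** mat_exp B t" using 1 2 by (simp add: vec_eq_iff)
  have "((\<lambda>t. \<Sum>k. mat_pow B k $ i $ j / fact k * t ^ k) has_field_derivative
      (\<Sum>k. diffs (\<lambda>k. mat_pow B k $ i $ j / fact k) k * t ^ k)) (at t)"
    by (rule termdiffs_strong_converges_everywhere) (rule summable_mat_exp)
  then show "((\<lambda>t. mat_exp B t $ i $ j) has_field_derivative (mat_exp B t ** B) $ i $ j) (at t)"
    unfolding diffs 2 by (simp add: mat_exp_def)
qed

lemma has_vector_derivative_matrixI:
  fixes f :: "real \<Rightarrow> real^'n^'m"
  assumes "\<And>i j. ((\<lambda>t. f t $ i $ j) has_field_derivative f' $ i $ j) (at t within S)"
  shows "(f has_vector_derivative f') (at t within S)"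
  unfolding has_vector_derivative_def
proof (subst has_derivative_componentwise_within, intro ballI)
  fix b :: "real^'n^'m" assume "b \<in> Basis"
  then obtain i j where b: "b = axis i (axis j 1)" by (auto simp: Basis_vec_def)
  show "((\<lambda>x. f x \<bullet> b) has_derivative (\<lambda>x. x *\<^sub>R f' \<bullet> b)) (at t within S)"
    using assms[of i j] unfolding b has_field_derivative_def
    by (simp add: inner_axis mult_commute_abs)
qed

lemma mat_exp_derivative:
  "(mat_exp B has_vector_derivative (B ** mat_exp B t)) (at t within S)"
  unfolding mat_exp_component_deriv(2)[symmetric]
  by (intro has_vector_derivative_matrixI has_field_derivative_at_within[OF mat_exp_component_deriv(1)])

lemma mat_exp_0 [simp]: "mat_exp B 0 = (mat 1 :: real^'d^'d)"
proof -
  have "(\<Sum>k. mat_pow B k $ i $ j / fact k * 0 ^ k) = (mat 1 :: real^'d^'d) $ i $ j" for i j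
    using powser_zero[of "\<lambda>k. mat_pow B k $ i $ j / fact k"] by simp
  then show ?thesis by (simp add: mat_exp_def vec_eq_iff)
qed

lemma continuous_on_mat_exp [continuous_intros]:
  assumes "continuous_on S f"
  shows "continuous_on S (\<lambda>x. mat_exp B (f x))"
proof -
  have "continuous_on UNIV (mat_exp B)"
    by (intro continuous_at_imp_continuous_on ballI)
      (rule has_vector_derivative_continuous[OF mat_exp_derivative])
  from continuous_on_compose2[OF this assms] show ?thesis by simp
qed

text \<open>The derivative of the product vanishes because \<open>B\<close> commutes with its
  exponential; the constant is read off at time 0.\<close>

lemma mat_exp_minus: "mat_exp B t ** mat_exp B (- t) = mat 1"
proof -
  have "((\<lambda>t. mat_exp B t ** mat_exp B (- t)) has_vector_derivative 0) (at s within UNIV)" for s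
  proof -
    have 1: "((\<lambda>t. mat_exp B (- t)) has_vector_derivative - (B ** mat_exp B (- s))) (at s within UNIV)"
    proof -
      have "(uminus has_vector_derivative - 1) (at s within UNIV)"
        by (auto intro!: derivative_eq_intros)
      from vector_diff_chain_within[OF this mat_exp_derivative[of B]] show ?thesis
        by (simp add: o_def)
    qed
    have "((\<lambda>t. mat_exp B t ** mat_exp B (- t)) has_vector_derivative
        (mat_exp B s ** - (B ** mat_exp B (- s)) + (B ** mat_exp B s) ** mat_exp B (- s))) (at s within UNIV)"
      by (rule matrix_mult.has_vector_derivative[OF mat_exp_derivative 1])
    moreover have "mat_exp B s ** - (B ** mat_exp B (- s)) + (B ** mat_exp B s) ** mat_exp B (- s) = 0"
      by (simp add: matrix_mult.minus_right matrix_mul_assoc mat_exp_component_deriv(2))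
    ultimately show ?thesis by simp
  qed
  note deriv = this
  have "\<exists>c. \<forall>t. mat_exp B t ** mat_exp B (- t) = c"
  proof (rule has_vector_derivative_zero_constant[OF convex_UNIV deriv])
    fix c assume "\<And>t. t \<in> UNIV \<Longrightarrow> mat_exp B t ** mat_exp B (- t) = c"
    then show "\<exists>c. \<forall>t. mat_exp B t ** mat_exp B (- t) = c" by auto
  qed
  then obtain c where c: "\<And>t. mat_exp B t ** mat_exp B (- t) = c" by auto
  from c[of 0] have "c = mat 1" by simp
  then show ?thesis using c by simp
qed

lemma invertible_mat_exp: "invertible (mat_exp B t)"
  unfolding invertible_def using mat_exp_minus[of B t] mat_exp_minus[of B "-t"]
  by (intro exI[of _ "mat_exp B (- t)"]) simp


section \<open>Stability\<close>

text \<open>Variation of constants. \<open>h\<close> removes the homogeneous solution, so its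
  derivative has modulus \<open>exp (a * t) * cmod (g t)\<close>. Once \<open>g\<close> is below
  \<open>\<epsilon>\<close>, the increment of \<open>h\<close> is dominated by that of
  \<open>\<epsilon> / a * exp (a * t)\<close>; dividing by \<open>exp (a * t)\<close> leaves a
  decaying term and a small one.\<close>

lemma linear_ode_tendsto_0:
  fixes f g :: "real \<Rightarrow> complex"
  assumes deriv: "\<And>t. (f has_vector_derivative (l * f t + g t)) (at t)"
    and g: "(g \<longlongrightarrow> 0) at_top" and l: "Re l < 0"
  shows "(f \<longlongrightarrow> 0) at_top"
proof -
  define a where "a = - Re l"
  have a: "a > 0" using l by (simp add: a_def)
  define h where "h t = exp (- (l * of_real t)) * f t" for t :: real
  have h: "(h has_vector_derivative (exp (- (l * of_real t)) * g t)) (at t)" for t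
  proof -
    have "((\<lambda>t. exp (- (l * of_real t))) has_vector_derivative (- l * exp (- (l * of_real t)))) (at t)"
      by (auto intro!: derivative_eq_intros has_vector_derivative_real_field simp: mult_ac)
    from has_vector_derivative_mult[OF this deriv[of t]] show ?thesis
      by (simp add: h_def[abs_def] algebra_simps)
  qed
  have nexp: "cmod (exp (- (l * of_real t))) = exp (a * t)" for t
    by (simp add: a_def norm_exp_eq_Re)
  have nh: "cmod (h t) = exp (a * t) * cmod (f t)" for t
    by (simp only: h_def norm_mult nexp)
  show ?thesis
  proof (rule tendstoI)
    fix e :: real assume e: "e > 0"
    \<comment> \<open>Chosen so that the forcing contributes at most
      \<open>\<epsilon> / a = e / 2\<close> to \<open>f\<close>.\<close>
    define \<epsilon> where "\<epsilon> = e * a / 2"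
    have eps: "\<epsilon> > 0" using e a by (simp add: \<epsilon>_def)
    obtain T where T: "\<And>t. t \<ge> T \<Longrightarrow> cmod (g t) < \<epsilon>"
      using tendstoD[OF g eps] by (auto simp: eventually_at_top_linorder)
    have bound: "cmod (f t) \<le> exp (- (a * (t - T))) * cmod (f T) + e / 2" if "t > T" for t
    proof -
      have "norm (h t - h T) \<le> \<epsilon> / a * exp (a * t) - \<epsilon> / a * exp (a * T)"
      proof (rule differentiable_bound_general[OF that])
        show "continuous_on {T..t} h"
          by (intro continuous_at_imp_continuous_on ballI has_vector_derivative_continuous[OF h])
        show "continuous_on {T..t} (\<lambda>t. \<epsilon> / a * exp (a * t))" by (intro continuous_intros)
        show "(h has_vector_derivative (exp (- (l * of_real x)) * g x)) (at x)" for x by (rule h)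
        show "((\<lambda>t. \<epsilon> / a * exp (a * t)) has_vector_derivative (\<epsilon> * exp (a * x))) (at x)" for x
          using a by (auto intro!: derivative_eq_intros simp: has_real_derivative_iff_has_vector_derivative[symmetric])
        show "norm (exp (- (l * of_real x)) * g x) \<le> \<epsilon> * exp (a * x)" if "T < x" for x
          using T[of x] that by (simp only: norm_mult nexp) (simp add: mult.commute)
      qed
      then have "cmod (h t) \<le> cmod (h T) + \<epsilon> / a * exp (a * t)"
        using norm_triangle_ineq2[of "h t" "h T"] a eps by (smt (verit) divide_pos_pos exp_gt_zero mult_pos_pos)
      then have "exp (a * t) * cmod (f t) \<le> exp (a * t) * (exp (- (a * (t - T))) * cmod (f T) + e / 2)"
        using a unfolding nh by (simp add: \<epsilon>_def algebra_simps exp_add[symmetric])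
      then show ?thesis by simp
    qed
    have "((\<lambda>t. exp (- (a * (t - T))) * cmod (f T)) \<longlongrightarrow> 0) at_top"
    proof -
      have "filterlim (\<lambda>t. a * (t - T)) at_top at_top"
        using filterlim_tendsto_pos_mult_at_top[OF tendsto_const a filterlim_tendsto_add_at_top[OF tendsto_const[of "-T"] filterlim_ident]]
        by simp
      then have "((\<lambda>t. exp (- (a * (t - T)))) \<longlongrightarrow> 0) at_top"
        by (intro filterlim_compose[OF exp_at_bot] filterlim_compose[OF filterlim_uminus_at_bot_at_top])
      from tendsto_mult_left_zero[OF this] show ?thesis .
    qed
    then have "\<forall>\<^sub>F t in at_top. dist (exp (- (a * (t - T))) * cmod (f T)) 0 < e / 2"
      using e by (intro tendstoD) auto
    then show "\<forall>\<^sub>F t in at_top. dist (f t) 0 < e"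
      using eventually_gt_at_top[of T]
    proof eventually_elim
      case (elim t)
      then show ?case using bound[of t] by simp
    qed
  qed
qed

section \<open>Polynomials in a matrix acting on a vector\<close>

lemma matrix_vector_mult_sum_right: "Z *v (\<Sum>i\<in>I. f i) = (\<Sum>i\<in>I. Z *v f i)"
  for Z :: "complex^'n^'m"
  by (induction I rule: infinite_finite_induct) (simp_all add: matrix_vector_right_distrib)

primrec krylov :: "complex^'d^'d \<Rightarrow> complex^'d \<Rightarrow> nat \<Rightarrow> complex^'d" where
  "krylov Z v 0 = v"
| "krylov Z v (Suc k) = Z *v krylov Z v k"

text \<open>This is p(Z) v, expanded in the Krylov vectors Z^k v.\<close>

definition poly_action :: "complex^'d^'d \<Rightarrow> complex poly \<Rightarrow> complex^'d \<Rightarrow> complex^'d" where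
  "poly_action Z p v = (\<Sum>k\<le>degree p. coeff p k *s krylov Z v k)"

lemma poly_action_altdef:
  assumes "degree p \<le> n"
  shows "poly_action Z p v = (\<Sum>k\<le>n. coeff p k *s krylov Z v k)"
  unfolding poly_action_def
  by (rule sum.mono_neutral_left) (use assms in \<open>auto simp: coeff_eq_0\<close>)

lemma krylov_mult: "krylov Z (Z *v v) k = Z *v krylov Z v k"
  by (induction k) simp_all

lemma krylov_diff: "krylov Z (v - w) k = krylov Z v k - krylov Z w k"
  by (induction k) (simp_all add: matrix_vector_mult_diff_distrib)

lemma krylov_smult: "krylov Z (c *s v) k = c *s krylov Z v k"
  by (induction k) (simp_all add: vector_scalar_commute)

lemma poly_action_pCons: "poly_action Z (pCons a p) v = a *s v + Z *v poly_action Z p v"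
proof -
  have "poly_action Z (pCons a p) v = (\<Sum>k\<le>Suc (degree p). coeff (pCons a p) k *s krylov Z v k)"
    by (rule poly_action_altdef) (rule degree_pCons_le)
  also have "\<dots> = a *s v + (\<Sum>k\<le>degree p. coeff p k *s (Z *v krylov Z v k))"
    by (simp add: sum.atMost_Suc_shift del: sum.atMost_Suc)
  also have "(\<Sum>k\<le>degree p. coeff p k *s (Z *v krylov Z v k)) = Z *v poly_action Z p v"
    by (simp add: poly_action_def matrix_vector_mult_sum_right vector_scalar_commute)
  finally show ?thesis .
qed

lemma poly_action_smult: "poly_action Z (smult c p) v = c *s poly_action Z p v"
  by (subst poly_action_altdef[of _ "degree p"]) (simp_all add: poly_action_def degree_smult_le vec.scale_sum_right)

lemma poly_action_add: "poly_action Z (p + q) v = poly_action Z p v + poly_action Z q v"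
proof -
  let ?n = "max (degree p) (degree q)"
  show ?thesis
    by (simp add: poly_action_altdef[of "p + q" ?n] poly_action_altdef[of p ?n]
        poly_action_altdef[of q ?n] degree_add_le_max sum.distrib vector_sadd_rdistrib)
qed

lemma poly_action_commute: "poly_action Z p (Z *v v - l *s v) = Z *v poly_action Z p v - l *s poly_action Z p v"
proof -
  have "poly_action Z p (Z *v v - l *s v) = (\<Sum>k\<le>degree p. Z *v (coeff p k *s krylov Z v k) - l *s (coeff p k *s krylov Z v k))"
    unfolding poly_action_def krylov_diff krylov_smult krylov_mult
    by (simp add: vector_ssub_ldistrib vector_scalar_commute vector_smult_assoc mult.commute)
  then show ?thesis
    by (simp add: sum_subtractf poly_action_def matrix_vector_mult_sum_right vec.scale_sum_right)
qed

lemma poly_action_root: "poly_action Z ([:- l, 1:] * q) v = Z *v poly_action Z q v - l *s poly_action Z q v"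
proof -
  have "[:- l, 1:] * q = pCons 0 q + smult (- l) q" by simp
  then show ?thesis
    by (simp only: poly_action_add poly_action_pCons poly_action_smult) simp
qed

text \<open>If two Krylov vectors coincide, the difference of two monomials annihilates
  \<open>v\<close>. Otherwise more of them are distinct than the real dimension of the space, and a
  linear dependence with real coefficients is the polynomial.\<close>

lemma annihilating_poly_exists:
  fixes Z :: "complex^'d^'d"
  shows "\<exists>p. p \<noteq> 0 \<and> poly_action Z p v = 0"
proof (cases "inj (krylov Z v)")
  case False
  then obtain i j where ij: "i \<noteq> j" "krylov Z v i = krylov Z v j" by (auto simp: inj_def)
  have m: "poly_action Z (monom c k) v = c *s krylov Z v k" for c k
  proof -
    have "poly_action Z (monom c k) v = (\<Sum>n\<le>k. coeff (monom c k) n *s krylov Z v n)"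
      by (rule poly_action_altdef) (rule degree_monom_le)
    also have "\<dots> = (\<Sum>n\<in>{k}. coeff (monom c k) n *s krylov Z v n)"
      by (rule sum.mono_neutral_right) auto
    finally show ?thesis by simp
  qed
  have "coeff (monom 1 i + monom (- 1) j) i = (1 :: complex)" using ij by simp
  then have "monom 1 i + monom (- 1) j \<noteq> (0 :: complex poly)" by (metis coeff_0 zero_neq_one)
  moreover have "poly_action Z (monom 1 i + monom (- 1) j) v = 0"
    by (simp add: poly_action_add m ij)
  ultimately show ?thesis by blast
next
  case True
  define n where "n = DIM(complex^'d)"
  let ?S = "krylov Z v ` {..n}"
  have "card ?S = Suc n" by (subst card_image) (auto intro: inj_on_subset[OF True])
  then have "dependent ?S" using independent_bound[of ?S] by (auto simp: n_def)
  then obtain u where u: "\<exists>w\<in>?S. u w \<noteq> 0" "(\<Sum>w\<in>?S. u w *\<^sub>R w) = 0"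
    by (auto simp: dependent_finite)
  define p where "p = Poly (map (\<lambda>k. complex_of_real (u (krylov Z v k))) [0..<Suc n])"
  have c: "coeff p k = (if k \<le> n then complex_of_real (u (krylov Z v k)) else 0)" for k
    by (simp add: p_def nth_default_def del: upt_Suc)
  have "poly_action Z p v = (\<Sum>k\<le>n. coeff p k *s krylov Z v k)"
    by (rule poly_action_altdef) (auto simp: c intro: degree_le)
  also have "\<dots> = (\<Sum>k\<le>n. u (krylov Z v k) *\<^sub>R krylov Z v k)"
    by (intro sum.cong) (simp_all add: c vec_eq_iff scaleR_conv_of_real[where 'a = complex])
  also have "\<dots> = 0"
    using u(2) by (subst (asm) sum.reindex) (auto intro: inj_on_subset[OF True] simp: o_def)
  finally have "poly_action Z p v = 0" .
  moreover have "p \<noteq> 0"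
  proof
    assume "p = 0"
    then have "u (krylov Z v k) = 0" if "k \<le> n" for k using c[of k] that by simp
    then show False using u(1) by auto
  qed
  ultimately show ?thesis by blast
qed

text \<open>Peeling off one root \<open>l\<close> of an annihilating polynomial: if \<open>l\<close> is an eigenvalue, the orbit of \<open>v\<close>
  solves a scalar stable equation forced by the orbit of \<open>(Z - l) v\<close>; otherwise \<open>Z - l\<close> can be cancelled.\<close>

lemma stable_orbit:
  fixes f :: "complex^'d \<Rightarrow> real \<Rightarrow> complex^'d"
  assumes deriv: "\<And>v i t. ((\<lambda>t. f v t $ i) has_vector_derivative f (Z *v v) t $ i) (at t)"
    and lin: "\<And>v w c t. f (v - c *s w) t = f v t - c *s f w t"
    and eig: "\<And>l v. v \<noteq> 0 \<Longrightarrow> Z *v v = l *s v \<Longrightarrow> Re l < 0"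
    and p: "p \<noteq> 0" "poly_action Z p v = 0"
  shows "((\<lambda>t. f v t $ i) \<longlongrightarrow> 0) at_top"
  using p
proof (induction "degree p" arbitrary: p v i rule: less_induct)
  case less
  show ?case
  proof (cases "degree p = 0")
    case True
    then obtain c where c: "p = [:c:]" by (rule degree_eq_zeroE)
    then have "c *s v = 0" "c \<noteq> 0" using less.prems by (auto simp: poly_action_def)
    then have "v = 0" by simp
    \<comment> \<open>With \<open>v = w = 0\<close> and \<open>c = 1\<close>, linearity reads f 0 =
      f 0 - f 0.\<close>
    then have "f v t = 0" for t using lin[of 0 1 0 t] by simp
    then show ?thesis by simp
  next
    case False
    then have "\<not> constant (poly p)" by (simp add: constant_degree)
    then obtain l where "poly p l = 0" using fundamental_theorem_of_algebra by blast
    then obtain q where q: "p = [:- l, 1:] * q" by (metis dvdE poly_eq_0_iff_dvd)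
    have q0: "q \<noteq> 0" using q less.prems by auto
    have "degree p = Suc (degree q)" unfolding q using q0 by (subst degree_mult_eq) auto
    then have deg: "degree q < degree p" by simp
    show ?thesis
    proof (cases "Re l < 0")
      case True
      let ?u = "Z *v v - l *s v"
      have "poly_action Z q ?u = 0"
        using less.prems(2) by (simp only: q poly_action_root poly_action_commute)
      then have g: "((\<lambda>t. f ?u t $ i) \<longlongrightarrow> 0) at_top" using less.hyps[OF deg q0] by blast
      have "((\<lambda>t. f v t $ i) has_vector_derivative (l * f v t $ i + f ?u t $ i)) (at t)" for t
        using deriv[of v i t] by (simp add: lin)
      from linear_ode_tendsto_0[OF this g True] show ?thesis .
    next
      case False
      have "Z *v poly_action Z q v = l *s poly_action Z q v"
        using less.prems(2) unfolding q poly_action_root by simp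
      then have "poly_action Z q v = 0" using eig False by blast
      then show ?thesis using less.hyps[OF deg q0] by blast
    qed
  qed
qed

text \<open>Decay is shown orbit by orbit over the complex vectors, each vector with its own
  annihilating polynomial in place of a Jordan form. The entries of the exponential are components
  of the orbits of the basis vectors.\<close>

theorem mat_exp_tendsto_0:
  fixes B :: "real^'d^'d"
  assumes "\<And>z. complex_eigenvalue B z \<Longrightarrow> Re z < 0"
  shows "(mat_exp B \<longlongrightarrow> 0) at_top"
proof -
  define f where "f v t = map_matrix complex_of_real (mat_exp B t) *v v" for v :: "complex^'d" and t
  let ?Z = "map_matrix complex_of_real B"
  have mm: "map_matrix complex_of_real (P ** Q) = map_matrix complex_of_real P ** map_matrix complex_of_real Q"
    for P Q :: "real^'d^'d"
    by (simp add: vec_eq_iff matrix_matrix_mult_def)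
  have deriv: "((\<lambda>t. f v t $ i) has_vector_derivative f (?Z *v v) t $ i) (at t)" for v i t
  proof -
    have "((\<lambda>t. \<Sum>j\<in>UNIV. complex_of_real (mat_exp B t $ i $ j) * v $ j) has_vector_derivative
        (\<Sum>j\<in>UNIV. complex_of_real ((mat_exp B t ** B) $ i $ j) * v $ j)) (at t)"
      using mat_exp_component_deriv(1)[of B i _ t]
      by (intro has_vector_derivative_sum has_vector_derivative_mult_left has_vector_derivative_of_real)
        (simp add: has_real_derivative_iff_has_vector_derivative[symmetric])
    moreover have "(\<Sum>j\<in>UNIV. complex_of_real (M $ i $ j) * v $ j) = (map_matrix complex_of_real M *v v) $ i"
      for M :: "real^'d^'d"
      by (simp add: matrix_vector_mult_def)
    ultimately show ?thesis by (simp add: f_def mm matrix_vector_mul_assoc)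
  qed
  have lin: "f (v - c *s w) t = f v t - c *s f w t" for v w c t
    by (simp add: f_def matrix_vector_mult_diff_distrib vector_scalar_commute)
  have eig: "Re l < 0" if "v \<noteq> 0" "?Z *v v = l *s v" for l v
    using assms that by (auto simp: complex_eigenvalue_def)
  have lim: "((\<lambda>t. f v t $ i) \<longlongrightarrow> 0) at_top" for v i
  proof -
    obtain p where p: "p \<noteq> 0" "poly_action ?Z p v = 0" using annihilating_poly_exists by blast
    show ?thesis by (rule stable_orbit[where Z = ?Z and p = p]) (rule deriv lin eig p; assumption?)+
  qed
  have "((\<lambda>t. mat_exp B t $ i $ j) \<longlongrightarrow> 0) at_top" for i j
  proof -
    have "f (axis j 1) t $ i = complex_of_real (mat_exp B t $ i $ j)" for t
      by (simp add: f_def matrix_vector_mult_def axis_def if_distrib cong: if_cong)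
    then have "((\<lambda>t. complex_of_real (mat_exp B t $ i $ j)) \<longlongrightarrow> complex_of_real 0) at_top"
      using lim[of "axis j 1" i] by simp
    then show ?thesis by (simp only: tendsto_of_real_iff)
  qed
  then show ?thesis by (intro vec_tendstoI) simp
qed

section \<open>Translation-invariant measures on subspaces\<close>

text \<open>Haar measure of a subspace \<open>V\<close>, carried by the ambient space. Lebesgue
  measure on vectors, on symmetric matrices and on square matrices are the instances, so one change
  of variables formula serves for all three.\<close>

locale invariant_measure =
  fixes \<mu> :: "'a::euclidean_space measure" and V :: "'a set"
  assumes sets_eq [measurable_cong, simp]: "sets \<mu> = sets borel"
    and V: "subspace V"
    and AE_V: "AE x in \<mu>. x \<in> V"
    and translate: "\<And>v. v \<in> V \<Longrightarrow> distr \<mu> borel (\<lambda>x. x + v) = \<mu>"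
    and finite_ball: "\<And>r. emeasure \<mu> (ball 0 r) < \<infinity>"
    and pos_ball: "\<And>r. 0 < r \<Longrightarrow> 0 < emeasure \<mu> (ball 0 r)"
begin

lemma space_eq [simp]: "space \<mu> = UNIV"
  using sets_eq_imp_space_eq[OF sets_eq] by simp

lemma sigma_finite: "sigma_finite_measure \<mu>"
proof (rule sigma_finite_measure.intro, intro exI conjI)
  show "countable ((\<lambda>n. ball 0 (real n) :: 'a set) ` UNIV)" by blast
  show "(\<lambda>n. ball 0 (real n)) ` UNIV \<subseteq> sets \<mu>" by auto
  show "\<Union> ((\<lambda>n. ball 0 (real n) :: 'a set) ` UNIV) = space \<mu>"
    by (auto simp: reals_Archimedean2)
  show "\<forall>a\<in>(\<lambda>n. ball 0 (real n)) ` UNIV. emeasure \<mu> a \<noteq> \<infinity>"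
    using finite_ball by (auto simp: less_top)
qed

lemma nn_integral_translate:
  assumes "v \<in> V" and [measurable]: "f \<in> borel_measurable borel"
  shows "(\<integral>\<^sup>+x. f (x + v) \<partial>\<mu>) = (\<integral>\<^sup>+x. f x \<partial>\<mu>)"
proof -
  have "(\<integral>\<^sup>+x. f x \<partial>\<mu>) = (\<integral>\<^sup>+x. f x \<partial>distr \<mu> borel (\<lambda>x. x + v))" by (simp add: translate assms(1))
  also have "\<dots> = (\<integral>\<^sup>+x. f (x + v) \<partial>\<mu>)" by (rule nn_integral_distr) measurable
  finally show ?thesis ..
qed

text \<open>Uniqueness of invariant measures in product form, by Fubini and two shifts.\<close>

lemma invariant_cross:
  fixes f g :: "'a \<Rightarrow> ennreal"
  assumes sets [measurable_cong]: "sets \<nu> = sets borel" and sf: "sigma_finite_measure \<nu>"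
    and AE: "AE x in \<nu>. x \<in> V"
    and inv: "\<And>v. v \<in> V \<Longrightarrow> distr \<nu> borel (\<lambda>x. x + v) = \<nu>"
    and [measurable]: "f \<in> borel_measurable borel" "g \<in> borel_measurable borel"
  shows "(\<integral>\<^sup>+x. f x \<partial>\<nu>) * (\<integral>\<^sup>+x. g x \<partial>\<mu>) = (\<integral>\<^sup>+x. g x \<partial>\<nu>) * (\<integral>\<^sup>+x. f (- x) \<partial>\<mu>)"
proof -
  interpret mu: sigma_finite_measure \<mu> by (rule sigma_finite)
  interpret nu: sigma_finite_measure \<nu> by (rule sf)
  interpret P: pair_sigma_finite \<mu> \<nu> ..
  have "(\<integral>\<^sup>+x. f x \<partial>\<nu>) * (\<integral>\<^sup>+x. g x \<partial>\<mu>) = (\<integral>\<^sup>+y. f y * (\<integral>\<^sup>+x. g x \<partial>\<mu>) \<partial>\<nu>)"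
    by (rule nn_integral_multc[symmetric]) measurable
  also have "\<dots> = (\<integral>\<^sup>+y. (\<integral>\<^sup>+x. f y * g (x + y) \<partial>\<mu>) \<partial>\<nu>)"
  proof (rule nn_integral_cong_AE)
    show "AE y in \<nu>. f y * (\<integral>\<^sup>+x. g x \<partial>\<mu>) = (\<integral>\<^sup>+x. f y * g (x + y) \<partial>\<mu>)"
      using AE by eventually_elim (simp add: nn_integral_cmult nn_integral_translate)
  qed
  also have "\<dots> = (\<integral>\<^sup>+x. (\<integral>\<^sup>+y. f y * g (x + y) \<partial>\<nu>) \<partial>\<mu>)"
    by (rule P.Fubini') measurable
  also have "\<dots> = (\<integral>\<^sup>+x. (\<integral>\<^sup>+y. f (y - x) * g y \<partial>\<nu>) \<partial>\<mu>)"
  proof (rule nn_integral_cong_AE)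
    show "AE x in \<mu>. (\<integral>\<^sup>+y. f y * g (x + y) \<partial>\<nu>) = (\<integral>\<^sup>+y. f (y - x) * g y \<partial>\<nu>)"
      using AE_V
    proof eventually_elim
      case (elim x)
      then have "distr \<nu> borel (\<lambda>y. y + x) = \<nu>" by (rule inv)
      then have "(\<integral>\<^sup>+y. f (y - x) * g y \<partial>\<nu>) = (\<integral>\<^sup>+y. f (y - x) * g y \<partial>distr \<nu> borel (\<lambda>y. y + x))" by simp
      also have "\<dots> = (\<integral>\<^sup>+y. f y * g (x + y) \<partial>\<nu>)"
        by (subst nn_integral_distr) (simp_all add: add.commute)
      finally show ?case ..
    qed
  qed
  also have "\<dots> = (\<integral>\<^sup>+y. (\<integral>\<^sup>+x. f (y - x) * g y \<partial>\<mu>) \<partial>\<nu>)"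
    by (rule P.Fubini'[symmetric]) measurable
  also have "\<dots> = (\<integral>\<^sup>+y. g y * (\<integral>\<^sup>+x. f (- x) \<partial>\<mu>) \<partial>\<nu>)"
  proof (rule nn_integral_cong_AE)
    show "AE y in \<nu>. (\<integral>\<^sup>+x. f (y - x) * g y \<partial>\<mu>) = g y * (\<integral>\<^sup>+x. f (- x) \<partial>\<mu>)"
      using AE
    proof eventually_elim
      case (elim y)
      then have "- y \<in> V" using V by (rule subspace_neg[rotated])
      from nn_integral_translate[OF this, of "\<lambda>x. f (- x)"]
      have "(\<integral>\<^sup>+x. f (y - x) \<partial>\<mu>) = (\<integral>\<^sup>+x. f (- x) \<partial>\<mu>)" by simp
      moreover have "(\<integral>\<^sup>+x. f (y - x) * g y \<partial>\<mu>) = (\<integral>\<^sup>+x. f (y - x) \<partial>\<mu>) * g y"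
        by (rule nn_integral_multc) measurable
      ultimately show ?case by (simp add: mult.commute)
    qed
  qed
  also have "\<dots> = (\<integral>\<^sup>+x. g x \<partial>\<nu>) * (\<integral>\<^sup>+x. f (- x) \<partial>\<mu>)"
    by (rule nn_integral_multc) measurable
  finally show ?thesis .
qed

text \<open>For \<open>T\<close> invertible on \<open>V\<close> this is 1 / |det T| on
  \<open>V\<close>, read off from the preimage of the unit ball.\<close>

definition scale :: "('a \<Rightarrow> 'a) \<Rightarrow> ennreal" where
  "scale T = emeasure \<mu> {x. T x \<in> ball 0 1} / emeasure \<mu> (ball 0 1)"

text \<open>The linear maps used later depend on integration variables, so their factors have to be
  measurable in the parameter.\<close>

lemma measurable_scale:
  assumes [measurable]: "(\<lambda>z. T (fst z) (snd z)) \<in> borel_measurable (N \<Otimes>\<^sub>M borel)"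
  shows "(\<lambda>p. scale (T p)) \<in> borel_measurable N"
proof -
  interpret sigma_finite_measure \<mu> by (rule sigma_finite)
  define c where "c = emeasure \<mu> (ball 0 1)"
  have "(\<lambda>p. (\<integral>\<^sup>+x. (if norm (T p x) < 1 then 1 else 0) \<partial>\<mu>) / c) \<in> borel_measurable N"
    by measurable
  moreover have "(\<integral>\<^sup>+x. (if norm (T p x) < 1 then 1 else 0) \<partial>\<mu>) = emeasure \<mu> {x. T p x \<in> ball 0 1}"
    if "p \<in> space N" for p
  proof -
    have [measurable]: "T p \<in> borel_measurable borel"
      using measurable_compose[OF measurable_Pair1'[OF that] assms] by simp
    have "(\<integral>\<^sup>+x. (if norm (T p x) < 1 then 1 else 0) \<partial>\<mu>) = (\<integral>\<^sup>+x. indicator {x. norm (T p x) < 1} x \<partial>\<mu>)"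
      by (intro nn_integral_cong) (simp add: indicator_def)
    also have "\<dots> = emeasure \<mu> {x. norm (T p x) < 1}"
      by (rule nn_integral_indicator) measurable
    finally show ?thesis by simp
  qed
  ultimately show ?thesis
    unfolding scale_def c_def by (subst measurable_cong) auto
qed

text \<open>The case \<open>\<nu> = \<mu>\<close> of \<open>invariant_cross\<close>, with the unit
  ball as the set whose finite positive measure is cancelled.\<close>

lemma nn_integral_uminus:
  assumes [measurable]: "f \<in> borel_measurable borel"
  shows "(\<integral>\<^sup>+x. f (- x) \<partial>\<mu>) = (\<integral>\<^sup>+x. f x \<partial>\<mu>)"
proof -
  let ?b = "emeasure \<mu> (ball 0 1)"
  have "(\<integral>\<^sup>+x. f x \<partial>\<mu>) * (\<integral>\<^sup>+x. indicator (ball 0 1) x \<partial>\<mu>)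
      = (\<integral>\<^sup>+x. indicator (ball 0 1) x \<partial>\<mu>) * (\<integral>\<^sup>+x. f (- x) \<partial>\<mu>)"
    by (rule invariant_cross[OF sets_eq sigma_finite AE_V translate])
      (simp_all add: borel_measurable_indicator)
  then have "?b * (\<integral>\<^sup>+x. f x \<partial>\<mu>) = ?b * (\<integral>\<^sup>+x. f (- x) \<partial>\<mu>)" by (simp add: mult.commute)
  then show ?thesis
    using pos_ball[of 1] finite_ball[of 1] by (subst (asm) ennreal_mult_cancel_left) auto
qed

text \<open>The image of \<open>\<mu>\<close> under \<open>T\<close> is again invariant, since a
  shift by \<open>v\<close> is the image of the shift by \<open>T' v\<close>. It is sigma-finite
  because \<open>T'\<close> confines the preimage of a ball to a ball. By
  \<open>invariant_cross\<close> it is then a multiple of \<open>\<mu>\<close>.\<close>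

lemma scale:
  assumes T: "bounded_linear T" "T ` V \<subseteq> V" and T': "bounded_linear T'" "T' ` V \<subseteq> V"
    and inv: "\<And>x. x \<in> V \<Longrightarrow> T (T' x) = x" "\<And>x. x \<in> V \<Longrightarrow> T' (T x) = x"
  shows nn_integral_scale: "f \<in> borel_measurable borel \<Longrightarrow>
      (\<integral>\<^sup>+x. f (T x) \<partial>\<mu>) = scale T * (\<integral>\<^sup>+x. f x \<partial>\<mu>)"
    and scale_pos: "0 < scale T" and scale_finite: "scale T < \<infinity>"
proof -
  have mT [measurable]: "T \<in> borel_measurable borel"
    using T(1) by (intro borel_measurable_continuous_onI linear_continuous_on)
  let ?b = "emeasure \<mu> (ball 0 1)"
  have b: "0 < ?b" "?b < \<infinity>" using pos_ball finite_ball by auto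
  obtain K where K: "K > 0" "\<And>x. norm (T x) \<le> norm x * K"
    using bounded_linear.pos_bounded[OF T(1)] by blast
  obtain K' where K': "K' > 0" "\<And>x. norm (T' x) \<le> norm x * K'"
    using bounded_linear.pos_bounded[OF T'(1)] by blast
  have fin: "emeasure \<mu> {x. T x \<in> ball 0 r} < \<infinity>" for r
  proof -
    have "emeasure \<mu> {x. T x \<in> ball 0 r} \<le> emeasure \<mu> (ball 0 (r * K'))"
    proof (rule emeasure_mono_AE)
      show "AE x in \<mu>. x \<in> {x. T x \<in> ball 0 r} \<longrightarrow> x \<in> ball 0 (r * K')"
        using AE_V
      proof eventually_elim
        case (elim x)
        have "norm x \<le> norm (T x) * K'" using K'(2)[of "T x"] inv(2)[OF elim] by simp
        then show ?case using K'(1) by (auto intro: le_less_trans)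
      qed
    qed measurable
    then show ?thesis using finite_ball le_less_trans by blast
  qed
  have pos: "0 < emeasure \<mu> {x. T x \<in> ball 0 1}"
  proof -
    have "ball 0 (1 / K) \<subseteq> {x. T x \<in> ball 0 1}"
    proof safe
      fix x :: 'a assume "x \<in> ball 0 (1 / K)"
      then have "norm x * K < 1" using K(1) by (simp add: field_simps)
      then show "T x \<in> ball 0 1" using K(2)[of x] by simp
    qed
    then have "emeasure \<mu> (ball 0 (1 / K)) \<le> emeasure \<mu> {x. T x \<in> ball 0 1}"
      by (intro emeasure_mono) auto
    then show ?thesis using pos_ball[of "1 / K"] K(1) by (meson divide_pos_pos less_le_trans zero_less_one)
  qed
  show "0 < scale T" unfolding scale_def using pos b
    by (simp add: ennreal_zero_less_divide)
  show "scale T < \<infinity>" unfolding scale_def using fin[of 1] b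
    by (simp add: ennreal_divide_eq_top_iff less_top[symmetric] zero_less_iff_neq_zero)
  define \<nu> where "\<nu> = distr \<mu> borel T"
  have s [measurable_cong]: "sets \<nu> = sets borel" by (simp add: \<nu>_def)
  have sf: "sigma_finite_measure \<nu>"
  proof (rule sigma_finite_measure.intro, intro exI conjI)
    show "countable ((\<lambda>n. ball 0 (real n) :: 'a set) ` UNIV)" by blast
    show "(\<lambda>n. ball 0 (real n)) ` UNIV \<subseteq> sets \<nu>" by (auto simp: s)
    show "\<Union> ((\<lambda>n. ball 0 (real n) :: 'a set) ` UNIV) = space \<nu>"
      by (auto simp: reals_Archimedean2 \<nu>_def)
    show "\<forall>a\<in>(\<lambda>n. ball 0 (real n)) ` UNIV. emeasure \<nu> a \<noteq> \<infinity>"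
      using fin by (auto simp: \<nu>_def emeasure_distr vimage_def less_top)
  qed
  have V_sets [measurable]: "V \<in> sets borel" using closed_subspace[OF V] by (rule borel_closed)
  have AE: "AE x in \<nu>. x \<in> V"
    unfolding \<nu>_def by (subst AE_distr_iff) (use AE_V T(2) in auto)
  have inv': "distr \<nu> borel (\<lambda>x. x + v) = \<nu>" if v: "v \<in> V" for v
  proof -
    have "distr \<nu> borel (\<lambda>x. x + v) = distr \<mu> borel (\<lambda>x. T x + v)"
      unfolding \<nu>_def by (subst distr_distr) (simp_all add: o_def)
    also have "\<dots> = distr \<mu> borel (\<lambda>x. T (x + T' v))"
      using inv(1)[OF v] by (simp add: linear_add[OF bounded_linear.linear[OF T(1)]])
    also have "\<dots> = distr (distr \<mu> borel (\<lambda>x. x + T' v)) borel T"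
      by (subst distr_distr) (simp_all add: o_def)
    also have "\<dots> = \<nu>" using T'(2) v by (subst translate) (auto simp: \<nu>_def)
    finally show ?thesis .
  qed
  show "(\<integral>\<^sup>+x. f (T x) \<partial>\<mu>) = scale T * (\<integral>\<^sup>+x. f x \<partial>\<mu>)" if [measurable]: "f \<in> borel_measurable borel"
  proof -
    have "(\<integral>\<^sup>+x. f x \<partial>\<nu>) * (\<integral>\<^sup>+x. indicator (ball 0 1) x \<partial>\<mu>)
        = (\<integral>\<^sup>+x. indicator (ball 0 1) x \<partial>\<nu>) * (\<integral>\<^sup>+x. f (- x) \<partial>\<mu>)"
      by (rule invariant_cross[OF s sf AE inv']) (simp_all add: borel_measurable_indicator)
    moreover have "(\<integral>\<^sup>+x. f x \<partial>\<nu>) = (\<integral>\<^sup>+x. f (T x) \<partial>\<mu>)"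
      unfolding \<nu>_def by (rule nn_integral_distr) measurable
    moreover have "(\<integral>\<^sup>+x. indicator (ball 0 1) x \<partial>\<nu>) = emeasure \<mu> {x. T x \<in> ball 0 1}"
      by (simp add: s) (simp add: \<nu>_def emeasure_distr vimage_def)
    ultimately have "(\<integral>\<^sup>+x. f (T x) \<partial>\<mu>) * ?b = emeasure \<mu> {x. T x \<in> ball 0 1} * (\<integral>\<^sup>+x. f x \<partial>\<mu>)"
      by (simp add: nn_integral_uminus)
    then have "(\<integral>\<^sup>+x. f (T x) \<partial>\<mu>) * ?b / ?b = scale T * (\<integral>\<^sup>+x. f x \<partial>\<mu>)"
      by (simp add: scale_def ennreal_times_divide mult.commute)
    then show ?thesis using b by (simp add: ennreal_mult_divide_eq less_top[symmetric])
  qed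
qed

end

section \<open>Lebesgue measure on vectors, on symmetric matrices and on matrices by rows\<close>

lemma invariant_measure_lborel: "invariant_measure (lborel :: 'a::euclidean_space measure) UNIV"
proof
  show "distr lborel borel (\<lambda>x. x + v) = lborel" for v :: 'a
    using lborel_distr_plus[of v] by (simp add: add.commute[of _ v])
  show "0 < emeasure lborel (ball (0 :: 'a) r)" if "0 < r" for r
    using that emeasure_lborel_ball_finite[of "0 :: 'a" r] content_ball_pos[of r "0 :: 'a"]
    by (subst emeasure_eq_ennreal_measure) auto
qed (auto simp: emeasure_lborel_ball_finite[unfolded infinity_ennreal_def])

text \<open>\<open>J\<close> assembles finitely many coordinates into an element of
  \<open>V\<close>. Additivity carries translations of the product measure over to \<open>V\<close>,
  and \<open>le1\<close> and \<open>le2\<close> make the norm comparable with the largest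
  coordinate, so that balls correspond to boxes. The restriction in \<open>add\<close> keeps the sum
  inside the space of the product measure.\<close>

lemma invariant_measure_coordinates:
  fixes J :: "('i \<Rightarrow> 'b::euclidean_space) \<Rightarrow> 'a::euclidean_space"
  assumes I: "finite I"
    and J [measurable]: "J \<in> borel_measurable (PiM I (\<lambda>_. lborel))"
    and V: "subspace V"
    and range: "\<And>f. J f \<in> V" "\<And>v. v \<in> V \<Longrightarrow> \<exists>c. v = J c"
    and add: "\<And>f c. J (\<lambda>i\<in>I. f i + c i) = J f + J c"
    and le1: "\<And>f i. i \<in> I \<Longrightarrow> norm (f i) \<le> norm (J f)"
    and le2: "\<And>f e. (\<And>i. i \<in> I \<Longrightarrow> norm (f i) \<le> e) \<Longrightarrow> norm (J f) \<le> K * e" and K: "K > 0"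
  shows "invariant_measure (distr (PiM I (\<lambda>_. lborel)) borel J) V"
proof
  interpret product_sigma_finite "\<lambda>_::'i. lborel :: 'b measure" ..
  let ?P = "PiM I (\<lambda>_. lborel :: 'b measure)"
  show "sets (distr ?P borel J) = sets borel" "subspace V" using V by simp_all
  have [measurable]: "V \<in> sets borel" using closed_subspace[OF V] by (rule borel_closed)
  show "AE x in distr ?P borel J. x \<in> V"
    by (subst AE_distr_iff) (auto simp: range)
  show "distr (distr ?P borel J) borel (\<lambda>x. x + v) = distr ?P borel J" if v: "v \<in> V" for v
  proof -
    obtain c where c: "v = J c" using range(2)[OF v] by blast
    have [measurable]: "(\<lambda>f. \<lambda>i\<in>I. f i + c i) \<in> measurable ?P ?P"
      by (rule measurable_restrict) measurable
    have P: "distr ?P ?P (\<lambda>f. \<lambda>i\<in>I. f i + c i) = ?P"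
    proof (rule PiM_eqI[OF I])
      fix A :: "'i \<Rightarrow> 'b set" assume A: "\<And>i. i \<in> I \<Longrightarrow> A i \<in> sets lborel"
      have "(\<lambda>f. \<lambda>i\<in>I. f i + c i) -` (PiE I A) \<inter> space ?P = (\<Pi>\<^sub>E i\<in>I. (\<lambda>x. x + c i) -` A i)"
        by (auto simp: space_PiM PiE_iff)
      moreover have "emeasure lborel ((\<lambda>x. x + c i) -` A i) = emeasure lborel (A i)" if "i \<in> I" for i
      proof -
        interpret L: invariant_measure "lborel :: 'b measure" UNIV by (rule invariant_measure_lborel)
        have "emeasure (distr lborel borel (\<lambda>x. x + c i)) (A i) = emeasure lborel (A i)"
          by (simp add: L.translate)
        then show ?thesis using A[OF that] by (simp add: emeasure_distr)
      qed
      moreover have "(\<lambda>x. x + c i) -` A i \<in> sets lborel" if "i \<in> I" for i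
        using A[OF that] measurable_sets[of "\<lambda>x. x + c i" borel borel "A i"] by simp
      ultimately show "emeasure (distr ?P ?P (\<lambda>f. \<lambda>i\<in>I. f i + c i)) (PiE I A)
          = (\<Prod>i\<in>I. emeasure lborel (A i))"
        using A I by (subst emeasure_distr) (simp_all add: sets_PiM_I_finite emeasure_PiM)
    qed simp
    have "distr (distr ?P borel J) borel (\<lambda>x. x + v) = distr ?P borel (\<lambda>f. J f + J c)"
      unfolding c by (subst distr_distr) (simp_all add: o_def)
    also have "\<dots> = distr ?P borel (\<lambda>f. J (\<lambda>i\<in>I. f i + c i))" by (simp add: add)
    also have "\<dots> = distr (distr ?P ?P (\<lambda>f. \<lambda>i\<in>I. f i + c i)) borel J"
      by (subst distr_distr) (simp_all add: o_def)
    finally show ?thesis by (simp add: P)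
  qed
  have bx: "(\<Pi>\<^sub>E i\<in>I. ball 0 r) \<in> sets ?P" for r by (intro sets_PiM_I_finite I) auto
  show "emeasure (distr ?P borel J) (ball 0 r) < \<infinity>" for r
  proof -
    have "emeasure (distr ?P borel J) (ball 0 r) = emeasure ?P (J -` ball 0 r \<inter> space ?P)"
      by (rule emeasure_distr) auto
    also have "\<dots> \<le> emeasure ?P (\<Pi>\<^sub>E i\<in>I. ball 0 r)"
      by (intro emeasure_mono bx subsetI) (auto simp: space_PiM PiE_iff intro: le_less_trans[OF le1])
    also have "\<dots> = (\<Prod>i\<in>I. emeasure lborel (ball (0 :: 'b) r))" by (intro emeasure_PiM I) auto
    also have "\<dots> < \<infinity>" 
      using emeasure_lborel_ball_finite[of "0 :: 'b" r] by (simp add: less_top[symmetric] power_eq_top_ennreal)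
    finally show ?thesis .
  qed
  show "0 < emeasure (distr ?P borel J) (ball 0 r)" if r: "0 < r" for r
  proof -
    \<comment> \<open>A product of balls of this radius is mapped by \<open>le2\<close> into the
      ball of radius \<open>r / 2\<close>.\<close>
    let ?e = "r / (2 * K)"
    have "0 < (\<Prod>i\<in>I. emeasure lborel (ball (0 :: 'b) ?e))"
      using r K invariant_measure.pos_ball[OF invariant_measure_lborel, where 'a = 'b, of ?e]
      by (simp add: zero_less_iff_neq_zero I)
    also have "\<dots> = emeasure ?P (\<Pi>\<^sub>E i\<in>I. ball 0 ?e)" by (intro emeasure_PiM[symmetric] I) auto
    also have "\<dots> \<le> emeasure ?P (J -` ball 0 r \<inter> space ?P)"
    proof (intro emeasure_mono subsetI IntI)
      fix f assume f: "f \<in> (\<Pi>\<^sub>E i\<in>I. ball (0 :: 'b) ?e)"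
      have "norm (J f) \<le> K * ?e" using f by (intro le2) (auto simp: PiE_iff less_imp_le)
      also have "\<dots> < r" using r K by simp
      finally show "f \<in> J -` ball 0 r" by simp
      show "f \<in> space ?P" using f by (auto simp: space_PiM PiE_iff)
    qed measurable
    also have "\<dots> = emeasure (distr ?P borel J) (ball 0 r)"
      by (rule emeasure_distr[symmetric]) auto
    finally show ?thesis .
  qed
qed

lemma norm_matrix_le:
  fixes S :: "real^'n^'m"
  assumes "\<And>i j. \<bar>S $ i $ j\<bar> \<le> e"
  shows "norm S \<le> real (CARD('m) * CARD('n)) * e"
proof -
  have "norm S \<le> (\<Sum>i\<in>UNIV. norm (S $ i))" unfolding norm_vec_def by (rule L2_set_le_sum) simp
  also have "\<dots> \<le> (\<Sum>i\<in>(UNIV :: 'm set). \<Sum>j\<in>(UNIV :: 'n set). e)"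
  proof (intro sum_mono)
    fix i
    have "norm (S $ i) \<le> (\<Sum>j\<in>UNIV. \<bar>S $ i $ j\<bar>)" by (rule norm_le_l1_cart)
    also have "\<dots> \<le> (\<Sum>j\<in>(UNIV :: 'n set). e)" by (intro sum_mono assms)
    finally show "norm (S $ i) \<le> (\<Sum>j\<in>(UNIV :: 'n set). e)" .
  qed
  finally show ?thesis by simp
qed

lemma matrix_nth_le_norm: "\<bar>S $ i $ j\<bar> \<le> norm S" for S :: "real^'n^'m"
  using component_le_norm_cart[of "S $ i" j] Finite_Cartesian_Product.norm_nth_le[of S i] by linarith

lemma measurable_vec_nth [measurable (raw)]:
  fixes f :: "'x \<Rightarrow> 'b::{second_countable_topology, real_normed_vector}^'n"
  assumes "f \<in> borel_measurable M"
  shows "(\<lambda>x. f x $ i) \<in> borel_measurable M"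
  by (rule borel_measurable_continuous_on[OF _ assms]) (intro continuous_intros)

lemma borel_measurable_matrixI:
  fixes f :: "'x \<Rightarrow> real^'n^'m"
  assumes "\<And>i j. (\<lambda>x. f x $ i $ j) \<in> borel_measurable M"
  shows "f \<in> borel_measurable M"
proof (subst borel_measurable_euclidean_space, intro ballI)
  fix b :: "real^'n^'m" assume "b \<in> Basis"
  then obtain i j where b: "b = axis i (axis j 1)" by (auto simp: Basis_vec_def)
  then show "(\<lambda>x. f x \<bullet> b) \<in> borel_measurable M" using assms by (simp add: inner_axis)
qed

lemma invariant_measure_symmetric:
  "invariant_measure (lebesgue_symmetric :: (real^'d^'d) measure) symmetric_matrices"
  unfolding lebesgue_symmetric_def
proof (rule invariant_measure_coordinates[where K = "real (CARD('d) * CARD('d))"])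
  let ?I = "{{i, j} | i j :: 'd. True}"
  show "finite ?I" by (rule finite)
  show "(\<lambda>f. \<chi> i j. f {i, j}) \<in> borel_measurable (PiM ?I (\<lambda>_. lborel :: real measure))"
  proof (rule borel_measurable_matrixI)
    fix i j :: 'd
    have "(\<lambda>f. f {i, j}) \<in> measurable (PiM ?I (\<lambda>_. lborel)) (lborel :: real measure)"
      by (rule measurable_component_singleton) blast
    then show "(\<lambda>f. (\<chi> i j. f {i, j}) $ i $ j) \<in> borel_measurable (PiM ?I (\<lambda>_. lborel :: real measure))"
      by simp
  qed
  show "subspace symmetric_matrices" by (rule subspace_symmetric_matrices)
  show "(\<chi> i j. f {i, j}) \<in> symmetric_matrices" for f :: "'d set \<Rightarrow> real"
    by (simp add: symmetric_matrices_def transpose_def vec_eq_iff insert_commute)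
  show "\<exists>c. v = (\<chi> i j. c {i, j})" if v: "v \<in> symmetric_matrices" for v :: "real^'d^'d"
  proof -
    \<comment> \<open>The entry is read at an arbitrarily chosen ordering of the unordered pair;
      symmetry of \<open>v\<close> makes the choice irrelevant.\<close>
    define c where "c p = (let q = (SOME q. p = {fst q, snd q}) in v $ fst q $ snd q)" for p
    have "c {i, j} = v $ i $ j" for i j
    proof -
      define q where "q = (SOME q. {i, j} = {fst q, snd q})"
      have "{i, j} = {fst q, snd q}" unfolding q_def by (rule someI[of _ "(i, j)"]) simp
      then have "q = (i, j) \<or> q = (j, i)" by (cases q) (auto simp: doubleton_eq_iff)
      then show ?thesis using symmetric_nth[OF v, of i j] unfolding c_def q_def[symmetric] Let_def by (elim disjE) simp_all
    qed
    then show ?thesis by (intro exI[of _ c]) (simp add: vec_eq_iff)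
  qed
  show "(\<chi> i j. (\<lambda>p\<in>?I. f p + c p) {i, j}) = (\<chi> i j. f {i, j}) + (\<chi> i j. c {i, j})"
    for f c :: "'d set \<Rightarrow> real"
    by (auto simp: vec_eq_iff)
  show "norm (f p) \<le> norm ((\<chi> i j. f {i, j}) :: real^'d^'d)" if p: "p \<in> ?I" for f :: "'d set \<Rightarrow> real" and p
  proof -
    obtain i j where "p = {i, j}" using p by blast
    then show ?thesis using matrix_nth_le_norm[of "(\<chi> i j. f {i, j}) :: real^'d^'d" i j] by simp
  qed
  show "norm ((\<chi> i j. f {i, j}) :: real^'d^'d) \<le> real (CARD('d) * CARD('d)) * e"
    if "\<And>p. p \<in> ?I \<Longrightarrow> norm (f p) \<le> e" for f :: "'d set \<Rightarrow> real" and e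
  proof (rule norm_matrix_le)
    fix i j :: 'd
    have "{i, j} \<in> ?I" by blast
    from that[OF this] show "\<bar>((\<chi> i j. f {i, j}) :: real^'d^'d) $ i $ j\<bar> \<le> e" by simp
  qed
qed simp

text \<open>Jumps are numbered by naturals and matrix rows by the index type; this numbering lets
  the d jump vectors be the rows of a square matrix.\<close>

definition row_index :: "'d::finite \<Rightarrow> nat" where
  "row_index = (SOME e. bij_betw e UNIV {..<CARD('d)})"

lemma row_index: "bij_betw row_index (UNIV :: 'd::finite set) {..<CARD('d)}"
  unfolding row_index_def
  using someI_ex[OF ex_bij_betw_finite_nat[of "UNIV :: 'd set"]] by (simp add: atLeast0LessThan)

definition rows_matrix :: "(nat \<Rightarrow> real^'d) \<Rightarrow> real^'d^'d" where
  "rows_matrix f = (\<chi> i. f (row_index i))"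

text \<open>Lebesgue measure on square matrices as an image of the product over the rows, the form
  in which d successive jump vectors are integrated.\<close>

definition lebesgue_rows :: "(real^'d^'d) measure" where
  "lebesgue_rows = distr (PiM {..<CARD('d)} (\<lambda>_. lborel)) borel rows_matrix"

lemma row_index_less [simp]: "row_index (i :: 'd::finite) < CARD('d)"
  using bij_betwE[OF row_index] by auto

lemma measurable_rows_matrix [measurable]:
  "(rows_matrix :: _ \<Rightarrow> real^'d^'d) \<in> borel_measurable (PiM {..<CARD('d)} (\<lambda>_. lborel))"
proof (rule borel_measurable_matrixI)
  fix i j :: 'd
  have "(\<lambda>f. f (row_index i)) \<in> measurable (PiM {..<CARD('d)} (\<lambda>_. lborel)) (lborel :: (real^'d) measure)"
    by (rule measurable_component_singleton) simp
  then have "(\<lambda>f. f (row_index i) $ j) \<in> borel_measurable (PiM {..<CARD('d)} (\<lambda>_. lborel :: (real^'d) measure))"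
    by (intro measurable_vec_nth) simp
  then show "(\<lambda>f. rows_matrix f $ i $ j) \<in> borel_measurable (PiM {..<CARD('d)} (\<lambda>_. lborel :: (real^'d) measure))"
    by (simp add: rows_matrix_def)
qed

lemma invariant_measure_rows: "invariant_measure (lebesgue_rows :: (real^'d^'d) measure) UNIV"
  unfolding lebesgue_rows_def
proof (rule invariant_measure_coordinates[where K = "real CARD('d)"])
  show "\<exists>c. v = rows_matrix c" for v :: "real^'d^'d"
  proof -
    have "v = rows_matrix (\<lambda>n. v $ inv row_index n)"
      using bij_betw_imp_inj_on[OF row_index[where 'd = 'd]]
      by (simp add: rows_matrix_def vec_eq_iff)
    then show ?thesis by blast
  qed
  show "rows_matrix (\<lambda>i\<in>{..<CARD('d)}. f i + c i) = rows_matrix f + (rows_matrix c :: real^'d^'d)" for f c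
    by (simp add: rows_matrix_def vec_eq_iff)
  show "norm (f n) \<le> norm (rows_matrix f :: real^'d^'d)" if n: "n \<in> {..<CARD('d)}" for f n
  proof -
    obtain i :: 'd where "n = row_index i" using bij_betw_imp_surj_on[OF row_index[where 'd = 'd]] n by blast
    then show ?thesis using Finite_Cartesian_Product.norm_nth_le[of "rows_matrix f" i] by (simp add: rows_matrix_def)
  qed
  show "norm (rows_matrix f :: real^'d^'d) \<le> real CARD('d) * e"
    if "\<And>n. n \<in> {..<CARD('d)} \<Longrightarrow> norm (f n) \<le> e" for f e
  proof -
    have "norm (rows_matrix f :: real^'d^'d) \<le> (\<Sum>i\<in>UNIV. norm ((rows_matrix f :: real^'d^'d) $ i))"
      unfolding norm_vec_def by (rule L2_set_le_sum) simp
    also have "\<dots> \<le> (\<Sum>i\<in>(UNIV :: 'd set). e)"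
      by (intro sum_mono) (use that in \<open>simp add: rows_matrix_def\<close>)
    finally show ?thesis by simp
  qed
qed auto

lemma rows_matrix_gram: "transpose (rows_matrix f) ** rows_matrix f = (\<Sum>n<CARD('d). outer (f n :: real^'d))"
proof -
  have "(\<Sum>n<CARD('d). outer (f n)) = (\<Sum>i\<in>(UNIV :: 'd set). outer (f (row_index i)))"
    using sum.reindex_bij_betw[OF row_index[where 'd = 'd], of "\<lambda>n. outer (f n)"] by simp
  then show ?thesis
    by (simp add: vec_eq_iff matrix_matrix_mult_def transpose_def rows_matrix_def outer_def)
qed

section \<open>Gram matrices of absolutely continuous random matrices\<close>

lemma measurable_det [measurable]: "(det :: real^'d^'d \<Rightarrow> real) \<in> borel_measurable borel"
  unfolding det_def by (intro borel_measurable_continuous_onI continuous_intros)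

text \<open>Cramer's rule makes inversion measurable.\<close>

definition cramer_inv :: "real^'d^'d \<Rightarrow> real^'d^'d" where
  "cramer_inv A = (\<chi> k j. det (\<chi> i l. if l = k then axis j 1 $ i else A $ i $ l) / det A)"

lemma measurable_cramer_inv [measurable]: "(cramer_inv :: real^'d^'d \<Rightarrow> real^'d^'d) \<in> borel_measurable borel"
proof (rule borel_measurable_matrixI)
  fix k j :: 'd
  have "(\<lambda>A :: real^'d^'d. \<chi> i l. if l = k then axis j 1 $ i else A $ i $ l) \<in> borel_measurable borel"
    by (rule borel_measurable_matrixI) (simp add: measurable_vec_nth)
  then show "(\<lambda>A :: real^'d^'d. cramer_inv A $ k $ j) \<in> borel_measurable borel"
    unfolding cramer_inv_def by simp
qed

lemma cramer_inv:
  assumes "invertible A"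
  shows "A ** cramer_inv A = mat 1" "cramer_inv A ** A = mat 1"
proof -
  have d: "det A \<noteq> 0" using assms by (simp add: invertible_det_nz)
  have "A *v column j (cramer_inv A) = axis j 1" for j
    by (subst cramer[OF d]) (simp add: cramer_inv_def column_def vec_eq_iff)
  then have "(A ** cramer_inv A) $ i $ j = (mat 1 :: real^'a^'a) $ i $ j" for i j
    by (simp add: matrix_matrix_mult_def matrix_vector_mult_def column_def vec_eq_iff mat_def axis_def)
  then show 1: "A ** cramer_inv A = mat 1" by (simp add: vec_eq_iff)
  then show "cramer_inv A ** A = mat 1" by (simp add: matrix_left_right_inverse)
qed

lemma invertible_cramer_inv: "invertible A \<Longrightarrow> invertible (cramer_inv A)"
  using cramer_inv unfolding invertible_def by blast

lemma pred_invertible [measurable]: "Measurable.pred borel (invertible :: real^'d^'d \<Rightarrow> bool)"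
  unfolding invertible_det_nz by measurable

text \<open>This gives measurability: the semidefinite cone is closed, and invertibility is a
  condition on the determinant.\<close>

lemma posdef_eq: "posdef = {S \<in> psd. invertible S}"
proof safe
  fix S :: "real^'a^'a" assume S: "S \<in> psd" "invertible S"
  have "0 < v \<bullet> (S *v v)" if "v \<noteq> 0" for v
    using psd_nonneg[OF S(1), of v] psd_kernel[OF S(1), of v] S(2) that
    unfolding invertible_kernel by (metis less_eq_real_def)
  then show "S \<in> posdef" using S(1) by (simp add: posdef_def psd_symmetric)
qed (simp_all add: posdef_psd posdef_invertible)

lemma posdef_sets [measurable]: "posdef \<in> sets borel"
  unfolding posdef_eq by measurable

text \<open>A total measurable version, since \<open>psd_sqrt\<close> is unspecified off the cone.\<close>

definition psd_sqrt0 :: "real^'d^'d \<Rightarrow> real^'d^'d" where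
  "psd_sqrt0 S = (if S \<in> psd then psd_sqrt S else 0)"

lemma measurable_psd_sqrt0 [measurable]: "(psd_sqrt0 :: real^'d^'d \<Rightarrow> real^'d^'d) \<in> borel_measurable borel"
  unfolding psd_sqrt0_def by (rule borel_measurable_continuous_on_if) (simp_all add: continuous_on_psd_sqrt psd_sets)

abbreviation congr :: "real^'d^'d \<Rightarrow> real^'d^'d \<Rightarrow> real^'d^'d" where
  "congr G S \<equiv> transpose G ** S ** G"

lemma bounded_linear_left_mult: "bounded_linear ((**) R)" for R :: "real^'d^'d"
  by (rule matrix_mult.bounded_linear_right)

lemma bounded_linear_congr: "bounded_linear (congr G)"
  by (rule bounded_linear_compose[OF matrix_mult.bounded_linear_left matrix_mult.bounded_linear_right])

lemma congr_symmetric: "S \<in> symmetric_matrices \<Longrightarrow> congr G S \<in> symmetric_matrices"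
  using symmetric_congruence[of S "transpose G"] by simp

lemma congr_posdef: "S \<in> posdef \<Longrightarrow> invertible G \<Longrightarrow> congr G S \<in> posdef"
  using posdef_congruence[of S "transpose G"] by (simp add: transpose_invertible)

lemma congr_inverse:
  assumes "invertible G"
  shows "congr G (congr (cramer_inv G) S) = S" "congr (cramer_inv G) (congr G S) = S"
proof -
  have t: "transpose G ** transpose (cramer_inv G) = mat 1" "transpose (cramer_inv G) ** transpose G = mat 1"
    using cramer_inv[OF assms] by (metis transpose_mat transpose_matrix_mult)+
  have "congr G (congr (cramer_inv G) S) = (transpose G ** transpose (cramer_inv G)) ** S ** (cramer_inv G ** G)"
    by (simp add: matrix_mul_assoc)
  then show "congr G (congr (cramer_inv G) S) = S" by (simp add: t cramer_inv[OF assms])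
  have "congr (cramer_inv G) (congr G S) = (transpose (cramer_inv G) ** transpose G) ** S ** (G ** cramer_inv G)"
    by (simp add: matrix_mul_assoc)
  then show "congr (cramer_inv G) (congr G S) = S" by (simp add: t cramer_inv[OF assms])
qed

interpretation sym: invariant_measure "lebesgue_symmetric :: (real^'d^'d) measure" symmetric_matrices
  by (rule invariant_measure_symmetric)

interpretation rows: invariant_measure "lebesgue_rows :: (real^'d^'d) measure" UNIV
  by (rule invariant_measure_rows)

lemma rows_scale:
  fixes R :: "real^'d^'d"
  assumes "invertible R"
  shows "f \<in> borel_measurable borel \<Longrightarrow>
      (\<integral>\<^sup>+G. f (R ** G) \<partial>lebesgue_rows) = rows.scale ((**) R) * (\<integral>\<^sup>+G. f G \<partial>lebesgue_rows)"
    and "0 < rows.scale ((**) R)" "rows.scale ((**) R) < \<infinity>"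
proof -
  have i: "R ** (cramer_inv R ** G) = G" "cramer_inv R ** (R ** G) = G" for G
    using cramer_inv[OF assms] by (simp_all add: matrix_mul_assoc)
  note s = rows.scale[of "(**) R" "(**) (cramer_inv R)", OF bounded_linear_left_mult _ bounded_linear_left_mult _ i]
  show "f \<in> borel_measurable borel \<Longrightarrow>
      (\<integral>\<^sup>+G. f (R ** G) \<partial>lebesgue_rows) = rows.scale ((**) R) * (\<integral>\<^sup>+G. f G \<partial>lebesgue_rows)"
    "0 < rows.scale ((**) R)" "rows.scale ((**) R) < \<infinity>"
    by (rule s; simp)+
qed

lemma sym_scale:
  fixes G :: "real^'d^'d"
  assumes "invertible G"
  shows "f \<in> borel_measurable borel \<Longrightarrow>
      (\<integral>\<^sup>+S. f (congr G S) \<partial>lebesgue_symmetric) = sym.scale (congr G) * (\<integral>\<^sup>+S. f S \<partial>lebesgue_symmetric)"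
    and "0 < sym.scale (congr G)" "sym.scale (congr G) < \<infinity>"
proof -
  note s = sym.scale[of "congr G" "congr (cramer_inv G)", OF bounded_linear_congr _ bounded_linear_congr _
      congr_inverse[OF assms]]
  show "f \<in> borel_measurable borel \<Longrightarrow>
      (\<integral>\<^sup>+S. f (congr G S) \<partial>lebesgue_symmetric) = sym.scale (congr G) * (\<integral>\<^sup>+S. f S \<partial>lebesgue_symmetric)"
    "0 < sym.scale (congr G)" "sym.scale (congr G) < \<infinity>"
    by (rule s; auto simp: congr_symmetric)+
qed

lemma measurable_rows_scale [measurable]:
  "(\<lambda>R :: real^'d^'d. rows.scale ((**) R)) \<in> borel_measurable borel"
  by (rule rows.measurable_scale) measurable

lemma measurable_sym_scale [measurable]:
  "(\<lambda>G :: real^'d^'d. sym.scale (congr G)) \<in> borel_measurable borel"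
  by (rule sym.measurable_scale) measurable

text \<open>A strictly positive subprobability density for the auxiliary variable \<open>S\<close>.
  Total mass at most 1 means that averaging over \<open>S\<close> keeps lower bounds free of
  constants.\<close>

definition weight :: "real^'d^'d \<Rightarrow> ennreal" where
  "weight = (SOME w. w \<in> borel_measurable borel \<and> (\<forall>S. 0 < w S) \<and> (\<integral>\<^sup>+S. w S \<partial>lebesgue_symmetric) \<le> 1)"

lemma weight:
  shows measurable_weight [measurable]: "(weight :: real^'d^'d \<Rightarrow> ennreal) \<in> borel_measurable borel"
    and weight_pos: "0 < weight (S :: real^'d^'d)"
    and weight_le: "(\<integral>\<^sup>+S. weight S \<partial>(lebesgue_symmetric :: (real^'d^'d) measure)) \<le> 1"
proof -
  interpret sigma_finite_measure "lebesgue_symmetric :: (real^'d^'d) measure" by (rule sym.sigma_finite)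
  obtain h :: "real^'d^'d \<Rightarrow> ennreal" where h [measurable]: "h \<in> borel_measurable lebesgue_symmetric"
    and fin: "integral\<^sup>N lebesgue_symmetric h \<noteq> \<infinity>" and pos: "\<And>x. 0 < h x \<and> h x < \<infinity>"
    using Ex_finite_integrable_function by auto
  define c where "c = integral\<^sup>N lebesgue_symmetric h"
  have "\<exists>w :: real^'d^'d \<Rightarrow> ennreal. w \<in> borel_measurable borel \<and> (\<forall>S. 0 < w S) \<and> (\<integral>\<^sup>+S. w S \<partial>lebesgue_symmetric) \<le> 1"
  \<comment> \<open>Dividing by \<open>c + 1\<close> gives an integral at most 1 whatever the value
    of the finite number \<open>c\<close>.\<close>
  proof (intro exI[of _ "\<lambda>S. h S / (c + 1)"] conjI allI)
    show "(\<lambda>S. h S / (c + 1)) \<in> borel_measurable borel" by measurable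
    show "0 < h S / (c + 1)" for S
      using pos fin by (simp add: ennreal_zero_less_divide c_def less_top[symmetric])
    have "(\<integral>\<^sup>+S. h S / (c + 1) \<partial>lebesgue_symmetric) = c / (c + 1)"
      unfolding c_def by (rule nn_integral_divide) measurable
    also have "\<dots> \<le> (c + 1) / (c + 1)" by (intro divide_right_mono_ennreal) simp
    also have "\<dots> = 1" using fin by (intro ennreal_divide_self) (simp_all add: c_def less_top[symmetric])
    finally show "(\<integral>\<^sup>+S. h S / (c + 1) \<partial>lebesgue_symmetric) \<le> 1" .
  qed
  from someI_ex[OF this] show "(weight :: real^'d^'d \<Rightarrow> ennreal) \<in> borel_measurable borel"
    "0 < weight (S :: real^'d^'d)"
    "(\<integral>\<^sup>+S. weight S \<partial>(lebesgue_symmetric :: (real^'d^'d) measure)) \<le> 1"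
    by (auto simp: weight_def)
qed

text \<open>For fixed definite \<open>S\<close>, the image of this density under multiplication of
  \<open>G\<close> by the root of \<open>S\<close> is \<open>weight S\<close> times
  \<open>q\<close>; the quotient by the scale factor undoes that linear substitution.\<close>

definition gram_kernel :: "(real^'d^'d \<Rightarrow> ennreal) \<Rightarrow> real^'d^'d \<Rightarrow> real^'d^'d \<Rightarrow> ennreal" where
  "gram_kernel q S G = (if S \<in> posdef \<and> invertible G
     then weight S * q (psd_sqrt0 S ** G) /
       rows.scale ((**) (psd_sqrt0 S)) else 0)"

text \<open>The substitution \<open>Y = congr G S\<close> for fixed invertible \<open>G\<close>
  turns \<open>S\<close> into \<open>congr (cramer_inv G) Y\<close> and brings in the factor
  \<open>sym.scale (congr G)\<close>. Integrating out \<open>G\<close> leaves a minorant of the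
  density of the Gram matrix.\<close>

definition gram_density :: "(real^'d^'d \<Rightarrow> ennreal) \<Rightarrow> real^'d^'d \<Rightarrow> ennreal" where
  "gram_density q Y = (\<integral>\<^sup>+G. sym.scale (congr G) * gram_kernel q (congr (cramer_inv G) Y) G \<partial>lebesgue_rows)"

lemma measurable_gram_kernel:
  fixes f g :: "'x \<Rightarrow> real^'d^'d"
  assumes [measurable]: "(\<lambda>x. q (fst x) (snd x)) \<in> borel_measurable (N \<Otimes>\<^sub>M borel)"
    and [measurable]: "p \<in> measurable M N" "f \<in> borel_measurable M" "g \<in> borel_measurable M"
  shows "(\<lambda>x. gram_kernel (q (p x)) (f x) (g x)) \<in> borel_measurable M"
proof -
  have "(\<lambda>x. (p x, psd_sqrt0 (f x) ** g x)) \<in> measurable M (N \<Otimes>\<^sub>M borel)" by measurable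
  from measurable_compose[OF this assms(1)]
  have [measurable]: "(\<lambda>x. q (p x) (psd_sqrt0 (f x) ** g x)) \<in> borel_measurable M" by simp
  show ?thesis unfolding gram_kernel_def by measurable
qed

lemma measurable_gram_density:
  fixes f :: "'x \<Rightarrow> real^'d^'d"
  assumes [measurable]: "(\<lambda>x. q (fst x) (snd x)) \<in> borel_measurable (N \<Otimes>\<^sub>M borel)"
    and [measurable]: "p \<in> measurable M N" "f \<in> borel_measurable M"
  shows "(\<lambda>x. gram_density (q (p x)) (f x)) \<in> borel_measurable M"
proof -
  interpret sigma_finite_measure "lebesgue_rows :: (real^'d^'d) measure" by (rule rows.sigma_finite)
  have [measurable]: "(\<lambda>x. gram_kernel (q (p (fst x))) (congr (cramer_inv (snd x)) (f (fst x))) (snd x))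
      \<in> borel_measurable (M \<Otimes>\<^sub>M lebesgue_rows)"
    by (rule measurable_gram_kernel[OF assms(1), of "\<lambda>x. p (fst x)"]) measurable
  show ?thesis unfolding gram_density_def
    by (intro borel_measurable_nn_integral) (simp add: case_prod_beta)
qed

text \<open>The averaging trick: \<open>U = sqrt S G\<close> has Gram matrix \<open>G\<^sup>T S G\<close>; integrating over \<open>S\<close> against a
  weight and over \<open>G\<close>, Fubini lets one substitute \<open>Y = G\<^sup>T S G\<close> in \<open>S\<close> for fixed \<open>G\<close>.\<close>

lemma gram_swap:
  fixes q f :: "real^'d^'d \<Rightarrow> ennreal"
  assumes q [measurable]: "q \<in> borel_measurable borel" and f [measurable]: "f \<in> borel_measurable borel"
  shows "(\<integral>\<^sup>+S. (\<integral>\<^sup>+G. gram_kernel q S G * f (congr G S) \<partial>lebesgue_rows) \<partial>lebesgue_symmetric)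
    = (\<integral>\<^sup>+Y. gram_density q Y * f Y \<partial>lebesgue_symmetric)"
proof -
  interpret R: sigma_finite_measure "lebesgue_rows :: (real^'d^'d) measure" by (rule rows.sigma_finite)
  interpret S: sigma_finite_measure "lebesgue_symmetric :: (real^'d^'d) measure" by (rule sym.sigma_finite)
  interpret P: pair_sigma_finite "lebesgue_symmetric :: (real^'d^'d) measure" "lebesgue_rows :: (real^'d^'d) measure" ..
  have [measurable]: "(\<lambda>x. q (snd x)) \<in> borel_measurable (count_space UNIV \<Otimes>\<^sub>M borel)" by measurable
  have k [measurable (raw)]: "(\<lambda>x. gram_kernel q (a x) (b x)) \<in> borel_measurable N"
    if [measurable]: "a \<in> borel_measurable N" "b \<in> borel_measurable N" for a b and N :: "'x measure"
    by (rule measurable_gram_kernel[where p = "\<lambda>_. ()" and N = "count_space UNIV" and q = "\<lambda>_. q"]) measurable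
  have "(\<integral>\<^sup>+S. (\<integral>\<^sup>+G. gram_kernel q S G * f (congr G S) \<partial>lebesgue_rows) \<partial>lebesgue_symmetric)
      = (\<integral>\<^sup>+G. (\<integral>\<^sup>+S. gram_kernel q S G * f (congr G S) \<partial>lebesgue_symmetric) \<partial>lebesgue_rows)"
    by (rule P.Fubini'[symmetric]) measurable
  also have "\<dots> = (\<integral>\<^sup>+G. (\<integral>\<^sup>+Y. sym.scale (congr G) * gram_kernel q (congr (cramer_inv G) Y) G * f Y \<partial>lebesgue_symmetric) \<partial>lebesgue_rows)"
  proof (rule nn_integral_cong)
    fix G :: "real^'d^'d"
    show "(\<integral>\<^sup>+S. gram_kernel q S G * f (congr G S) \<partial>lebesgue_symmetric)
        = (\<integral>\<^sup>+Y. sym.scale (congr G) * gram_kernel q (congr (cramer_inv G) Y) G * f Y \<partial>lebesgue_symmetric)"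
    proof (cases "invertible G")
      case False
      then show ?thesis by (simp add: gram_kernel_def)
    next
      case True
      define F where "F Y = gram_kernel q (congr (cramer_inv G) Y) G * f Y" for Y
      have [measurable]: "F \<in> borel_measurable borel" unfolding F_def by measurable
      have "(\<integral>\<^sup>+S. gram_kernel q S G * f (congr G S) \<partial>lebesgue_symmetric) = (\<integral>\<^sup>+S. F (congr G S) \<partial>lebesgue_symmetric)"
        by (simp add: F_def congr_inverse[OF True])
      also have "\<dots> = sym.scale (congr G) * (\<integral>\<^sup>+Y. F Y \<partial>lebesgue_symmetric)"
        by (rule sym_scale[OF True]) measurable
      also have "\<dots> = (\<integral>\<^sup>+Y. sym.scale (congr G) * F Y \<partial>lebesgue_symmetric)"
        by (rule nn_integral_cmult[symmetric]) measurable
      finally show ?thesis by (simp add: F_def mult_ac)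
    qed
  qed
  also have "\<dots> = (\<integral>\<^sup>+Y. (\<integral>\<^sup>+G. sym.scale (congr G) * gram_kernel q (congr (cramer_inv G) Y) G * f Y \<partial>lebesgue_rows) \<partial>lebesgue_symmetric)"
    by (rule P.Fubini') measurable
  also have "\<dots> = (\<integral>\<^sup>+Y. gram_density q Y * f Y \<partial>lebesgue_symmetric)"
    unfolding gram_density_def by (intro nn_integral_cong nn_integral_multc) measurable
  finally show ?thesis .
qed

text \<open>For definite \<open>S\<close> the inner integral over \<open>G\<close> is at most
  \<open>weight S\<close> times the right-hand side, and for other \<open>S\<close> it is 0.
  Integrating over \<open>S\<close> then uses that the weight has mass at most 1.\<close>

theorem gram_density_lower_bound:
  fixes q f :: "real^'d^'d \<Rightarrow> ennreal"
  assumes q [measurable]: "q \<in> borel_measurable borel" and f [measurable]: "f \<in> borel_measurable borel"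
  shows "(\<integral>\<^sup>+Y. gram_density q Y * f Y \<partial>lebesgue_symmetric) \<le> (\<integral>\<^sup>+U. q U * f (transpose U ** U) \<partial>lebesgue_rows)"
proof -
  let ?I = "\<integral>\<^sup>+U. q U * f (transpose U ** U) \<partial>lebesgue_rows"
  have inner: "(\<integral>\<^sup>+G. gram_kernel q S G * f (congr G S) \<partial>lebesgue_rows) \<le> weight S * ?I" for S :: "real^'d^'d"
  proof (cases "S \<in> posdef")
    case True
    define R where "R = psd_sqrt S"
    have psd: "S \<in> psd" using True by (rule posdef_psd)
    have R: "invertible R" "transpose R = R" "R ** R = S"
      by (simp_all add: R_def posdef_sqrt_invertible True transpose_psd_sqrt psd psd_sqrt_square)
    define c where "c = rows.scale ((**) R)"
    have c: "0 < c" "c < \<infinity>" unfolding c_def by (rule rows_scale[OF R(1)])+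
    have gram: "transpose (R ** G) ** (R ** G) = congr G S" for G
    proof -
      have "transpose (R ** G) ** (R ** G) = transpose G ** (R ** R) ** G"
        by (simp add: R(2) matrix_mul_assoc)
      then show ?thesis by (simp add: R(3))
    qed
    have "(\<integral>\<^sup>+G. gram_kernel q S G * f (congr G S) \<partial>lebesgue_rows)
        \<le> (\<integral>\<^sup>+G. weight S / c * (q (R ** G) * f (transpose (R ** G) ** (R ** G))) \<partial>lebesgue_rows)"
      unfolding gram
      by (intro nn_integral_mono) (simp add: gram_kernel_def psd_sqrt0_def psd R_def[symmetric] c_def[symmetric] True
          divide_ennreal_def mult_ac)
    also have "\<dots> = weight S / c * (\<integral>\<^sup>+G. q (R ** G) * f (transpose (R ** G) ** (R ** G)) \<partial>lebesgue_rows)"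
      by (rule nn_integral_cmult) measurable
    also have "\<dots> = weight S / c * (c * ?I)"
      unfolding c_def by (subst rows_scale(1)[OF R(1), of "\<lambda>U. q U * f (transpose U ** U)"]) simp_all
    also have "\<dots> = weight S * ?I"
      using c by (simp add: divide_ennreal_def mult_ac ennreal_mult_divide_eq)
        (metis (no_types, lifting) ennreal_divide_self divide_ennreal_def mult.assoc mult.commute mult.right_neutral not_gr_zero less_top infinity_ennreal_def)
    finally show ?thesis .
  qed (simp add: gram_kernel_def)
  have "(\<integral>\<^sup>+Y. gram_density q Y * f Y \<partial>lebesgue_symmetric)
      = (\<integral>\<^sup>+S. (\<integral>\<^sup>+G. gram_kernel q S G * f (congr G S) \<partial>lebesgue_rows) \<partial>lebesgue_symmetric)"
    by (rule gram_swap[OF q f, symmetric])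
  also have "\<dots> \<le> (\<integral>\<^sup>+S. weight S * ?I \<partial>(lebesgue_symmetric :: (real^'d^'d) measure))"
    by (intro nn_integral_mono inner)
  also have "\<dots> = (\<integral>\<^sup>+S. weight S \<partial>(lebesgue_symmetric :: (real^'d^'d) measure)) * ?I"
    by (rule nn_integral_multc) measurable
  also have "\<dots> \<le> 1 * ?I" by (intro mult_right_mono weight_le) simp
  finally show ?thesis by simp
qed

lemma AE_rows_left_mult:
  fixes R :: "real^'d^'d"
  assumes "invertible R" and P [measurable]: "Measurable.pred borel P" and AE: "AE U in lebesgue_rows. P U"
  shows "AE G in lebesgue_rows. P (R ** G)"
proof -
  have "(\<integral>\<^sup>+G. indicator {U. \<not> P U} (R ** G) \<partial>lebesgue_rows) = rows.scale ((**) R) * (\<integral>\<^sup>+U. indicator {U. \<not> P U} U \<partial>lebesgue_rows)"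
    by (rule rows_scale[OF assms(1)]) measurable
  also have "(\<integral>\<^sup>+U. indicator {U. \<not> P U} U \<partial>lebesgue_rows) = 0"
    using AE by (subst nn_integral_0_iff_AE) (auto simp: indicator_def)
  finally have "(\<integral>\<^sup>+G. indicator {U. \<not> P U} (R ** G) \<partial>lebesgue_rows) = 0" by simp
  then have "AE G in lebesgue_rows. indicator {U. \<not> P U} (R ** G) = (0 :: ennreal)"
    by (subst (asm) nn_integral_0_iff_AE) auto
  then show ?thesis by eventually_elim (auto simp: indicator_def split: if_splits)
qed

text \<open>The invertible matrices contain a ball around the identity, which has positive measure
  by translation invariance.\<close>

lemma exists_invertible_AE:
  assumes "AE G in (lebesgue_rows :: (real^'d^'d) measure). P G"
  shows "\<exists>G. invertible G \<and> P G"
proof (rule ccontr)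
  assume no: "\<not> ?thesis"
  have "open {G :: real^'d^'d. det G \<noteq> 0}"
    unfolding det_def by (intro open_Collect_neq continuous_intros)
  then obtain e where e: "e > 0" "ball (mat 1) e \<subseteq> {G :: real^'d^'d. det G \<noteq> 0}"
    unfolding open_contains_ball by (metis (mono_tags) det_I mem_Collect_eq zero_neq_one)
  have "AE G in lebesgue_rows. (G :: real^'d^'d) \<notin> ball (mat 1) e"
    using assms by eventually_elim (use no e(2) in \<open>auto simp: invertible_det_nz\<close>)
  then have z: "emeasure lebesgue_rows (ball (mat 1) e :: (real^'d^'d) set) = 0"
    by (subst (asm) AE_iff_measurable[OF _ refl]) (auto simp: ball_def)
  have "emeasure lebesgue_rows (ball 0 e :: (real^'d^'d) set)
      = (\<integral>\<^sup>+x. indicator (ball 0 e) x \<partial>(lebesgue_rows :: (real^'d^'d) measure))"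
    by (rule nn_integral_indicator[symmetric]) simp
  also have "\<dots> = (\<integral>\<^sup>+x. indicator (ball (mat 1) e) (x + mat 1) \<partial>(lebesgue_rows :: (real^'d^'d) measure))"
    by (intro nn_integral_cong) (auto simp: indicator_def dist_norm)
  also have "\<dots> = emeasure lebesgue_rows (ball (mat 1) e :: (real^'d^'d) set)"
    by (subst rows.nn_integral_translate) (auto intro!: borel_measurable_indicator)
  finally have "emeasure lebesgue_rows (ball 0 e :: (real^'d^'d) set) = 0" using z by simp
  moreover have "0 < emeasure lebesgue_rows (ball 0 e :: (real^'d^'d) set)" by (rule rows.pos_ball[OF e(1)])
  ultimately show False by simp
qed

text \<open>Let \<open>Z\<close> be the part of the definite cone where the density vanishes. By
  \<open>gram_swap\<close> and positivity of \<open>q\<close>, almost every pair of a definite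
  \<open>S\<close> and an invertible \<open>G\<close> has \<open>congr G S\<close> outside
  \<open>Z\<close>. Fixing one good \<open>G\<close>, the linear substitution by
  \<open>congr G\<close> shows that \<open>Z\<close> itself is null.\<close>

theorem gram_density_pos:
  fixes q :: "real^'d^'d \<Rightarrow> ennreal"
  assumes q [measurable]: "q \<in> borel_measurable borel" and pos: "AE U in lebesgue_rows. 0 < q U"
  shows "AE Y in lebesgue_symmetric. Y \<in> posdef \<longrightarrow> 0 < gram_density q Y"
proof -
  interpret R: sigma_finite_measure "lebesgue_rows :: (real^'d^'d) measure" by (rule rows.sigma_finite)
  interpret S: sigma_finite_measure "lebesgue_symmetric :: (real^'d^'d) measure" by (rule sym.sigma_finite)
  interpret P: pair_sigma_finite "lebesgue_symmetric :: (real^'d^'d) measure" "lebesgue_rows :: (real^'d^'d) measure" ..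
  have [measurable]: "(\<lambda>x. q (snd x)) \<in> borel_measurable (count_space UNIV \<Otimes>\<^sub>M borel)" by measurable
  have [measurable]: "gram_density q \<in> borel_measurable borel"
    by (rule measurable_gram_density[where p = "\<lambda>_. ()" and N = "count_space UNIV" and q = "\<lambda>_. q"]) measurable
  have k [measurable (raw)]: "(\<lambda>x. gram_kernel q (a x) (b x)) \<in> borel_measurable N"
    if [measurable]: "a \<in> borel_measurable N" "b \<in> borel_measurable N" for a b and N :: "'x measure"
    by (rule measurable_gram_kernel[where p = "\<lambda>_. ()" and N = "count_space UNIV" and q = "\<lambda>_. q"]) measurable
  define Z where "Z = {Y \<in> posdef. gram_density q Y = 0}"
  have Z [measurable]: "Z \<in> sets borel" unfolding Z_def by measurable
  define f :: "real^'d^'d \<Rightarrow> ennreal" where "f = indicator Z"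
  have [measurable]: "f \<in> borel_measurable borel" unfolding f_def by measurable
  have "(\<integral>\<^sup>+Y. gram_density q Y * f Y \<partial>lebesgue_symmetric) = 0"
    by (subst nn_integral_0_iff_AE) (auto simp: f_def Z_def indicator_def)
  then have "(\<integral>\<^sup>+S. (\<integral>\<^sup>+G. gram_kernel q S G * f (congr G S) \<partial>lebesgue_rows) \<partial>lebesgue_symmetric) = 0"
    by (simp add: gram_swap)
  then have AE1: "AE S in lebesgue_symmetric. (\<integral>\<^sup>+G. gram_kernel q S G * f (congr G S) \<partial>lebesgue_rows) = 0"
    by (subst (asm) nn_integral_0_iff_AE) (auto intro!: R.borel_measurable_nn_integral)
  have AE2: "AE S in lebesgue_symmetric. AE G in lebesgue_rows. S \<in> posdef \<and> invertible G \<longrightarrow> congr G S \<notin> Z"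
    using AE1
  proof eventually_elim
    case (elim S)
    show ?case
    proof (cases "S \<in> posdef")
      case True
      define R where "R = psd_sqrt S"
      have psd: "S \<in> psd" using True by (rule posdef_psd)
      have R: "invertible R" by (simp add: R_def posdef_sqrt_invertible True)
      have 1: "AE G in lebesgue_rows. gram_kernel q S G * f (congr G S) = 0"
        using elim by (subst (asm) nn_integral_0_iff_AE) auto
      have 2: "AE G in lebesgue_rows. 0 < q (R ** G)"
        by (rule AE_rows_left_mult[OF R _ pos]) measurable
      from 1 2 show ?thesis
      proof eventually_elim
        case (elim G)
        show ?case
        proof (intro impI notI, elim conjE)
          assume G: "invertible G" and Zm: "congr G S \<in> Z"
          have "gram_kernel q S G = weight S * q (R ** G) / rows.scale ((**) R)"
            using True G by (simp add: gram_kernel_def psd_sqrt0_def psd R_def)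
          also have "\<dots> > 0"
            using elim(2) weight_pos[of S] rows_scale(3)[OF R]
            by (simp add: ennreal_zero_less_divide ennreal_zero_less_mult_iff)
          finally show False using elim(1) Zm by (simp add: f_def)
        qed
      qed
    qed simp
  qed
  have "AE G in lebesgue_rows. AE S in lebesgue_symmetric. S \<in> posdef \<and> invertible G \<longrightarrow> congr G S \<notin> Z"
  proof (subst P.AE_commute[symmetric])
    have "Measurable.pred (lebesgue_symmetric \<Otimes>\<^sub>M lebesgue_rows)
        (\<lambda>x :: (real^'d^'d) \<times> (real^'d^'d). fst x \<in> posdef \<and> invertible (snd x) \<longrightarrow> congr (snd x) (fst x) \<notin> Z)"
      by measurable
    then show "{x \<in> space (lebesgue_symmetric \<Otimes>\<^sub>M lebesgue_rows).
        fst x \<in> posdef \<and> invertible (snd x) \<longrightarrow> congr (snd x) (fst x) \<notin> Z} \<in> sets (lebesgue_symmetric \<Otimes>\<^sub>M lebesgue_rows)"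
      by (simp only: pred_def)
  qed (rule AE2)
  from exists_invertible_AE[OF this] obtain G where G: "invertible G"
    "AE S in lebesgue_symmetric. S \<in> posdef \<longrightarrow> congr G S \<notin> Z" by auto
  have "AE S in lebesgue_symmetric. f (congr G S) = 0"
    using G(2)
  proof eventually_elim
    case (elim S)
    have "S \<in> posdef" if "congr G S \<in> Z"
    proof -
      have "congr (cramer_inv G) (congr G S) \<in> posdef"
        by (rule congr_posdef) (use that G(1) in \<open>simp_all add: Z_def invertible_cramer_inv\<close>)
      then show ?thesis by (simp add: congr_inverse[OF G(1)])
    qed
    then show ?case using elim by (auto simp: f_def indicator_def)
  qed
  then have "(\<integral>\<^sup>+S. f (congr G S) \<partial>lebesgue_symmetric) = 0"
    by (subst nn_integral_0_iff_AE) auto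
  then have "(\<integral>\<^sup>+S. f S \<partial>lebesgue_symmetric) = 0"
    using sym_scale[OF G(1)] by (subst (asm) sym_scale(1)[OF G(1)]) auto
  then have "emeasure lebesgue_symmetric Z = 0" by (simp add: f_def)
  then have "AE Y in lebesgue_symmetric. Y \<notin> Z"
    by (intro AE_not_in) (simp add: null_sets_def)
  then show ?thesis by eventually_elim (auto simp: Z_def zero_less_iff_neq_zero)
qed

section \<open>Paths\<close>

text \<open>A function with one-sided limits is uniformly close to integrable functions. The
  approximation property passes to the union of adjacent intervals and holds near every point, so it
  holds on the whole interval; uniform limits preserve integrability.\<close>

lemma regulated_integrable:
  fixes f :: "real \<Rightarrow> 'a::euclidean_space"
  assumes left: "\<And>x. a < x \<Longrightarrow> x \<le> b \<Longrightarrow> \<exists>l. (f \<longlongrightarrow> l) (at_left x)"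
    and right: "\<And>x. a \<le> x \<Longrightarrow> x < b \<Longrightarrow> \<exists>l. (f \<longlongrightarrow> l) (at_right x)"
    and "a \<le> b"
  shows "f integrable_on {a..b}"
proof -
  have "\<exists>g. (\<forall>x\<in>cbox a b. norm (f x - g x) \<le> e) \<and> g integrable_on cbox a b" if e: "e > 0" for e
  proof -
    \<comment> \<open>The intersection with \<open>{a..b}\<close> is there because the local step of
      the Bolzano argument meets intervals that stick out of \<open>{a..b}\<close>, where nothing is
      known about \<open>f\<close>.\<close>
    define P where "P u v \<longleftrightarrow> (\<exists>g. (\<forall>y\<in>{u..v} \<inter> {a..b}. norm (f y - g y) \<le> e) \<and> g integrable_on {u..v})" for u v
    have "P a b"
      using \<open>a \<le> b\<close>
    proof (induction rule: Bolzano)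
      case (trans u v w)
      then obtain g h where g: "\<forall>y\<in>{u..v} \<inter> {a..b}. norm (f y - g y) \<le> e" "g integrable_on {u..v}"
        and h: "\<forall>y\<in>{v..w} \<inter> {a..b}. norm (f y - h y) \<le> e" "h integrable_on {v..w}"
        unfolding P_def by blast
      define k where "k y = (if y \<le> v then g y else h y)" for y
      have "k integrable_on {u..v}" using g(2) by (rule integrable_eq) (simp add: k_def)
      moreover have "k integrable_on {v..w}"
        by (rule integrable_spike_finite[OF _ _ h(2), of "{v}"]) (auto simp: k_def)
      ultimately have "k integrable_on {u..w}"
        using trans by (intro Henstock_Kurzweil_Integration.integrable_combine[of u v w]) auto
      moreover have "\<forall>y\<in>{u..w} \<inter> {a..b}. norm (f y - k y) \<le> e" using g(1) h(1) by (auto simp: k_def)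
      ultimately show ?case unfolding P_def by blast
    next
      case (local x)
      obtain l d1 where d1: "d1 > 0" "\<And>y. a < x \<Longrightarrow> x - d1 < y \<Longrightarrow> y < x \<Longrightarrow> norm (f y - l) \<le> e"
      proof (cases "a < x")
        case True
        then obtain l where "(f \<longlongrightarrow> l) (at_left x)" using left local by blast
        then have "\<forall>\<^sub>F y in at_left x. dist (f y) l < e" using e by (rule tendstoD)
        then obtain c where "c < x" "\<And>y. c < y \<Longrightarrow> y < x \<Longrightarrow> dist (f y) l < e"
          by (auto simp: eventually_at_left_field)
        then show ?thesis using that[of "x - c" l] by (force simp: dist_norm)
      qed (use that[of 1] in auto)
      obtain r d2 where d2: "d2 > 0" "\<And>y. x < b \<Longrightarrow> x < y \<Longrightarrow> y < x + d2 \<Longrightarrow> norm (f y - r) \<le> e"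
      proof (cases "x < b")
        case True
        then obtain l where "(f \<longlongrightarrow> l) (at_right x)" using right local by blast
        then have "\<forall>\<^sub>F y in at_right x. dist (f y) l < e" using e by (rule tendstoD)
        then obtain c where "c > x" "\<And>y. x < y \<Longrightarrow> y < c \<Longrightarrow> dist (f y) l < e"
          by (auto simp: eventually_at_right_field)
        then show ?thesis using that[of "c - x" l] by (force simp: dist_norm)
      qed (use that[of 1] in auto)
      define k where "k y = (if y < x then l else if y = x then f x else r)" for y
      have "P u v" if uv: "u \<le> x" "x \<le> v" "v - u < min d1 d2" for u v
      proof -
        have "k integrable_on {u..x}"
          by (rule integrable_spike_finite[of "{x}" _ _ "\<lambda>_. l"]) (auto simp: k_def)
        moreover have "k integrable_on {x..v}"
          by (rule integrable_spike_finite[of "{x}" _ _ "\<lambda>_. r"]) (auto simp: k_def)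
        ultimately have "k integrable_on {u..v}"
          using uv by (intro Henstock_Kurzweil_Integration.integrable_combine[of u x v]) auto
        moreover have "norm (f y - k y) \<le> e" if "y \<in> {u..v} \<inter> {a..b}" for y
          using d1(2)[of y] d2(2)[of y] that uv e by (auto simp: k_def)
        ultimately show ?thesis unfolding P_def by blast
      qed
      then show ?case using d1(1) d2(1) by (intro exI[of _ "min d1 d2"]) auto
    qed
    then show ?thesis by (auto simp: P_def)
  qed
  then have "f integrable_on cbox a b" by (rule integrable_uniform_limit)
  then show ?thesis by simp
qed

lemma left_lim_eqI: "(f \<longlongrightarrow> l) (at_left t) \<Longrightarrow> left_lim f t = l" for t :: real
  unfolding left_lim_def by (rule tendsto_Lim) simp_all

lemma cadlag_right: "cadlag f \<Longrightarrow> 0 \<le> t \<Longrightarrow> (f \<longlongrightarrow> f t) (at_right t)"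
  by (simp add: cadlag_def)

lemma cadlag_left:
  fixes f :: "real \<Rightarrow> 'a::t2_space"
  assumes "cadlag f" "0 < t"
  shows "(f \<longlongrightarrow> left_lim f t) (at_left t)"
proof -
  obtain l where "(f \<longlongrightarrow> l) (at_left t)" using assms by (auto simp: cadlag_def)
  then show ?thesis using left_lim_eqI by metis
qed

lemma left_lim_bound:
  fixes f :: "real \<Rightarrow> 'a::real_normed_vector"
  assumes f: "cadlag f" and t: "0 \<le> b" "b < t" and bound: "\<And>r. b < r \<Longrightarrow> r < t \<Longrightarrow> norm (f r - l) \<le> e"
  shows "norm (left_lim f t - l) \<le> e"
proof (rule tendsto_upperbound)
  show "((\<lambda>r. norm (f r - l)) \<longlongrightarrow> norm (left_lim f t - l)) (at_left t)"
    by (intro tendsto_intros cadlag_left f) (use t in simp)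
  show "\<forall>\<^sub>F r in at_left t. norm (f r - l) \<le> e"
    unfolding eventually_at_left_field using t bound by (intro exI[of _ b]) auto
qed simp

text \<open>Together with the limit from the right, this makes the drift integrand, which is written
  with left limits, a regulated function.\<close>

lemma left_lim_tendsto_left:
  fixes f :: "real \<Rightarrow> 'a::real_normed_vector"
  assumes f: "cadlag f" and t: "0 < t"
  shows "(left_lim f \<longlongrightarrow> left_lim f t) (at_left t)"
proof (rule tendstoI)
  fix e :: real assume "e > 0"
  then have "\<forall>\<^sub>F y in at_left t. dist (f y) (left_lim f t) < e / 2"
    by (intro tendstoD[OF cadlag_left[OF f t]]) simp
  then obtain c where c: "c < t" "\<And>y. c < y \<Longrightarrow> y < t \<Longrightarrow> dist (f y) (left_lim f t) < e / 2"
    by (auto simp: eventually_at_left_field)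
  have "dist (left_lim f y) (left_lim f t) < e" if "max c 0 < y" "y < t" for y
  proof -
    have "norm (left_lim f y - left_lim f t) \<le> e / 2"
      by (rule left_lim_bound[OF f, of "max c 0"]) (use that c(2) in \<open>auto simp: dist_norm less_imp_le\<close>)
    then show ?thesis using \<open>e > 0\<close> by (simp add: dist_norm)
  qed
  then show "\<forall>\<^sub>F y in at_left t. dist (left_lim f y) (left_lim f t) < e"
    unfolding eventually_at_left_field using c(1) t by (intro exI[of _ "max c 0"]) auto
qed

lemma left_lim_tendsto_right:
  fixes f :: "real \<Rightarrow> 'a::real_normed_vector"
  assumes f: "cadlag f" and t: "0 \<le> t"
  shows "(left_lim f \<longlongrightarrow> f t) (at_right t)"
proof (rule tendstoI)
  fix e :: real assume "e > 0"
  then have "\<forall>\<^sub>F y in at_right t. dist (f y) (f t) < e / 2"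
    by (intro tendstoD[OF cadlag_right[OF f t]]) simp
  then obtain c where c: "t < c" "\<And>y. t < y \<Longrightarrow> y < c \<Longrightarrow> dist (f y) (f t) < e / 2"
    by (auto simp: eventually_at_right_field)
  have "dist (left_lim f y) (f t) < e" if "t < y" "y < c" for y
  proof -
    have "norm (left_lim f y - f t) \<le> e / 2"
      by (rule left_lim_bound[OF f t \<open>t < y\<close>]) (use that c(2) in \<open>auto simp: dist_norm less_imp_le\<close>)
    then show ?thesis using \<open>e > 0\<close> by (simp add: dist_norm)
  qed
  then show "\<forall>\<^sub>F y in at_right t. dist (left_lim f y) (f t) < e"
    unfolding eventually_at_right_field using c(1) by (intro exI[of _ c]) auto
qed

section \<open>Step paths with finitely many jumps\<close>

text \<open>\<open>\<theta> 0 = 0\<close> is the starting time and not a jump. The jumps on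
  \<open>{0..t}\<close> are \<open>\<theta> 1\<close> to \<open>\<theta> n\<close>, so the jump with
  index \<open>i\<close>, counted from 0, happens at \<open>\<theta> (Suc i)\<close>.\<close>

locale jump_times =
  fixes \<theta> :: "nat \<Rightarrow> real" and n :: nat and t :: real and N :: "real \<Rightarrow> nat"
  assumes zero: "\<theta> 0 = 0"
    and mono: "\<And>i. i < n \<Longrightarrow> \<theta> i < \<theta> (Suc i)"
    and le: "\<theta> n \<le> t"
    and count: "\<And>k s. k < n \<Longrightarrow> \<theta> k \<le> s \<Longrightarrow> s < \<theta> (Suc k) \<Longrightarrow> N s = k"
    and count_last: "\<And>s. \<theta> n \<le> s \<Longrightarrow> s \<le> t \<Longrightarrow> N s = n"
begin

lemma mono_less: "i < j \<Longrightarrow> j \<le> n \<Longrightarrow> \<theta> i < \<theta> j"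
proof (induction j)
  case (Suc j)
  then show ?case using mono[of j] by (cases "i = j") auto
qed simp

lemma mono_le: "i \<le> j \<Longrightarrow> j \<le> n \<Longrightarrow> \<theta> i \<le> \<theta> j"
  using mono_less[of i j] by (cases "i = j") auto

lemma nonneg: "i \<le> n \<Longrightarrow> 0 \<le> \<theta> i"
  using mono_le[of 0 i] zero by simp

lemma locate:
  assumes "0 \<le> s" "s \<le> t"
  shows "N s \<le> n" "\<theta> (N s) \<le> s" "N s < n \<Longrightarrow> s < \<theta> (Suc (N s))"
proof -
  have "\<exists>k\<le>n. \<theta> k \<le> s \<and> (k < n \<longrightarrow> s < \<theta> (Suc k))"
  proof (cases "\<exists>k<n. s < \<theta> (Suc k)")
    case True
    define k where "k = (LEAST k. k < n \<and> s < \<theta> (Suc k))"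
    have k: "k < n" "s < \<theta> (Suc k)" using LeastI_ex[OF True] by (auto simp: k_def)
    have "\<theta> k \<le> s"
    proof (cases k)
      case (Suc j)
      then have "\<not> (j < n \<and> s < \<theta> (Suc j))" using not_less_Least[of j "\<lambda>k. k < n \<and> s < \<theta> (Suc k)"] by (simp add: k_def)
      then show ?thesis using Suc k by simp
    qed (use assms zero in simp)
    then show ?thesis using k by (intro exI[of _ k]) simp
  next
    case False
    have "\<theta> n \<le> s"
    proof (cases n)
      case (Suc m)
      then have "\<not> s < \<theta> (Suc m)" using False by blast
      then show ?thesis using Suc by simp
    qed (use assms zero in simp)
    then show ?thesis by auto
  qed
  then obtain k where k: "k \<le> n" "\<theta> k \<le> s" "k < n \<Longrightarrow> s < \<theta> (Suc k)" by blast
  then have "N s = k" using count count_last assms by (cases "k = n") auto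
  then show "N s \<le> n" "\<theta> (N s) \<le> s" "N s < n \<Longrightarrow> s < \<theta> (Suc (N s))" using k by auto
qed

lemma jump_le_iff: "0 \<le> s \<Longrightarrow> s \<le> t \<Longrightarrow> i < n \<Longrightarrow> \<theta> (Suc i) \<le> s \<longleftrightarrow> i < N s"
  using locate[of s] mono_le[of "Suc i" "N s"] mono_le[of "Suc (N s)" "Suc i"]
  by (cases "i < N s") (auto simp: not_less)

lemma N_jump: "i < n \<Longrightarrow> N (\<theta> (Suc i)) = Suc i"
  using count[of "Suc i" "\<theta> (Suc i)"] count_last[of "\<theta> (Suc i)"] mono[of "Suc i"] le
  by (cases "Suc i = n") auto

text \<open>Applied twice: to the driving path, and to its quadratic variation, which is again a sum
  over past jumps.\<close>

lemma step_left:
  fixes f :: "real \<Rightarrow> 'b::real_normed_vector"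
  assumes f: "\<And>s. 0 \<le> s \<Longrightarrow> s \<le> t \<Longrightarrow> f s = (\<Sum>i<N s. a i)"
  shows step_jump: "\<And>i. i < n \<Longrightarrow> jump f (\<theta> (Suc i)) = a i"
    and step_no_jump: "\<And>s. 0 < s \<Longrightarrow> s \<le> t \<Longrightarrow> s \<notin> (\<lambda>i. \<theta> (Suc i)) ` {..<n} \<Longrightarrow> jump f s = 0"
proof -
  fix i assume i: "i < n"
  have le_t: "\<theta> (Suc i) \<le> t" using mono_le[of "Suc i" n] le i by simp
  have "\<forall>\<^sub>F r in at_left (\<theta> (Suc i)). f r = (\<Sum>j<i. a j)"
    unfolding eventually_at_left_field using mono[OF i] nonneg[of i] i le_t
    by (intro exI[of _ "\<theta> i"]) (auto simp: f count)
  then have "left_lim f (\<theta> (Suc i)) = (\<Sum>j<i. a j)"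
    by (intro left_lim_eqI) (rule tendsto_eventually)
  then show "jump f (\<theta> (Suc i)) = a i"
    using f[of "\<theta> (Suc i)"] nonneg[of "Suc i"] i le_t by (simp add: jump_def N_jump)
next
  fix s assume s: "0 < s" "s \<le> t" "s \<notin> (\<lambda>i. \<theta> (Suc i)) ` {..<n}"
  have l: "N s \<le> n" "\<theta> (N s) \<le> s" "N s < n \<Longrightarrow> s < \<theta> (Suc (N s))" using locate[of s] s by auto
  have "\<theta> (N s) \<noteq> s"
  proof (cases "N s")
    case (Suc j)
    then show ?thesis using s(3) l(1) by (auto simp: image_iff)
  qed (use s zero in simp)
  then have less: "\<theta> (N s) < s" using l by simp
  have "f r = (\<Sum>j<N s. a j)" if "\<theta> (N s) < r" "r < s" for r
  proof -
    have "N r = N s" using that l s count[of "N s" r] count_last[of r] by (cases "N s < n") auto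
    then show ?thesis using f[of r] that nonneg[OF l(1)] s by simp
  qed
  then have "\<forall>\<^sub>F r in at_left s. f r = (\<Sum>j<N s. a j)"
    unfolding eventually_at_left_field using less by (intro exI[of _ "\<theta> (N s)"]) auto
  then have "left_lim f s = (\<Sum>j<N s. a j)"
    by (intro left_lim_eqI) (rule tendsto_eventually)
  then show "jump f s = 0" using f[of s] s by (simp add: jump_def)
qed

text \<open>Turns the sums over all times in the definitions of the quadratic variation and of the
  jump integral into finite sums over the jumps.\<close>

lemma infsum_jumps:
  fixes F :: "real \<Rightarrow> 'b::{real_normed_vector}"
  assumes F: "\<And>s. 0 < s \<Longrightarrow> s \<le> t \<Longrightarrow> s \<notin> (\<lambda>i. \<theta> (Suc i)) ` {..<n} \<Longrightarrow> F s = 0"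
    and u: "0 \<le> u" "u \<le> t"
  shows "(\<Sum>\<^sub>\<infinity>s\<in>{0<..u}. F s) = (\<Sum>i<N u. F (\<theta> (Suc i)))"
proof -
  have Nu: "N u \<le> n" by (rule locate[OF u])
  let ?S = "(\<lambda>i. \<theta> (Suc i)) ` {..<N u}"
  have "(\<Sum>\<^sub>\<infinity>s\<in>{0<..u}. F s) = (\<Sum>\<^sub>\<infinity>s\<in>?S. F s)"
  proof (rule infsum_cong_neutral)
    fix s assume s: "s \<in> {0<..u} - ?S"
    have "s \<notin> (\<lambda>i. \<theta> (Suc i)) ` {..<n}"
      using s jump_le_iff[OF u] by auto
    then show "F s = 0" using F[of s] s u by simp
  next
    fix s assume "s \<in> ?S - {0<..u}"
    then obtain i where i: "i < N u" "s = \<theta> (Suc i)" by auto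
    then have "s \<le> u" using jump_le_iff[OF u, of i] Nu by simp
    moreover have "0 < s" using mono_less[of 0 "Suc i"] zero i Nu by simp
    ultimately show "F s = 0" using \<open>s \<in> ?S - {0<..u}\<close> by simp
  qed simp
  also have "\<dots> = (\<Sum>s\<in>?S. F s)" by simp
  also have "\<dots> = (\<Sum>i<N u. F (\<theta> (Suc i)))"
  proof (subst sum.reindex)
    show "inj_on (\<lambda>i. \<theta> (Suc i)) {..<N u}"
    proof (rule linorder_inj_onI')
      fix i j assume "i \<in> {..<N u}" "j \<in> {..<N u}" "i < j"
      then show "\<theta> (Suc i) \<noteq> \<theta> (Suc j)" using mono_less[of "Suc i" "Suc j"] Nu by simp
    qed
  qed simp
  finally show ?thesis .
qed

end


section \<open>The volatility in coordinates transported to a fixed time\<close>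

text \<open>If \<open>y\<close> is the transported state just before a jump at time
  \<open>s\<close>, transporting it back from \<open>t\<close> to \<open>s\<close> gives the left
  limit of the volatility. The factor therefore sends a jump of the driver to the vector whose outer
  square the transported state gains.\<close>

definition jump_factor :: "real^'d^'d \<Rightarrow> real^'d^'d \<Rightarrow> real^'d^'d \<Rightarrow> real \<Rightarrow> real \<Rightarrow> real^'d^'d \<Rightarrow> real^'d^'d" where
  "jump_factor A B C t s y =
     mat_exp B (t - s) ** A ** psd_sqrt0 (C + mat_exp B (s - t) ** y ** transpose (mat_exp B (s - t)))"

text \<open>\<open>mat_exp B (t - s) ** Y\<^sub>s ** transpose (mat_exp B (t - s))\<close> is constant between the jumps of the volatility
  \<open>Y\<close>; \<open>transported \<dots> k\<close> is its value after \<open>k\<close> jumps of sizes \<open>v\<close> at times \<open>\<tau>\<close>.\<close>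

primrec transported :: "real^'d^'d \<Rightarrow> real^'d^'d \<Rightarrow> real^'d^'d \<Rightarrow> real \<Rightarrow> (nat \<Rightarrow> real) \<Rightarrow> (nat \<Rightarrow> real^'d) \<Rightarrow>
    real^'d^'d \<Rightarrow> nat \<Rightarrow> real^'d^'d" where
  "transported A B C t \<tau> v y 0 = y"
| "transported A B C t \<tau> v y (Suc k) = transported A B C t \<tau> v y k +
     outer (jump_factor A B C t (\<tau> k) (transported A B C t \<tau> v y k) *v v k)"

lemma transported_psd: "y \<in> psd \<Longrightarrow> transported A B C t \<tau> v y k \<in> psd"
  by (induction k) (simp_all add: psd_add psd_outer)

lemma constant_of_zero_derivative:
  fixes f :: "real \<Rightarrow> 'a::real_normed_vector"
  assumes "a \<le> b" "continuous_on {a..b} f" "\<And>x. a < x \<Longrightarrow> x < b \<Longrightarrow> (f has_vector_derivative 0) (at x)"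
  shows "f b = f a"
proof (cases "a = b")
  case False
  have "norm (f b - f a) \<le> (\<lambda>_. 0 :: real) b - (\<lambda>_. 0) a"
    by (rule differentiable_bound_general[where f' = "\<lambda>_. 0" and \<phi>' = "\<lambda>_. 0"])
      (use assms False in auto)
  then show ?thesis by simp
qed simp

lemma mat_exp_cancel: "mat_exp B (s - t) ** (mat_exp B (t - s) ** y ** transpose (mat_exp B (t - s))) ** transpose (mat_exp B (s - t)) = y"
proof -
  have 1: "mat_exp B (s - t) ** mat_exp B (t - s) = mat 1" using mat_exp_minus[of B "s - t"] by simp
  then have 2: "transpose (mat_exp B (t - s)) ** transpose (mat_exp B (s - t)) = mat 1"
    by (metis transpose_mat transpose_matrix_mult)
  have "mat_exp B (s - t) ** (mat_exp B (t - s) ** y ** transpose (mat_exp B (t - s))) ** transpose (mat_exp B (s - t))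
      = (mat_exp B (s - t) ** mat_exp B (t - s)) ** y ** (transpose (mat_exp B (t - s)) ** transpose (mat_exp B (s - t)))"
    by (simp only: matrix_mul_assoc)
  then show ?thesis by (simp add: 1 2)
qed

text \<open>In the product rule the two derivatives of the exponentials cancel the two drift
  terms.\<close>

lemma transport_derivative:
  assumes "(y has_vector_derivative (B ** y s + y s ** transpose B)) (at s)"
  shows "((\<lambda>s. mat_exp B (t - s) ** y s ** transpose (mat_exp B (t - s))) has_vector_derivative 0) (at s)"
proof -
  let ?E = "mat_exp B (t - s)"
  have "((\<lambda>s. t - s) has_vector_derivative - 1) (at s within UNIV)"
    by (auto intro!: derivative_eq_intros)
  from vector_diff_chain_within[OF this mat_exp_derivative[of B]]
  have E: "((\<lambda>s. mat_exp B (t - s)) has_vector_derivative - (?E ** B)) (at s)"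
    by (simp add: o_def mat_exp_component_deriv(2))
  have T: "((\<lambda>s. transpose (mat_exp B (t - s))) has_vector_derivative - (transpose B ** transpose ?E)) (at s)"
    using bounded_linear.has_vector_derivative[OF bounded_linear_transpose E] by (simp add: transpose_minus)
  have "((\<lambda>s. mat_exp B (t - s) ** y s) has_vector_derivative
      (?E ** (B ** y s + y s ** transpose B) + - (?E ** B) ** y s)) (at s)"
    by (rule matrix_mult.has_vector_derivative[OF E assms])
  from matrix_mult.has_vector_derivative[OF this T]
  have "((\<lambda>s. mat_exp B (t - s) ** y s ** transpose (mat_exp B (t - s))) has_vector_derivative
      ((?E ** y s) ** - (transpose B ** transpose ?E) +
       (?E ** (B ** y s + y s ** transpose B) + - (?E ** B) ** y s) ** transpose ?E)) (at s)" .
  moreover have "(?E ** y s) ** - (transpose B ** transpose ?E) +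
       (?E ** (B ** y s + y s ** transpose B) + - (?E ** B) ** y s) ** transpose ?E = 0"
    by (simp add: matrix_mult.minus_right matrix_mult.minus_left matrix_mult.add_left matrix_mult.add_right
        matrix_mul_assoc)
  ultimately show ?thesis by simp
qed

context jump_times
begin

theorem volatility_eq_transported:
  fixes y :: "real \<Rightarrow> real^'d^'d" and l :: "real \<Rightarrow> real^'d"
  assumes x: "x \<in> psd" and C: "C \<in> psd"
    and l: "\<And>s. 0 \<le> s \<Longrightarrow> l s = (\<Sum>i<N s. v i)"
    and y: "cadlag y" and y0: "y 0 = x"
    and eq: "\<And>s. 0 \<le> s \<Longrightarrow> y s = y 0 + integral {0..s} (\<lambda>s. B ** left_lim y s + left_lim y s ** transpose B) +
      pure_jump_integral (\<lambda>s. A ** psd_sqrt (C + left_lim y s)) (discontinuous_qv l)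
        (\<lambda>s. psd_sqrt (C + left_lim y s) ** transpose A) s"
  shows "y t = transported A B C t (\<lambda>i. \<theta> (Suc i)) v (mat_exp B t ** x ** transpose (mat_exp B t)) n"
proof -
  have t: "0 \<le> t" using nonneg[of n] le by simp
  define g where "g s = B ** left_lim y s + left_lim y s ** transpose B" for s
  define W where "W i = A ** psd_sqrt (C + left_lim y (\<theta> (Suc i))) ** outer (v i) **
    (psd_sqrt (C + left_lim y (\<theta> (Suc i))) ** transpose A)" for i
  have qv: "discontinuous_qv l s = (\<Sum>i<N s. outer (v i))" if s: "0 \<le> s" "s \<le> t" for s
  proof -
    have "discontinuous_qv l s = (\<Sum>i<N s. outer (jump l (\<theta> (Suc i))))"
      unfolding discontinuous_qv_def
      by (rule infsum_jumps[OF _ s]) (simp add: step_no_jump[OF l] outer_def zero_vec_def)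
    also have "\<dots> = (\<Sum>i<N s. outer (v i))"
      using locate(1)[OF s] by (intro sum.cong refl) (simp add: step_jump[OF l])
    finally show ?thesis .
  qed
  have pj: "pure_jump_integral (\<lambda>s. A ** psd_sqrt (C + left_lim y s)) (discontinuous_qv l)
        (\<lambda>s. psd_sqrt (C + left_lim y s) ** transpose A) s = (\<Sum>i<N s. W i)" if s: "0 \<le> s" "s \<le> t" for s
  proof -
    have "pure_jump_integral (\<lambda>s. A ** psd_sqrt (C + left_lim y s)) (discontinuous_qv l)
        (\<lambda>s. psd_sqrt (C + left_lim y s) ** transpose A) s
      = (\<Sum>i<N s. A ** psd_sqrt (C + left_lim y (\<theta> (Suc i))) ** jump (discontinuous_qv l) (\<theta> (Suc i)) **
          (psd_sqrt (C + left_lim y (\<theta> (Suc i))) ** transpose A))"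
      unfolding pure_jump_integral_def
      by (rule infsum_jumps[OF _ s]) (simp add: step_no_jump[OF qv] matrix_mult.zero_left matrix_mult.zero_right)
    also have "\<dots> = (\<Sum>i<N s. W i)"
      using locate(1)[OF s] by (intro sum.cong refl) (simp add: step_jump[OF qv] W_def)
    finally show ?thesis .
  qed
  have g_int: "g integrable_on {0..t}"
  proof (rule regulated_integrable[OF _ _ t])
    show "\<exists>l. (g \<longlongrightarrow> l) (at_left s)" if "0 < s" for s
      unfolding g_def
      by (rule exI[of _ "B ** left_lim y s + left_lim y s ** transpose B"])
        (intro tendsto_add matrix_mult.tendsto tendsto_const left_lim_tendsto_left[OF y that])
    show "\<exists>l. (g \<longlongrightarrow> l) (at_right s)" if "0 \<le> s" for s
      unfolding g_def
      by (rule exI[of _ "B ** y s + y s ** transpose B"])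
        (intro tendsto_add matrix_mult.tendsto tendsto_const left_lim_tendsto_right[OF y that])
  qed
  define c where "c u = x + integral {0..u} g" for u
  have c_cont: "continuous_on {0..t} c"
    unfolding c_def by (intro continuous_intros indefinite_integral_continuous_1 g_int)
  have y_c: "y s = c s + (\<Sum>i<N s. W i)" if "0 \<le> s" "s \<le> t" for s
    using eq[of s] pj[of s] y0 that by (simp add: c_def g_def[abs_def])
  define b where "b k = (if k < n then \<theta> (Suc k) else t)" for k
  \<comment> \<open>\<open>z k\<close> is the path on the interval between consecutive jumps,
    continued continuously to the right end \<open>b k\<close>. Its value there is the left limit of
    \<open>y\<close>, which enters the next jump.\<close>
  define z where "z k s = c s + (\<Sum>i<k. W i)" for k s
  define Z where "Z k s = mat_exp B (t - s) ** z k s ** transpose (mat_exp B (t - s))" for k s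
  have b: "\<theta> k \<le> b k" "b k \<le> t" if "k \<le> n" for k
    using mono[of k] le that mono_le[of "Suc k" n] by (auto simp: b_def)
  have z_cont: "continuous_on {\<theta> k..b k} (z k)" if "k \<le> n" for k
    unfolding z_def
    by (intro continuous_intros continuous_on_subset[OF c_cont]) (use b[OF that] nonneg[OF that] in auto)
  have y_z: "y s = z k s" if "k \<le> n" "\<theta> k \<le> s" "s < b k" for k s
  proof -
    have "N s = k" using that count[of k s] count_last[of s] by (cases "k < n") (auto simp: b_def)
    then show ?thesis using y_c[of s] that b[of k] nonneg[of k] by (simp add: z_def)
  qed
  have lim_z: "left_lim y s = z k s" if k: "k \<le> n" and s: "\<theta> k < s" "s \<le> b k" for k s
  proof (rule left_lim_eqI)
    have "(z k \<longlongrightarrow> z k s) (at s within {\<theta> k..b k})"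
      using z_cont[OF k] s by (auto simp: continuous_on_def)
    then have "(z k \<longlongrightarrow> z k s) (at s within {\<theta> k..s})"
      by (rule tendsto_within_subset) (use s in auto)
    then have "(z k \<longlongrightarrow> z k s) (at_left s)"
      using at_within_Icc_at_left[OF s(1)] by simp
    moreover have "\<forall>\<^sub>F r in at_left s. z k r = y r"
      unfolding eventually_at_left_field using s y_z[OF k] by (intro exI[of _ "\<theta> k"]) auto
    ultimately show "(y \<longlongrightarrow> z k s) (at_left s)" by (rule Lim_transform_eventually)
  qed
  have z_deriv: "(z k has_vector_derivative (B ** z k s + z k s ** transpose B)) (at s)"
    if k: "k \<le> n" and s: "\<theta> k < s" "s < b k" for k s
  proof -
    let ?I = "{\<theta> k<..<b k}"
    have st: "0 < s" "s < t" using s b[OF k] nonneg[OF k] by auto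
    \<comment> \<open>Inside the interval the left limits are the values of the continuous function
      \<open>z k\<close>, so \<open>g\<close> is continuous there and its integral is
      differentiable.\<close>
    have "continuous_on ?I (\<lambda>s. B ** z k s + z k s ** transpose B)"
      by (intro continuous_intros continuous_on_subset[OF z_cont[OF k]]) auto
    then have "continuous_on ?I g"
      by (rule continuous_on_eq) (use lim_z[OF k] in \<open>simp add: g_def\<close>)
    then have "isCont g s" using s by (simp add: continuous_on_eq_continuous_at)
    then have "continuous (at s within {0..t}) g" by (rule continuous_at_imp_continuous_at_within)
    then have "((\<lambda>u. integral {0..u} g) has_vector_derivative g s) (at s within {0..t})"
      using integral_has_vector_derivative_continuous_at[of g 0 t s "{}"] g_int st by simp
    then have "((\<lambda>u. integral {0..u} g) has_vector_derivative g s) (at s)"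
      using at_within_Icc_at[of 0 s t] st by simp
    then have "(z k has_vector_derivative g s) (at s)"
      unfolding z_def c_def by (auto intro!: derivative_eq_intros)
    then show ?thesis using lim_z[OF k, of s] s by (simp add: g_def)
  qed
  have Z_const: "Z k s = Z k (\<theta> k)" if k: "k \<le> n" and s: "\<theta> k \<le> s" "s \<le> b k" for k s
    unfolding Z_def
  proof (rule constant_of_zero_derivative[OF s(1)])
    show "continuous_on {\<theta> k..s} (\<lambda>s. mat_exp B (t - s) ** z k s ** transpose (mat_exp B (t - s)))"
      by (intro continuous_intros continuous_on_subset[OF z_cont[OF k]]) (use s in auto)
    show "((\<lambda>s. mat_exp B (t - s) ** z k s ** transpose (mat_exp B (t - s))) has_vector_derivative 0) (at r)"
      if "\<theta> k < r" "r < s" for r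
      by (rule transport_derivative[OF z_deriv[OF k]]) (use that s in auto)
  qed
  let ?x = "mat_exp B t ** x ** transpose (mat_exp B t)"
  let ?T = "transported A B C t (\<lambda>i. \<theta> (Suc i)) v ?x"
  have step: "Z k (\<theta> k) = ?T k" if "k \<le> n" for k
    using that
  proof (induction k)
    case 0
    show ?case by (simp add: Z_def z_def c_def zero)
  next
    case (Suc k)
    define s where "s = \<theta> (Suc k)"
    have k: "k \<le> n" "k < n" using Suc.prems by auto
    have bk: "b k = s" using k by (simp add: b_def s_def)
    have less: "\<theta> k < s" using mono[OF k(2)] by (simp add: s_def)
    let ?E = "mat_exp B (t - s)" and ?E' = "mat_exp B (s - t)"
    have Zs: "Z k s = ?T k" using Z_const[OF k(1), of s] Suc k less bk by simp
    have ll: "left_lim y s = z k s" by (rule lim_z[OF k(1) less]) (simp add: bk)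
    have zs: "z k s = ?E' ** ?T k ** transpose ?E'"
      unfolding Zs[symmetric] Z_def by (rule mat_exp_cancel[symmetric])
    define Q where "Q = psd_sqrt (C + z k s)"
    have psd: "C + z k s \<in> psd"
      unfolding zs by (intro psd_add C psd_congruence transported_psd x)
    from psd have Qt: "transpose Q = Q" unfolding Q_def by (rule transpose_psd_sqrt)
    have F: "jump_factor A B C t s (?T k) = ?E ** A ** Q"
      using psd by (simp add: jump_factor_def psd_sqrt0_def Q_def zs)
    have "Z (Suc k) s = Z k s + ?E ** W k ** transpose ?E"
      by (simp add: Z_def z_def matrix_mult.add_left matrix_mult.add_right add.assoc)
    also have "?E ** W k ** transpose ?E = (?E ** A ** Q) ** outer (v k) ** transpose (?E ** A ** Q)"
      by (simp add: W_def s_def[symmetric] ll Q_def[symmetric] Qt matrix_mul_assoc)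
    also have "\<dots> = outer (jump_factor A B C t s (?T k) *v v k)"
      by (simp only: F outer_matrix_vector)
    finally show ?case by (simp add: s_def[symmetric] Zs)
  qed
  have "y t = z n t" using y_c[OF t order_refl] count_last[OF le] by (simp add: z_def)
  also have "\<dots> = Z n t" by (simp add: Z_def)
  also have "\<dots> = Z n (\<theta> n)" by (rule Z_const) (use le in \<open>auto simp: b_def\<close>)
  finally show ?thesis by (simp add: step)
qed

end

section \<open>The density produced by as many jumps as the dimension\<close>

lemma measurable_mat_exp [measurable]: "mat_exp B \<in> borel_measurable borel"
  by (intro borel_measurable_continuous_onI continuous_intros)

lemma measurable_jump_factor [measurable (raw)]:
  assumes [measurable]: "f \<in> borel_measurable M" "g \<in> borel_measurable M"
  shows "(\<lambda>x. jump_factor A B C t (f x) (g x)) \<in> borel_measurable M"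
  unfolding jump_factor_def by measurable

interpretation lebesgue_vec: invariant_measure "lborel :: (real^'d) measure" UNIV
  by (rule invariant_measure_lborel)

lemma vec_scale:
  fixes K :: "real^'d^'d"
  assumes "invertible K"
  shows "f \<in> borel_measurable borel \<Longrightarrow>
      (\<integral>\<^sup>+v. f (K *v v) \<partial>lborel) = lebesgue_vec.scale ((*v) K) * (\<integral>\<^sup>+v. f v \<partial>lborel)"
    and "0 < lebesgue_vec.scale ((*v) K)" "lebesgue_vec.scale ((*v) K) < \<infinity>"
proof -
  have i: "K *v (cramer_inv K *v v) = v" "cramer_inv K *v (K *v v) = v" for v
    using cramer_inv[OF assms] by (simp_all add: matrix_vector_mul_assoc)
  note s = lebesgue_vec.scale[of "(*v) K" "(*v) (cramer_inv K)", OF matrix_vector_mul_bounded_linear _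
      matrix_vector_mul_bounded_linear _ i]
  show "f \<in> borel_measurable borel \<Longrightarrow>
      (\<integral>\<^sup>+v. f (K *v v) \<partial>lborel) = lebesgue_vec.scale ((*v) K) * (\<integral>\<^sup>+v. f v \<partial>lborel)"
    "0 < lebesgue_vec.scale ((*v) K)" "lebesgue_vec.scale ((*v) K) < \<infinity>"
    by (rule s; simp)+
qed

lemma measurable_vec_scale [measurable]:
  "(\<lambda>K :: real^'d^'d. lebesgue_vec.scale ((*v) K)) \<in> borel_measurable borel"
  by (rule lebesgue_vec.measurable_scale) measurable

lemma AE_vec_mult:
  fixes K :: "real^'d^'d"
  assumes K: "invertible K" and P [measurable]: "Measurable.pred borel P" and AE: "AE u in lborel. P u"
  shows "AE v in lborel. P (K *v v)"
proof -
  have "(\<integral>\<^sup>+v. indicator {u. \<not> P u} (K *v v) \<partial>lborel) = lebesgue_vec.scale ((*v) K) * (\<integral>\<^sup>+u. indicator {u. \<not> P u} u \<partial>lborel)"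
    by (rule vec_scale[OF K]) measurable
  also have "(\<integral>\<^sup>+u. indicator {u. \<not> P u} u \<partial>lborel) = 0"
    using AE by (subst nn_integral_0_iff_AE) (auto simp: indicator_def)
  finally have "(\<integral>\<^sup>+v. indicator {u. \<not> P u} (K *v v) \<partial>lborel) = 0" by simp
  then have "AE v in lborel. indicator {u. \<not> P u} (K *v v) = (0 :: ennreal)"
    by (subst (asm) nn_integral_0_iff_AE) auto
  then show ?thesis by eventually_elim (auto simp: indicator_def split: if_splits)
qed

text \<open>\<open>F\<close> is the full jump law and \<open>dens\<close> a minorant of it. The
  singular part of \<open>F\<close> is simply dropped in the lower bounds.\<close>

locale jump_chain =
  fixes F :: "(real^'d) measure" and A B C :: "real^'d^'d" and t :: real and dens :: "real^'d \<Rightarrow> ennreal"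
  assumes prob_F: "prob_space F" and sets_F [measurable_cong, simp]: "sets F = sets borel"
    and A: "invertible A" and C: "C \<in> posdef"
    and measurable_dens [measurable]: "dens \<in> borel_measurable borel"
    and dens_pos: "AE v in lborel. 0 < dens v"
    and dens_le: "\<And>\<phi>. \<phi> \<in> borel_measurable borel \<Longrightarrow> (\<integral>\<^sup>+v. dens v * \<phi> v \<partial>lborel) \<le> (\<integral>\<^sup>+v. \<phi> v \<partial>F)"
begin

sublocale F: prob_space F by (rule prob_F)

lemma space_F [simp]: "space F = UNIV"
  using sets_eq_imp_space_eq[OF sets_F] by simp

abbreviation K :: "real \<Rightarrow> real^'d^'d \<Rightarrow> real^'d^'d" where
  "K \<equiv> jump_factor A B C t"

lemma K_invertible:
  assumes "y \<in> psd"
  shows "invertible (K s y)"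
proof -
  have "C + mat_exp B (s - t) ** y ** transpose (mat_exp B (s - t)) \<in> posdef"
    by (intro posdef_psd_add C psd_congruence assms)
  from posdef_sqrt_invertible[OF this] posdef_psd[OF this] show ?thesis
    unfolding jump_factor_def psd_sqrt0_def by (simp add: invertible_mult A invertible_mat_exp)
qed

definition jump_op :: "real \<Rightarrow> (real^'d^'d \<Rightarrow> ennreal) \<Rightarrow> real^'d^'d \<Rightarrow> ennreal" where
  "jump_op s \<phi> y = (\<integral>\<^sup>+v. \<phi> (y + outer (K s y *v v)) \<partial>F)"

text \<open>The operators compose backwards: the one of the last jump acts on \<open>\<phi>\<close>
  first.\<close>

primrec jump_ops :: "(nat \<Rightarrow> real) \<Rightarrow> nat \<Rightarrow> (real^'d^'d \<Rightarrow> ennreal) \<Rightarrow> real^'d^'d \<Rightarrow> ennreal" where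
  "jump_ops \<tau> 0 \<phi> = \<phi>"
| "jump_ops \<tau> (Suc k) \<phi> = jump_ops \<tau> k (jump_op (\<tau> k) \<phi>)"

lemma measurable_jump_op [measurable]:
  assumes [measurable]: "\<phi> \<in> borel_measurable borel"
  shows "jump_op s \<phi> \<in> borel_measurable borel"
  unfolding jump_op_def by (intro F.borel_measurable_nn_integral) (simp add: case_prod_beta)

lemma measurable_jump_ops [measurable]:
  "\<phi> \<in> borel_measurable borel \<Longrightarrow> jump_ops \<tau> k \<phi> \<in> borel_measurable borel"
  by (induction k arbitrary: \<phi>) simp_all

text \<open>The role of the Chapman-Kolmogorov equation for fixed jump times; it separates the two
  blocks of jumps behind the small set.\<close>

lemma jump_ops_add: "jump_ops \<tau> (j + k) \<phi> = jump_ops \<tau> j (jump_ops (\<lambda>i. \<tau> (j + i)) k \<phi>)"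
  by (induction k arbitrary: \<phi>) simp_all

text \<open>Comparison is only asked on the cone, where \<open>K\<close> is invertible and the
  density bounds hold; outer squares never leave it.\<close>

lemma jump_op_mono: "(\<And>y. y \<in> psd \<Longrightarrow> \<phi> y \<le> \<phi>' y) \<Longrightarrow> y \<in> psd \<Longrightarrow> jump_op s \<phi> y \<le> jump_op s \<phi>' y"
  unfolding jump_op_def by (intro nn_integral_mono) (simp add: psd_add psd_outer)

lemma jump_ops_mono: "(\<And>y. y \<in> psd \<Longrightarrow> \<phi> y \<le> \<phi>' y) \<Longrightarrow> y \<in> psd \<Longrightarrow> jump_ops \<tau> k \<phi> y \<le> jump_ops \<tau> k \<phi>' y"
  by (induction k arbitrary: \<phi> \<phi>') (simp_all add: jump_op_mono)

lemma transported_cong: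
  "(\<And>i. i < k \<Longrightarrow> v i = w i) \<Longrightarrow> transported A B C t \<tau> v y k = transported A B C t \<tau> w y k"
  by (induction k) simp_all

lemma measurable_transported:
  assumes "\<And>i. i < k \<Longrightarrow> (\<lambda>x. \<tau> x i) \<in> borel_measurable M"
    and "\<And>i. i < k \<Longrightarrow> (\<lambda>x. v x i) \<in> borel_measurable M"
  shows "(\<lambda>x. transported A B C t (\<tau> x) (v x) y k) \<in> borel_measurable M"
  using assms
proof (induction k)
  case (Suc k)
  have [measurable]: "(\<lambda>x. transported A B C t (\<tau> x) (v x) y k) \<in> borel_measurable M"
    "(\<lambda>x. \<tau> x k) \<in> borel_measurable M" "(\<lambda>x. v x k) \<in> borel_measurable M"
    using Suc by auto
  show ?case by simp
qed simp

lemma nn_integral_transported: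
  assumes [measurable]: "\<phi> \<in> borel_measurable borel"
  shows "(\<integral>\<^sup>+v. \<phi> (transported A B C t \<tau> v y k) \<partial>PiM {..<k} (\<lambda>_. F)) = jump_ops \<tau> k \<phi> y"
  using assms
proof (induction k arbitrary: \<phi>)
  case 0
  then show ?case by (simp add: space_PiM)
next
  case (Suc k)
  note [measurable] = Suc.prems
  interpret product_sigma_finite "\<lambda>_::nat. F" ..
  have [measurable]: "(\<lambda>v. transported A B C t \<tau> v y (Suc k)) \<in> borel_measurable (PiM (insert k {..<k}) (\<lambda>_. F))"
    by (rule measurable_transported) (auto intro!: measurable_component_singleton[THEN measurable_compose])
  have "(\<integral>\<^sup>+v. \<phi> (transported A B C t \<tau> v y (Suc k)) \<partial>PiM {..<Suc k} (\<lambda>_. F))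
      = (\<integral>\<^sup>+v. (\<integral>\<^sup>+w. \<phi> (transported A B C t \<tau> (v(k := w)) y (Suc k)) \<partial>F) \<partial>PiM {..<k} (\<lambda>_. F))"
    unfolding lessThan_Suc by (rule product_nn_integral_insert) (simp_all del: transported.simps)
  also have "\<dots> = (\<integral>\<^sup>+v. jump_op (\<tau> k) \<phi> (transported A B C t \<tau> v y k) \<partial>PiM {..<k} (\<lambda>_. F))"
  proof (rule nn_integral_cong)
    fix v
    have "transported A B C t \<tau> (v(k := w)) y k = transported A B C t \<tau> v y k" for w
      by (rule transported_cong) simp
    then show "(\<integral>\<^sup>+w. \<phi> (transported A B C t \<tau> (v(k := w)) y (Suc k)) \<partial>F)
        = jump_op (\<tau> k) \<phi> (transported A B C t \<tau> v y k)"
      by (simp add: jump_op_def)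
  qed
  also have "\<dots> = jump_ops \<tau> (Suc k) \<phi> y" by (simp add: Suc.IH)
  finally show ?case .
qed

text \<open>The density of \<open>u = K v\<close> when \<open>v\<close> has density
  \<open>dens\<close>; the scale factor stands for 1 / |det K|.\<close>

definition jump_density :: "real \<Rightarrow> real^'d^'d \<Rightarrow> real^'d \<Rightarrow> ennreal" where
  "jump_density s y u = lebesgue_vec.scale ((*v) (K s y)) * dens (cramer_inv (K s y) *v u)"

lemma measurable_jump_density [measurable (raw)]:
  assumes [measurable]: "f \<in> borel_measurable M" "g \<in> borel_measurable M" "h \<in> borel_measurable M"
  shows "(\<lambda>x. jump_density (f x) (g x) (h x)) \<in> borel_measurable M"
proof -
  have "(\<lambda>x. lebesgue_vec.scale ((*v) (K (f x) (g x)))) \<in> borel_measurable M"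
    by (rule measurable_compose[OF _ measurable_vec_scale]) measurable
  then show ?thesis unfolding jump_density_def by measurable
qed

lemma jump_density_pos:
  assumes y: "y \<in> psd"
  shows "AE u in lborel. 0 < jump_density s y u"
proof -
  have "AE u in lborel. 0 < dens (cramer_inv (K s y) *v u)"
    by (rule AE_vec_mult[OF invertible_cramer_inv[OF K_invertible[OF y]] _ dens_pos]) measurable
  then show ?thesis
    by eventually_elim (simp add: jump_density_def ennreal_zero_less_mult_iff vec_scale(2)[OF K_invertible[OF y]])
qed

lemma jump_op_lower_bound:
  assumes y: "y \<in> psd" and \<phi> [measurable]: "\<phi> \<in> borel_measurable borel"
  shows "(\<integral>\<^sup>+u. jump_density s y u * \<phi> (y + outer u) \<partial>lborel) \<le> jump_op s \<phi> y"
proof -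
  note inv = K_invertible[OF y, of s]
  define h where "h u = dens (cramer_inv (K s y) *v u) * \<phi> (y + outer u)" for u
  have [measurable]: "h \<in> borel_measurable borel" unfolding h_def by measurable
  have "(\<integral>\<^sup>+u. jump_density s y u * \<phi> (y + outer u) \<partial>lborel) = (\<integral>\<^sup>+u. lebesgue_vec.scale ((*v) (K s y)) * h u \<partial>lborel)"
    by (simp add: jump_density_def h_def mult.assoc)
  also have "\<dots> = lebesgue_vec.scale ((*v) (K s y)) * (\<integral>\<^sup>+u. h u \<partial>lborel)"
    by (rule nn_integral_cmult) measurable
  also have "\<dots> = (\<integral>\<^sup>+v. h (K s y *v v) \<partial>lborel)" by (rule vec_scale(1)[OF inv, symmetric]) measurable
  also have "\<dots> = (\<integral>\<^sup>+v. dens v * \<phi> (y + outer (K s y *v v)) \<partial>lborel)"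
    by (simp add: h_def matrix_vector_mul_assoc cramer_inv[OF inv])
  also have "\<dots> \<le> jump_op s \<phi> y" unfolding jump_op_def by (rule dens_le) measurable
  finally show ?thesis .
qed

text \<open>A minorant of the joint density of the transported jump vectors. The factor for jump
  \<open>k\<close> depends on earlier vectors only through the current state, so the change of
  variables is triangular.\<close>

primrec chain_density :: "(nat \<Rightarrow> real) \<Rightarrow> real^'d^'d \<Rightarrow> nat \<Rightarrow> (nat \<Rightarrow> real^'d) \<Rightarrow> ennreal" where
  "chain_density \<tau> y 0 u = 1"
| "chain_density \<tau> y (Suc k) u =
     chain_density \<tau> y k u * jump_density (\<tau> k) (y + (\<Sum>i<k. outer (u i))) (u k)"

lemma chain_density_cong: "(\<And>i. i < k \<Longrightarrow> u i = w i) \<Longrightarrow> chain_density \<tau> y k u = chain_density \<tau> y k w"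
  by (induction k) simp_all

lemma measurable_chain_density:
  assumes "\<And>i. i < k \<Longrightarrow> (\<lambda>x. \<tau> x i) \<in> borel_measurable M"
    and [measurable]: "y \<in> borel_measurable M"
    and "\<And>i. i < k \<Longrightarrow> (\<lambda>x. u x i) \<in> borel_measurable M"
  shows "(\<lambda>x. chain_density (\<tau> x) (y x) k (u x)) \<in> borel_measurable M"
  using assms(1,3)
proof (induction k)
  case (Suc k)
  have [measurable]: "(\<lambda>x. chain_density (\<tau> x) (y x) k (u x)) \<in> borel_measurable M"
    "(\<lambda>x. \<tau> x k) \<in> borel_measurable M" "(\<lambda>x. u x k) \<in> borel_measurable M"
    using Suc by auto
  have [measurable]: "(\<lambda>x. outer (u x i)) \<in> borel_measurable M" if "i < k" for i
    using Suc.prems(2)[of i] that by (intro measurable_compose[OF _ measurable_outer]) simp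
  have [measurable]: "(\<lambda>x. \<Sum>i<k. outer (u x i)) \<in> borel_measurable M"
    by (rule borel_measurable_sum) simp
  show ?case by simp
qed simp

lemma psd_plus_outers: "y \<in> psd \<Longrightarrow> y + (\<Sum>i\<in>I. outer (u i)) \<in> psd"
  by (intro psd_add psd_sum psd_outer)

lemma measurable_component_lborel:
  "i \<in> I \<Longrightarrow> (\<lambda>u. u i) \<in> borel_measurable (PiM I (\<lambda>_. lborel :: 'b::euclidean_space measure))"
  using measurable_component_singleton[of i I "\<lambda>_. lborel"] by simp

text \<open>The induction integrates the last vector out first. This replaces \<open>\<phi>\<close>
  by the minorant \<open>\<phi>'\<close> of \<open>jump_op (\<tau> k) \<phi>\<close>, and the
  induction hypothesis applies to \<open>\<phi>'\<close>.\<close>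

lemma jump_ops_chain_density:
  assumes y: "y \<in> psd" and "\<phi> \<in> borel_measurable borel"
  shows "(\<integral>\<^sup>+u. chain_density \<tau> y k u * \<phi> (y + (\<Sum>i<k. outer (u i))) \<partial>PiM {..<k} (\<lambda>_. lborel))
    \<le> jump_ops \<tau> k \<phi> y"
  using assms(2)
proof (induction k arbitrary: \<phi>)
  case 0
  then show ?case by (simp add: space_PiM)
next
  case (Suc k)
  note [measurable] = Suc.prems
  interpret product_sigma_finite "\<lambda>_::nat. lborel :: (real^'d) measure" ..
  let ?P = "PiM {..<k} (\<lambda>_. lborel :: (real^'d) measure)"
  let ?Q = "PiM (insert k {..<k}) (\<lambda>_. lborel :: (real^'d) measure)"
  have [measurable]: "(\<lambda>u. chain_density \<tau> y (Suc k) u) \<in> borel_measurable ?Q"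
    by (rule measurable_chain_density) (auto intro!: measurable_component_lborel)
  have [measurable]: "(\<lambda>u. \<Sum>i<Suc k. outer (u i)) \<in> borel_measurable ?Q"
    by (intro borel_measurable_sum measurable_compose[OF measurable_component_lborel measurable_outer]) auto
  define \<phi>' where "\<phi>' z = (\<integral>\<^sup>+w. jump_density (\<tau> k) z w * \<phi> (z + outer w) \<partial>lborel)" for z
  have m' [measurable]: "\<phi>' \<in> borel_measurable borel"
    unfolding \<phi>'_def by (intro lborel.borel_measurable_nn_integral) (simp add: case_prod_beta)
  have "(\<integral>\<^sup>+u. chain_density \<tau> y (Suc k) u * \<phi> (y + (\<Sum>i<Suc k. outer (u i))) \<partial>PiM {..<Suc k} (\<lambda>_. lborel))
      = (\<integral>\<^sup>+u. (\<integral>\<^sup>+w. chain_density \<tau> y (Suc k) (u(k := w)) *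
          \<phi> (y + (\<Sum>i<Suc k. outer ((u(k := w)) i))) \<partial>lborel) \<partial>?P)"
    unfolding lessThan_Suc[of k]
    by (rule product_nn_integral_insert) (simp, simp, measurable)
  also have "\<dots> = (\<integral>\<^sup>+u. chain_density \<tau> y k u * \<phi>' (y + (\<Sum>i<k. outer (u i))) \<partial>?P)"
  proof (rule nn_integral_cong)
    fix u :: "nat \<Rightarrow> real^'d"
    let ?z = "y + (\<Sum>i<k. outer (u i))"
    have c: "chain_density \<tau> y k (u(k := w)) = chain_density \<tau> y k u" for w
      by (rule chain_density_cong) simp
    have "(\<integral>\<^sup>+w. chain_density \<tau> y (Suc k) (u(k := w)) * \<phi> (y + (\<Sum>i<Suc k. outer ((u(k := w)) i))) \<partial>lborel)
        = (\<integral>\<^sup>+w. chain_density \<tau> y k u * (jump_density (\<tau> k) ?z w * \<phi> (?z + outer w)) \<partial>lborel)"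
      by (simp add: c add.assoc mult.assoc)
    also have "\<dots> = chain_density \<tau> y k u * \<phi>' ?z"
      unfolding \<phi>'_def by (rule nn_integral_cmult) measurable
    finally show "(\<integral>\<^sup>+w. chain_density \<tau> y (Suc k) (u(k := w)) * \<phi> (y + (\<Sum>i<Suc k. outer ((u(k := w)) i))) \<partial>lborel)
        = chain_density \<tau> y k u * \<phi>' ?z" .
  qed
  also have "\<dots> \<le> jump_ops \<tau> k \<phi>' y" by (rule Suc.IH[OF m'])
  also have "\<dots> \<le> jump_ops \<tau> k (jump_op (\<tau> k) \<phi>) y"
    unfolding \<phi>'_def by (rule jump_ops_mono[OF jump_op_lower_bound y]) (use Suc.prems in auto)
  finally show ?case by simp
qed

lemma chain_density_pos:
  assumes y: "y \<in> psd"
  shows "AE u in PiM {..<k} (\<lambda>_. lborel). 0 < chain_density \<tau> y k u"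
proof (induction k)
  case 0
  then show ?case by simp
next
  case (Suc k)
  interpret product_sigma_finite "\<lambda>_::nat. lborel :: (real^'d) measure" ..
  let ?P = "PiM {..<k} (\<lambda>_. lborel :: (real^'d) measure)"
  let ?Q = "PiM (insert k {..<k}) (\<lambda>_. lborel :: (real^'d) measure)"
  have [measurable]: "(\<lambda>u. chain_density \<tau> y (Suc k) u) \<in> borel_measurable ?Q"
    by (rule measurable_chain_density) (auto intro!: measurable_component_lborel)
  define f :: "(nat \<Rightarrow> real^'d) \<Rightarrow> ennreal" where "f u = (if 0 < chain_density \<tau> y (Suc k) u then 0 else 1)" for u
  have [measurable]: "f \<in> borel_measurable ?Q" unfolding f_def by measurable
  have "(\<integral>\<^sup>+u. f u \<partial>?Q) = (\<integral>\<^sup>+u. (\<integral>\<^sup>+w. f (u(k := w)) \<partial>lborel) \<partial>?P)"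
    by (rule product_nn_integral_insert) simp_all
  also have "\<dots> = (\<integral>\<^sup>+u. 0 \<partial>?P)"
  proof (rule nn_integral_cong_AE)
    show "AE u in ?P. (\<integral>\<^sup>+w. f (u(k := w)) \<partial>lborel) = 0"
      using Suc.IH
    proof eventually_elim
      case (elim u)
      have c: "chain_density \<tau> y k (u(k := w)) = chain_density \<tau> y k u" for w
        by (rule chain_density_cong) simp
      have "AE w in lborel. 0 < jump_density (\<tau> k) (y + (\<Sum>i<k. outer (u i))) w"
        by (rule jump_density_pos[OF psd_plus_outers[OF y]])
      then have "AE w in lborel. f (u(k := w)) = 0"
        by eventually_elim (simp add: f_def c elim ennreal_zero_less_mult_iff)
      then have "(\<integral>\<^sup>+w. f (u(k := w)) \<partial>lborel) = (\<integral>\<^sup>+w. 0 \<partial>(lborel :: (real^'d) measure))"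
        by (rule nn_integral_cong_AE)
      then show ?case by simp
    qed
  qed
  finally have "(\<integral>\<^sup>+u. f u \<partial>?Q) = 0" by simp
  then have "AE u in ?Q. f u = 0" by (subst (asm) nn_integral_0_iff_AE) auto
  then show ?case unfolding lessThan_Suc by eventually_elim (simp add: f_def split: if_splits)
qed

definition rows_of :: "real^'d^'d \<Rightarrow> nat \<Rightarrow> real^'d" where
  "rows_of U i = U $ inv row_index i"

lemma rows_of_rows_matrix: "i < CARD('d) \<Longrightarrow> rows_of (rows_matrix u) i = u i"
  unfolding rows_of_def rows_matrix_def
  using bij_betw_imp_surj_on[OF row_index[where 'd = 'd]] by (simp add: f_inv_into_f)

text \<open>A minorant, for fixed jump times, of the density at \<open>z\<close> of the transported
  state reached from \<open>y\<close> by d jumps; the increment \<open>z - y\<close> is the Gram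
  matrix.\<close>

definition \<kappa> :: "(nat \<Rightarrow> real) \<Rightarrow> real^'d^'d \<Rightarrow> real^'d^'d \<Rightarrow> ennreal" where
  "\<kappa> \<tau> y z = gram_density (\<lambda>U. chain_density \<tau> y CARD('d) (rows_of U)) (z - y)"

lemma measurable_\<kappa>:
  assumes \<tau>: "\<And>i. i < CARD('d) \<Longrightarrow> (\<lambda>x. \<tau> x i) \<in> borel_measurable M"
    and [measurable]: "y \<in> borel_measurable M" "z \<in> borel_measurable M"
  shows "(\<lambda>x. \<kappa> (\<tau> x) (y x) (z x)) \<in> borel_measurable M"
  unfolding \<kappa>_def
proof (rule measurable_gram_density[where q = "\<lambda>x U. chain_density (\<tau> x) (y x) CARD('d) (rows_of U)" and N = M and p = "\<lambda>x. x"])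
  show "(\<lambda>x. chain_density (\<tau> (fst x)) (y (fst x)) CARD('d) (rows_of (snd x))) \<in> borel_measurable (M \<Otimes>\<^sub>M borel)"
    by (rule measurable_chain_density)
      (auto simp: rows_of_def intro!: measurable_compose[OF measurable_fst \<tau>] measurable_vec_nth)
qed measurable

lemma measurable_rows_density [measurable]:
  "(\<lambda>U. chain_density \<tau> y CARD('d) (rows_of U)) \<in> borel_measurable borel"
  by (rule measurable_chain_density) (auto simp: rows_of_def intro!: measurable_vec_nth)

theorem jump_ops_density:
  assumes y: "y \<in> psd" and \<phi> [measurable]: "\<phi> \<in> borel_measurable borel"
  shows "(\<integral>\<^sup>+z. \<kappa> \<tau> y z * \<phi> z \<partial>lebesgue_symmetric) \<le> jump_ops \<tau> CARD('d) \<phi> y"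
proof -
  let ?q = "\<lambda>U. chain_density \<tau> y CARD('d) (rows_of U)"
  have [measurable]: "(\<lambda>x. ?q (snd x)) \<in> borel_measurable (count_space UNIV \<Otimes>\<^sub>M borel)" by measurable
  have [measurable]: "gram_density ?q \<in> borel_measurable borel"
    by (rule measurable_gram_density[where p = "\<lambda>_. ()" and N = "count_space UNIV" and q = "\<lambda>_. ?q"]) measurable
  have "(\<integral>\<^sup>+z. \<kappa> \<tau> y z * \<phi> z \<partial>lebesgue_symmetric) = (\<integral>\<^sup>+S. \<kappa> \<tau> y (S + y) * \<phi> (S + y) \<partial>lebesgue_symmetric)"
    unfolding \<kappa>_def by (rule sym.nn_integral_translate[OF psd_symmetric[OF y], symmetric]) measurable
  also have "\<dots> = (\<integral>\<^sup>+S. gram_density ?q S * \<phi> (S + y) \<partial>lebesgue_symmetric)"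
    by (simp add: \<kappa>_def)
  also have "\<dots> \<le> (\<integral>\<^sup>+U. ?q U * \<phi> (transpose U ** U + y) \<partial>lebesgue_rows)"
    by (rule gram_density_lower_bound) measurable
  also have "\<dots> = (\<integral>\<^sup>+u. ?q (rows_matrix u) * \<phi> (transpose (rows_matrix u) ** rows_matrix u + y) \<partial>PiM {..<CARD('d)} (\<lambda>_. lborel))"
    unfolding lebesgue_rows_def by (rule nn_integral_distr) measurable
  also have "\<dots> = (\<integral>\<^sup>+u. chain_density \<tau> y CARD('d) u * \<phi> (y + (\<Sum>i<CARD('d). outer (u i))) \<partial>PiM {..<CARD('d)} (\<lambda>_. lborel))"
  proof (rule nn_integral_cong)
    fix u :: "nat \<Rightarrow> real^'d"
    have "?q (rows_matrix u) = chain_density \<tau> y CARD('d) u"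
      by (rule chain_density_cong) (rule rows_of_rows_matrix)
    then show "?q (rows_matrix u) * \<phi> (transpose (rows_matrix u) ** rows_matrix u + y)
        = chain_density \<tau> y CARD('d) u * \<phi> (y + (\<Sum>i<CARD('d). outer (u i)))"
      by (simp add: rows_matrix_gram add.commute)
  qed
  also have "\<dots> \<le> jump_ops \<tau> CARD('d) \<phi> y" by (rule jump_ops_chain_density[OF y \<phi>])
  finally show ?thesis .
qed

theorem \<kappa>_pos:
  assumes y: "y \<in> psd"
  shows "AE z in lebesgue_symmetric. z - y \<in> posdef \<longrightarrow> 0 < \<kappa> \<tau> y z"
proof -
  let ?q = "\<lambda>U. chain_density \<tau> y CARD('d) (rows_of U)"
  have "AE u in PiM {..<CARD('d)} (\<lambda>_. lborel). 0 < ?q (rows_matrix u)"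
    using chain_density_pos[OF y, where k = "CARD('d)" and \<tau> = \<tau>]
  proof eventually_elim
    case (elim u)
    have "?q (rows_matrix u) = chain_density \<tau> y CARD('d) u"
      by (rule chain_density_cong) (rule rows_of_rows_matrix)
    then show ?case using elim by simp
  qed
  then have "AE U in lebesgue_rows. 0 < ?q U"
    unfolding lebesgue_rows_def by (subst AE_distr_iff) auto
  then have AE: "AE S in lebesgue_symmetric. S \<in> posdef \<longrightarrow> 0 < gram_density ?q S"
    by (rule gram_density_pos[rotated]) measurable
  have "AE S in distr lebesgue_symmetric borel (\<lambda>S. S + - y). S \<in> posdef \<longrightarrow> 0 < gram_density ?q S"
    using AE by (subst sym.translate) (auto simp: subspace_neg[OF subspace_symmetric_matrices psd_symmetric[OF y]])
  moreover have [measurable]: "gram_density ?q \<in> borel_measurable borel"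
    by (rule measurable_gram_density[where p = "\<lambda>_. ()" and N = "count_space UNIV" and q = "\<lambda>_. ?q"]) measurable
  ultimately show ?thesis
    by (subst (asm) AE_distr_iff) (simp_all add: \<kappa>_def)
qed

end

section \<open>Jump times of the Poisson process\<close>

definition count_paths :: "(real \<Rightarrow> nat) measure" where
  "count_paths = PiM {0..} (\<lambda>_. count_space UNIV)"

text \<open>Restricting the infimum to a countable set of times makes the jump times measurable.\<close>

definition jump_time :: "real \<Rightarrow> nat \<Rightarrow> (real \<Rightarrow> nat) \<Rightarrow> real" where
  "jump_time t i \<eta> = (INF q\<in>insert t (\<rat> \<inter> {0..t}). if Suc i \<le> \<eta> q then q else t)"

text \<open>Prescribing one jump in each of n equal cells makes the probability a finite product of
  Poisson weights, and for a path from 0 it forces exactly n jumps up to \<open>t\<close>.\<close>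

definition one_jump_per_cell :: "real \<Rightarrow> nat \<Rightarrow> (real \<Rightarrow> nat) set" where
  "one_jump_per_cell t n = {\<eta> \<in> space count_paths. \<forall>i<n. \<eta> (t * real (Suc i) / real n) = Suc (\<eta> (t * real i / real n))}"

lemma measurable_count_paths: "0 \<le> q \<Longrightarrow> (\<lambda>\<eta>. \<eta> q) \<in> measurable count_paths (count_space UNIV)"
  unfolding count_paths_def by (rule measurable_component_singleton) simp

lemma measurable_jump_time [measurable]:
  assumes "0 \<le> t"
  shows "jump_time t i \<in> borel_measurable count_paths"
  unfolding jump_time_def
proof (rule borel_measurable_cINF_real)
  show "countable (insert t (\<rat> \<inter> {0..t}))" by (simp add: countable_rat)
  fix q assume "q \<in> insert t (\<rat> \<inter> {0..t})"
  then have "0 \<le> q" using assms by auto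
  note [measurable] = measurable_count_paths[OF this]
  show "(\<lambda>\<eta>. if Suc i \<le> \<eta> q then q else t) \<in> borel_measurable count_paths" by measurable
qed

lemma measurable_one_jump_per_cell [measurable]:
  assumes "0 \<le> t"
  shows "one_jump_per_cell t n \<in> sets count_paths"
proof -
  have [measurable]: "(\<lambda>\<eta>. \<eta> (t * real i / real n)) \<in> measurable count_paths (count_space UNIV)" for i
    by (rule measurable_count_paths) (use assms in simp)
  show ?thesis unfolding one_jump_per_cell_def by measurable
qed

text \<open>The last clause is right continuity, in the form it takes for an integer-valued
  path.\<close>

definition counting_path :: "(real \<Rightarrow> nat) \<Rightarrow> bool" where
  "counting_path \<eta> \<longleftrightarrow> \<eta> 0 = 0 \<and> (\<forall>s t. 0 \<le> s \<longrightarrow> s \<le> t \<longrightarrow> \<eta> s \<le> \<eta> t) \<and>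
     (\<forall>s\<ge>0. \<exists>e>0. \<forall>r. s < r \<and> r < s + e \<longrightarrow> \<eta> r = \<eta> s)"

text \<open>Jump \<open>i\<close> falls after \<open>g i\<close> and no later than
  \<open>g (Suc i)\<close>, so the jump times increase strictly. The shift \<open>k - 1\<close>
  makes room for the starting time at index 0.\<close>

lemma jump_times_of_path:
  assumes \<eta>: "counting_path \<eta>" "\<eta> \<in> one_jump_per_cell t n" and t: "0 < t" and n: "0 < n"
  shows "jump_times (\<lambda>k. if k = 0 then 0 else jump_time t (k - 1) \<eta>) n t \<eta>"
proof -
  define g where "g i = t * real i / real n" for i
  define T where "T i = jump_time t i \<eta>" for i
  have mono: "\<eta> s \<le> \<eta> r" if "0 \<le> s" "s \<le> r" for s r using \<eta>(1) that by (simp add: counting_path_def)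
  have right: "\<exists>e>0. \<forall>r. s < r \<and> r < s + e \<longrightarrow> \<eta> r = \<eta> s" if "0 \<le> s" for s
    using \<eta>(1) that by (simp add: counting_path_def)
  have g: "0 \<le> g i" "g 0 = 0" "g n = t" for i using t n by (auto simp: g_def)
  have g_le: "g i \<le> t" if "i \<le> n" for i using that t n by (simp add: g_def field_simps)
  have eg: "\<eta> (g i) = i" if "i \<le> n" for i
    using that
  proof (induction i)
    case 0
    then show ?case using \<eta>(1) by (simp add: counting_path_def g_def)
  next
    case (Suc i)
    then show ?case using \<eta>(2) by (simp add: one_jump_per_cell_def g_def)
  qed
  let ?I = "insert t (\<rat> \<inter> {0..t})"
  let ?f = "\<lambda>i q. if Suc i \<le> \<eta> q then q else t"
  have bdd: "bdd_below (?f i ` ?I)" for i by (rule bdd_belowI[of _ 0]) (use t in auto)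
  \<comment> \<open>The infimum runs over rational times only, but by monotonicity a rational just
    after \<open>s\<close> also qualifies, so the first passage is not overestimated.\<close>
  have T_le: "T i \<le> s" if "0 \<le> s" "s \<le> t" "Suc i \<le> \<eta> s" for i s
  proof (rule ccontr)
    assume "\<not> T i \<le> s"
    then have "s < T i" by simp
    moreover have "T i \<le> t"
      unfolding T_def jump_time_def by (rule cINF_lower2[OF bdd, of t]) auto
    ultimately obtain q where q: "q \<in> \<rat>" "s < q" "q < T i" "q < t"
      using Rats_dense_in_real[of s "T i"] by fastforce
    have "Suc i \<le> \<eta> q" using mono[of s q] that q by simp
    then have "T i \<le> q" unfolding T_def jump_time_def
      using q that by (intro cINF_lower2[OF bdd, of q]) auto
    then show False using q by simp
  qed
  have T_ge: "c \<le> T i" if "c \<le> t" "\<And>q. 0 \<le> q \<Longrightarrow> q \<le> t \<Longrightarrow> Suc i \<le> \<eta> q \<Longrightarrow> c \<le> q" for c i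
    unfolding T_def jump_time_def by (rule cINF_greatest) (use that t in auto)
  have before: "\<eta> s \<le> i" if "0 \<le> s" "s \<le> t" "s < T i" for s i
    using T_le[of s i] that by (meson not_less not_less_eq_eq)
  have T_gt: "g i < T i" if i: "i < n" for i
  proof -
    obtain e where e: "e > 0" "\<And>r. g i < r \<Longrightarrow> r < g i + e \<Longrightarrow> \<eta> r = \<eta> (g i)" using right[OF g(1)] by blast
    have lt: "g i < t" using i t n by (simp add: g_def field_simps)
    have "min (g i + e) t \<le> T i"
    proof (rule T_ge)
      fix q assume q: "0 \<le> q" "q \<le> t" "Suc i \<le> \<eta> q"
      have "g i < q"
      proof (rule ccontr)
        assume "\<not> g i < q"
        then show False using mono[of q "g i"] q eg[of i] i by simp
      qed
      then show "min (g i + e) t \<le> q" using e(2)[of q] q eg[of i] i by (cases "q < g i + e") auto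
    qed simp
    then show ?thesis using e lt by simp
  qed
  have T_g: "T i \<le> g (Suc i)" if "i < n" for i
    by (rule T_le) (use that g g_le[of "Suc i"] eg[of "Suc i"] in auto)
  have after: "Suc i \<le> \<eta> s" if i: "i < n" and s: "T i \<le> s" "s \<le> t" for s i
  proof -
    have T0: "0 \<le> T i" using T_gt[OF i] g(1)[of i] by simp
    have gt: "Suc i \<le> \<eta> r" if r: "T i < r" "r \<le> t" for r
    proof -
      have "\<exists>q\<in>?I. ?f i q < r"
        using cINF_less_iff[OF _ bdd[of i], of r] r by (simp add: T_def jump_time_def)
      then obtain q where "q \<in> ?I" "?f i q < r" by blast
      then have "0 \<le> q" "Suc i \<le> \<eta> q" "q < r" using r t by (auto split: if_splits)
      then show ?thesis using mono[of q r] by simp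
    qed
    \<comment> \<open>The passage level is attained at \<open>T i\<close>: by right continuity if
      \<open>T i < t\<close>, and because the path equals \<open>n\<close> at \<open>t\<close>
      otherwise.\<close>
    have "Suc i \<le> \<eta> (T i)"
    proof (cases "T i < t")
      case True
      obtain e where e: "e > 0" "\<And>r. T i < r \<Longrightarrow> r < T i + e \<Longrightarrow> \<eta> r = \<eta> (T i)" using right[OF T0] by blast
      define r where "r = min t (T i + e / 2)"
      have "T i < r" "r < T i + e" "r \<le> t" using e True by (auto simp: r_def)
      then show ?thesis using e(2)[of r] gt[of r] by simp
    next
      case False
      then have "T i = t" using T_g[OF i] g_le[of "Suc i"] i by simp
      then show ?thesis using eg[of n] g(3) i by simp
    qed
    then show ?thesis using mono[OF T0 s(1)] by simp
  qed
  show ?thesis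
  proof
    show "(if 0 = (0 :: nat) then 0 else jump_time t (0 - 1) \<eta>) = 0" by simp
    fix i assume i: "i < n"
    show "(if i = 0 then 0 else jump_time t (i - 1) \<eta>) < (if Suc i = 0 then 0 else jump_time t (Suc i - 1) \<eta>)"
    proof (cases i)
      case 0
      then show ?thesis using T_gt[of 0] i g by (simp add: T_def)
    next
      case (Suc j)
      then show ?thesis using T_gt[OF i] T_g[of j] i by (simp add: T_def)
    qed
  next
    show "(if n = 0 then 0 else jump_time t (n - 1) \<eta>) \<le> t"
      using T_g[of "n - 1"] g_le[of n] n by (simp add: T_def)
  next
    fix k s
    assume k: "k < n" and lo: "(if k = 0 then 0 else jump_time t (k - 1) \<eta>) \<le> s"
      and hi: "s < (if Suc k = 0 then 0 else jump_time t (Suc k - 1) \<eta>)"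
    have sT: "s < T k" using hi by (simp add: T_def)
    then have st: "s \<le> t" using T_g[OF k] g_le[of "Suc k"] k by simp
    have s0: "0 \<le> s"
    proof (cases k)
      case (Suc j)
      then show ?thesis using lo T_gt[of j] g(1)[of j] k by (simp add: T_def)
    qed (use lo in simp)
    have "k \<le> \<eta> s" using lo after[of "k - 1" s] k st by (cases k) (auto simp: T_def)
    then show "\<eta> s = k" using before[OF s0 st sT] by simp
  next
    fix s assume lo: "(if n = 0 then 0 else jump_time t (n - 1) \<eta>) \<le> s" and st: "s \<le> t"
    have s0: "0 \<le> s"
    proof (cases n)
      case (Suc j)
      then show ?thesis using lo T_gt[of j] g(1)[of j] by (simp add: T_def)
    qed (use n in simp)
    have "n \<le> \<eta> s" using lo after[of "n - 1" s] n st by (auto simp: T_def)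
    then show "\<eta> s = n" using mono[OF s0 st] eg[of n] g(3) by simp
  qed
qed

text \<open>The law of an increment gives monotonicity almost surely for one pair of times.
  Countably many rational pairs are handled together, and right continuity extends the inequality to
  all times.\<close>

lemma (in prob_space) AE_counting_path:
  assumes N: "poisson_process M rate N" and rate: "0 < rate"
  shows "AE w in M. counting_path (\<lambda>t\<in>{0..}. N t w)"
proof -
  have meas: "N t \<in> measurable M (count_space UNIV)" if "0 \<le> t" for t
    using N that by (simp add: poisson_process_def)
  have inc: "AE w in M. N s w \<le> N t w" if "0 \<le> s" "s < t" for s t
  proof -
    \<comment> \<open>A partition with a single step: the independence clause is invoked for the
      measurability of this one increment.\<close>
    define \<tau> where "\<tau> i = (if i = 0 then s else t)" for i :: nat
    have "indep_vars (\<lambda>_. count_space UNIV) (\<lambda>i w. int (N (\<tau> (Suc i)) w) - int (N (\<tau> i) w)) {..<1}"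
    proof -
      have "0 \<le> \<tau> 0" "\<forall>i<1. \<tau> i < \<tau> (Suc i)" using that by (auto simp: \<tau>_def)
      then show ?thesis using N unfolding poisson_process_def by blast
    qed
    then have [measurable]: "(\<lambda>w. int (N t w) - int (N s w)) \<in> measurable M (count_space UNIV)"
      by (auto simp: indep_vars_def \<tau>_def)
    have "AE k in measure_pmf (map_pmf int (poisson_pmf (rate * (t - s)))). 0 \<le> k"
      by (auto simp: AE_measure_pmf_iff)
    moreover have "distr M (count_space UNIV) (\<lambda>w. int (N t w) - int (N s w)) =
        measure_pmf (map_pmf int (poisson_pmf (rate * (t - s))))"
      using N that unfolding poisson_process_def by blast
    ultimately have "AE k in distr M (count_space UNIV) (\<lambda>w. int (N t w) - int (N s w)). 0 \<le> k"
      by (simp only:)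
    then show ?thesis by (subst (asm) AE_distr_iff) auto
  qed
  have "AE w in M. \<forall>s\<in>\<rat> \<inter> {0..}. \<forall>t\<in>\<rat> \<inter> {0..}. s < t \<longrightarrow> N s w \<le> N t w"
    using inc by (intro AE_ball_countable[THEN iffD2] ballI countable_Int1 countable_rat) auto
  moreover have "AE w in M. N 0 w = 0 \<and> cadlag (\<lambda>t. real (N t w))"
    using N by (simp add: poisson_process_def)
  ultimately show ?thesis
  proof eventually_elim
    case (elim w)
    have right: "\<exists>e>0. \<forall>r. s < r \<and> r < s + e \<longrightarrow> N r w = N s w" if "0 \<le> s" for s
    proof -
      have "((\<lambda>t. real (N t w)) \<longlongrightarrow> real (N s w)) (at_right s)" using elim that by (auto simp: cadlag_def)
      then have "\<forall>\<^sub>F r in at_right s. dist (real (N r w)) (real (N s w)) < 1" by (rule tendstoD) simp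
      then obtain c where c: "s < c" "\<And>r. s < r \<Longrightarrow> r < c \<Longrightarrow> dist (real (N r w)) (real (N s w)) < 1"
        by (auto simp: eventually_at_right_field)
      have "N r w = N s w" if "s < r" "r < c" for r
        using c(2)[OF that] by (simp add: dist_real_def abs_less_iff)
      then show ?thesis using c(1) by (intro exI[of _ "c - s"]) auto
    qed
    have "N s w \<le> N t w" if st: "0 \<le> s" "s < t" for s t
    proof -
      obtain e where e: "e > 0" "\<And>r. s < r \<Longrightarrow> r < s + e \<Longrightarrow> N r w = N s w" using right[OF st(1)] by blast
      obtain e' where e': "e' > 0" "\<And>r. t < r \<Longrightarrow> r < t + e' \<Longrightarrow> N r w = N t w" using right[of t] st by auto
      obtain q where q: "q \<in> \<rat>" "s < q" "q < min (s + e) t" using Rats_dense_in_real[of s "min (s + e) t"] e st by auto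
      obtain q' where q': "q' \<in> \<rat>" "t < q'" "q' < t + e'" using Rats_dense_in_real[of t "t + e'"] e' by auto
      have "N q w \<le> N q' w" using elim(1) q q' st by auto
      then show ?thesis using e(2)[of q] e'(2)[of q'] q q' by simp
    qed
    then have "N s w \<le> N t w" if "0 \<le> s" "s \<le> t" for s t
      using that by (cases "s = t") auto
    moreover have "\<exists>e>0. \<forall>r. s < r \<and> r < s + e \<longrightarrow> (\<lambda>t\<in>{0..}. N t w) r = (\<lambda>t\<in>{0..}. N t w) s" if "0 \<le> s" for s
      using right[OF that] that by fastforce
    ultimately show ?case using elim(2) by (simp add: counting_path_def)
  qed
qed

lemma (in prob_space) prob_one_jump_per_cell:
  assumes N: "poisson_process M rate N" and rate: "0 < rate" and t: "0 < t" and n: "0 < n"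
  shows "0 < emeasure M {w \<in> space M. (\<lambda>t\<in>{0..}. N t w) \<in> one_jump_per_cell t n}"
proof -
  define g where "g i = t * real i / real n" for i
  define Z where "Z i w = int (N (g (Suc i)) w) - int (N (g i) w)" for i w
  have g0: "0 \<le> g i" for i using t n by (simp add: g_def)
  have g_less: "g i < g (Suc i)" for i using t n by (simp add: g_def field_simps)
  have ind: "indep_vars (\<lambda>_. count_space UNIV) Z {..<n}"
    using N g0 g_less unfolding poisson_process_def Z_def by blast
  have Zm: "Z i \<in> measurable M (count_space UNIV)" if "i < n" for i
    using ind that by (auto simp: indep_vars_def)
  have one: "0 < prob (Z i -` {1} \<inter> space M)" if i: "i < n" for i
  proof -
    let ?p = "poisson_pmf (rate * (g (Suc i) - g i))"
    have r: "0 < rate * (g (Suc i) - g i)" using rate g_less[of i] by simp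
    have "prob (Z i -` {1} \<inter> space M) = measure (distr M (count_space UNIV) (Z i)) {1}"
      using Zm[OF i] by (simp add: measure_distr)
    also have "distr M (count_space UNIV) (Z i) = measure_pmf (map_pmf int ?p)"
      using N g0 g_less unfolding poisson_process_def Z_def by blast
    also have "measure (measure_pmf (map_pmf int ?p)) {1} = pmf (map_pmf int ?p) (int 1)"
      by (simp add: pmf.rep_eq)
    also have "\<dots> = pmf ?p 1" by (rule pmf_map_inj') (simp add: inj_on_def)
    also have "\<dots> > 0" using r by simp
    finally show ?thesis .
  qed
  have "prob (\<Inter>i\<in>{..<n}. Z i -` {1} \<inter> space M) = (\<Prod>i<n. prob (Z i -` {1} \<inter> space M))"
    using n by (intro indep_varsD_finite[OF ind]) auto
  also have "\<dots> > 0" using one by (intro prod_pos) auto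
  finally have "0 < emeasure M (\<Inter>i\<in>{..<n}. Z i -` {1} \<inter> space M)"
    by (simp add: emeasure_eq_measure)
  also have "(\<Inter>i\<in>{..<n}. Z i -` {1} \<inter> space M) = {w \<in> space M. (\<lambda>t\<in>{0..}. N t w) \<in> one_jump_per_cell t n}"
  proof -
    have "Z i w = 1 \<longleftrightarrow> N (g (Suc i)) w = Suc (N (g i) w)" for i w unfolding Z_def by auto
    moreover have "(\<lambda>t\<in>{0..}. N t w) \<in> one_jump_per_cell t n \<longleftrightarrow> (\<forall>i<n. N (g (Suc i)) w = Suc (N (g i) w))" for w
      using g0 unfolding one_jump_per_cell_def g_def[symmetric]
      by (simp add: count_paths_def space_PiM del: of_nat_Suc)
    ultimately show ?thesis using n by auto
  qed
  finally show ?thesis .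
qed


section \<open>Lower bounds for the transition probabilities\<close>

text \<open>The density is the Radon-Nikodym derivative of \<open>Fa\<close>. Minorization follows
  from \<open>Fa \<le> F\<close>; the zero set of the derivative is \<open>Fa\<close>-null, hence
  Lebesgue-null by equivalence.\<close>

lemma absolutely_continuous_part_density:
  fixes F :: "'a::euclidean_space measure"
  assumes dec: "lebesgue_decomposition lborel F Fa Fs" and equiv: "equivalent_measures Fa lborel"
  obtains f where "f \<in> borel_measurable borel" "AE v in lborel. 0 < f v"
    "\<And>\<phi>. \<phi> \<in> borel_measurable borel \<Longrightarrow> (\<integral>\<^sup>+v. f v * \<phi> v \<partial>lborel) \<le> (\<integral>\<^sup>+v. \<phi> v \<partial>F)"
proof (rule that[of "RN_deriv lborel Fa"])
  have sets: "sets F = sets lborel" "sets Fa = sets lborel" and ac: "absolutely_continuous lborel Fa"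
    and sum: "\<And>E. E \<in> sets lborel \<Longrightarrow> emeasure F E = emeasure Fa E + emeasure Fs E"
    using dec by (auto simp: lebesgue_decomposition_def)
  show m: "RN_deriv lborel Fa \<in> borel_measurable borel" by simp
  have "Fa \<le> F"
    using sets sum by (subst le_measure) simp_all
  then have le: "integral\<^sup>N Fa \<phi> \<le> integral\<^sup>N F \<phi>" for \<phi>
    by (rule nn_integral_mono_measure[rotated]) (simp add: sets)
  show "(\<integral>\<^sup>+v. RN_deriv lborel Fa v * \<phi> v \<partial>lborel) \<le> (\<integral>\<^sup>+v. \<phi> v \<partial>F)"
    if "\<phi> \<in> borel_measurable borel" for \<phi>
    using sigma_finite_measure.RN_deriv_nn_integral[OF sigma_finite_lborel ac sets(2), of \<phi>] that le[of \<phi>]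
    by simp
  let ?Z = "{v. RN_deriv lborel Fa v = 0}"
  have Z [measurable]: "?Z \<in> sets borel" by measurable
  have "emeasure Fa ?Z = (\<integral>\<^sup>+v. indicator ?Z v \<partial>Fa)" using sets by simp
  also have "\<dots> = (\<integral>\<^sup>+v. RN_deriv lborel Fa v * indicator ?Z v \<partial>lborel)"
    by (rule sigma_finite_measure.RN_deriv_nn_integral[OF sigma_finite_lborel ac sets(2)]) measurable
  also have "\<dots> = (\<integral>\<^sup>+v. 0 \<partial>(lborel :: 'a measure))" by (intro nn_integral_cong) (simp add: indicator_def)
  finally have "?Z \<in> null_sets Fa" using sets by (simp add: null_sets_def)
  then have "?Z \<in> null_sets lborel"
    using equiv unfolding equivalent_measures_def absolutely_continuous_def by blast
  from AE_not_in[OF this] show "AE v in lborel. 0 < RN_deriv lborel Fa v"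
    by eventually_elim (simp add: zero_less_iff_neq_zero)
qed

text \<open>Conditionally on the counting path, the first n jump sizes are still independent with
  law \<open>F\<close>. The product form is checked on rectangles, where the independence of the two
  generated sigma-algebras applies.\<close>

lemma (in prob_space) compound_poisson_law:
  assumes N: "\<And>t. 0 \<le> t \<Longrightarrow> N t \<in> measurable M (count_space UNIV)"
    and X: "indep_vars (\<lambda>_. borel) X (UNIV :: nat set)" "\<And>i. distr M borel (X i) = F"
    and indep: "indep_set
          (sets (vimage_algebra (space M) (\<lambda>w. \<lambda>t\<in>{0..}. N t w) (PiM {0..} (\<lambda>_. count_space UNIV))))
          (sets (vimage_algebra (space M) (\<lambda>w i. X i w) (PiM UNIV (\<lambda>_. borel))))"
    and n: "0 < n"
  shows "distr M (count_paths \<Otimes>\<^sub>M PiM {..<n} (\<lambda>_. borel)) (\<lambda>w. (\<lambda>t\<in>{0..}. N t w, \<lambda>i\<in>{..<n}. X i w))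
    = distr M count_paths (\<lambda>w. \<lambda>t\<in>{0..}. N t w) \<Otimes>\<^sub>M PiM {..<n} (\<lambda>_. F)"
proof -
  have Xm: "X i \<in> borel_measurable M" for i using X(1) by (auto simp: indep_vars_def)
  have Nm: "(\<lambda>w. \<lambda>t\<in>{0..}. N t w) \<in> measurable M (PiM {0..} (\<lambda>_. count_space UNIV))"
    by (rule measurable_restrict) (simp add: N)
  have Xs: "(\<lambda>w i. X i w) \<in> measurable M (PiM UNIV (\<lambda>_. borel))"
    by (rule measurable_PiM_single') (auto simp: Xm)
  have "distr M (PiM {..<n} (\<lambda>_. borel)) (\<lambda>w. \<lambda>i\<in>{..<n}. X i w) = PiM {..<n} (\<lambda>i. distr M borel (X i))"
    by (rule indep_vars_iff_distr_eq_PiM[THEN iffD1])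
      (use n Xm in \<open>auto intro: indep_vars_subset[OF X(1)]\<close>)
  then have law: "distr M (PiM {..<n} (\<lambda>_. borel)) (\<lambda>w. \<lambda>i\<in>{..<n}. X i w) = PiM {..<n} (\<lambda>_. F)"
    by (simp add: X(2))
  have Nm': "(\<lambda>w. \<lambda>t\<in>{0..}. N t w) \<in> measurable M count_paths" using Nm by (simp add: count_paths_def)
  have Xr: "(\<lambda>w. \<lambda>i\<in>{..<n}. X i w) \<in> measurable M (PiM {..<n} (\<lambda>_. borel))"
    by (rule measurable_restrict) (simp add: Xm)
  interpret A: prob_space "distr M count_paths (\<lambda>w. \<lambda>t\<in>{0..}. N t w)" by (rule prob_space_distr[OF Nm'])
  interpret B: prob_space "PiM {..<n} (\<lambda>_. F)" unfolding law[symmetric] by (rule prob_space_distr[OF Xr])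
  show ?thesis
  proof (rule pair_measure_eqI[symmetric])
    show "sigma_finite_measure (distr M count_paths (\<lambda>w. \<lambda>t\<in>{0..}. N t w))" ..
    show "sigma_finite_measure (PiM {..<n} (\<lambda>_. F))" ..
    have "sets F = sets borel" using X(2)[of 0] by (metis sets_distr)
    then have "sets (PiM {..<n} (\<lambda>_. F)) = sets (PiM {..<n} (\<lambda>_. borel))" by (intro sets_PiM_cong) auto
    from sets_pair_measure_cong[OF sets_distr this] show "sets (distr M count_paths (\<lambda>w. \<lambda>t\<in>{0..}. N t w) \<Otimes>\<^sub>M PiM {..<n} (\<lambda>_. F))
      = sets (distr M (count_paths \<Otimes>\<^sub>M PiM {..<n} (\<lambda>_. borel)) (\<lambda>w. (\<lambda>t\<in>{0..}. N t w, \<lambda>i\<in>{..<n}. X i w)))"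
      by simp
    fix P Q assume "P \<in> sets (distr M count_paths (\<lambda>w. \<lambda>t\<in>{0..}. N t w))" "Q \<in> sets (PiM {..<n} (\<lambda>_. F))"
    then have P: "P \<in> sets count_paths" and Q: "Q \<in> sets (PiM {..<n} (\<lambda>_. borel))"
      unfolding law[symmetric] by simp_all
    let ?P = "(\<lambda>w. \<lambda>t\<in>{0..}. N t w) -` P \<inter> space M" and ?Q = "(\<lambda>w. \<lambda>i\<in>{..<n}. X i w) -` Q \<inter> space M"
    have P': "?P \<in> sets (vimage_algebra (space M) (\<lambda>w. \<lambda>t\<in>{0..}. N t w) (PiM {0..} (\<lambda>_. count_space UNIV)))"
      using P by (intro in_vimage_algebra) (simp add: count_paths_def)
    let ?R = "(\<lambda>v. restrict v {..<n}) -` Q \<inter> space (PiM UNIV (\<lambda>_. borel))"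
    have "?R \<in> sets (PiM UNIV (\<lambda>_. borel))"
      by (rule measurable_sets[OF measurable_restrict_subset Q]) simp
    then have "(\<lambda>w i. X i w) -` ?R \<inter> space M \<in> sets (vimage_algebra (space M) (\<lambda>w i. X i w) (PiM UNIV (\<lambda>_. borel)))"
      by (rule in_vimage_algebra)
    also have "(\<lambda>w i. X i w) -` ?R \<inter> space M = ?Q" by (auto simp: space_PiM)
    finally have "prob (?P \<inter> ?Q) = prob ?P * prob ?Q" by (rule indep_setD[OF indep P'])
    then have "emeasure M (?P \<inter> ?Q) = emeasure M ?P * emeasure M ?Q"
      by (simp add: emeasure_eq_measure ennreal_mult)
    moreover have "emeasure (distr M count_paths (\<lambda>w. \<lambda>t\<in>{0..}. N t w)) P = emeasure M ?P"
      by (rule emeasure_distr[OF Nm' P])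
    moreover have "emeasure (PiM {..<n} (\<lambda>_. F)) Q = emeasure M ?Q"
      unfolding law[symmetric] by (rule emeasure_distr[OF Xr Q])
    moreover have "emeasure (distr M (count_paths \<Otimes>\<^sub>M PiM {..<n} (\<lambda>_. borel)) (\<lambda>w. (\<lambda>t\<in>{0..}. N t w, \<lambda>i\<in>{..<n}. X i w))) (P \<times> Q)
        = emeasure M (?P \<inter> ?Q)"
      using P Q Nm' Xr by (subst emeasure_distr) (auto intro!: arg_cong[where f = "emeasure M"])
    ultimately show "emeasure (distr M count_paths (\<lambda>w. \<lambda>t\<in>{0..}. N t w)) P * emeasure (PiM {..<n} (\<lambda>_. F)) Q
      = emeasure (distr M (count_paths \<Otimes>\<^sub>M PiM {..<n} (\<lambda>_. borel)) (\<lambda>w. (\<lambda>t\<in>{0..}. N t w, \<lambda>i\<in>{..<n}. X i w))) (P \<times> Q)"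
      by simp
  qed
qed

text \<open>The value at time \<open>t\<close> is the limit of values at grid points. Rounding down
  and adding 1 puts the grid point strictly to the right of \<open>t\<close>, where right continuity
  gives convergence. This makes the occupation integrals over time accessible to Fubini.\<close>

lemma jointly_measurable_cadlag:
  fixes Y :: "real \<Rightarrow> 'w \<Rightarrow> 'b::{real_normed_vector, second_countable_topology}"
  assumes Y: "\<And>t. 0 \<le> t \<Longrightarrow> Y t \<in> borel_measurable M"
    and cad: "AE w in M. cadlag (\<lambda>t. Y t w)"
  obtains N0 where "N0 \<in> null_sets M"
    "(\<lambda>z. if snd z \<in> N0 \<or> fst z < 0 then 0 else Y (fst z) (snd z)) \<in> borel_measurable (borel \<Otimes>\<^sub>M M)"
proof -
  obtain N0 where "{w \<in> space M. \<not> cadlag (\<lambda>t. Y t w)} \<subseteq> N0" "emeasure M N0 = 0" "N0 \<in> sets M"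
    using AE_E[OF cad] by blast
  then have N0: "N0 \<in> null_sets M" "{w \<in> space M. \<not> cadlag (\<lambda>t. Y t w)} \<subseteq> N0" by auto
  have [measurable]: "N0 \<in> sets M" using N0 by auto
  define Z where "Z n z = (if snd z \<in> N0 \<or> fst z < 0 then 0
    else Y (real_of_int (\<lfloor>fst z * real (Suc n)\<rfloor> + 1) / real (Suc n)) (snd z))" for n :: nat and z :: "real \<times> 'w"
  have Z: "Z n \<in> borel_measurable (borel \<Otimes>\<^sub>M M)" for n
  proof -
    define f where "f i z = (if snd z \<in> N0 \<or> i < 0 then 0 else Y (real_of_int (i + 1) / real (Suc n)) (snd z))"
      for i :: int and z :: "real \<times> 'w"
    have f: "f i \<in> borel_measurable (borel \<Otimes>\<^sub>M M)" for i
    proof (cases "i < 0")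
      case False
      have [measurable]: "Y (real_of_int (i + 1) / real (Suc n)) \<in> borel_measurable M"
        by (rule Y) (use False in simp)
      show ?thesis unfolding f_def by measurable
    next
      case True
      then have "f i = (\<lambda>_. 0)" by (simp add: f_def fun_eq_iff)
      then show ?thesis by simp
    qed
    have "(\<lambda>z. f \<lfloor>fst z * real (Suc n)\<rfloor> z) \<in> borel_measurable (borel \<Otimes>\<^sub>M M)"
      by (rule measurable_compose_countable[OF f]) measurable
    also have "(\<lambda>z. f \<lfloor>fst z * real (Suc n)\<rfloor> z) = Z n"
      by (auto simp: Z_def f_def fun_eq_iff floor_less_iff mult_less_0_iff zero_less_mult_iff)
    finally show ?thesis .
  qed
  have "(\<lambda>z. if snd z \<in> N0 \<or> fst z < 0 then 0 else Y (fst z) (snd z)) \<in> borel_measurable (borel \<Otimes>\<^sub>M M)"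
  proof (rule borel_measurable_LIMSEQ_metric[OF Z])
    fix z :: "real \<times> 'w" assume z: "z \<in> space (borel \<Otimes>\<^sub>M M)"
    show "(\<lambda>n. Z n z) \<longlonglongrightarrow> (if snd z \<in> N0 \<or> fst z < 0 then 0 else Y (fst z) (snd z))"
    proof (cases "snd z \<in> N0 \<or> fst z < 0")
      case False
      define t where "t = fst z"
      have "cadlag (\<lambda>t. Y t (snd z))" using z False N0(2) by (auto simp: space_pair_measure)
      then have lim: "((\<lambda>r. Y r (snd z)) \<longlongrightarrow> Y t (snd z)) (at_right t)"
        using False by (auto simp: cadlag_def t_def)
      define r where "r n = real_of_int (\<lfloor>t * real (Suc n)\<rfloor> + 1) / real (Suc n)" for n :: nat
      have r: "t < r n" "r n \<le> t + 1 / real (Suc n)" for n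
      proof -
        have "t * real (Suc n) < real_of_int (\<lfloor>t * real (Suc n)\<rfloor> + 1)" by linarith
        then show "t < r n" by (simp add: r_def less_divide_eq)
        have "real_of_int (\<lfloor>t * real (Suc n)\<rfloor> + 1) \<le> t * real (Suc n) + 1" by linarith
        then have "r n \<le> (t * real (Suc n) + 1) / real (Suc n)" unfolding r_def by (rule divide_right_mono) simp
        then show "r n \<le> t + 1 / real (Suc n)" by (simp add: add_divide_distrib)
      qed
      have "r \<longlonglongrightarrow> t"
      proof (rule tendsto_sandwich)
        show "(\<lambda>n. t) \<longlonglongrightarrow> t" by simp
        show "(\<lambda>n. t + 1 / real (Suc n)) \<longlonglongrightarrow> t"
          using tendsto_add[OF tendsto_const[of t] LIMSEQ_Suc[OF lim_1_over_n]] by simp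
      qed (use r in \<open>auto intro!: always_eventually less_imp_le\<close>)
      then have "filterlim r (at_right t) sequentially"
        using r(1) by (auto simp: filterlim_at intro!: always_eventually)
      from filterlim_compose[OF lim this] have "(\<lambda>n. Y (r n) (snd z)) \<longlonglongrightarrow> Y t (snd z)" .
      then show ?thesis using False by (simp add: Z_def r_def t_def)
    qed (simp add: Z_def)
  qed
  then show ?thesis by (rule that[OF N0(1)])
qed

section \<open>Maximal irreducibility measures\<close>

text \<open>Exhaustion: all irreducibility measures are absolutely continuous with respect to one finite measure
  \<open>m\<close>, so a set of maximal \<open>m\<close>-measure among those all of whose non-null subsets are hit from every
  state carries a maximal irreducibility measure.  The Markov property plays no role.\<close>

theorem maximal_irreducibility_measure_exists:
  fixes S :: "'a measure" and P :: "real \<Rightarrow> 'a \<Rightarrow> 'a measure"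
  assumes sets_P: "\<And>t x. sets (P t x) = sets S"
    and m: "finite_measure m" "sets m = sets S"
    and dom: "\<And>\<phi>. irreducible_wrt S P \<phi> \<Longrightarrow> absolutely_continuous m \<phi>"
  shows "\<exists>\<psi>. maximal_irreducibility_measure S P \<psi>"
proof -
  interpret m: finite_measure m by (rule m)
  define hit where "hit D \<longleftrightarrow> (\<forall>x\<in>space S. 0 < (\<integral>\<^sup>+t\<in>{0..}. emeasure (P t x) D \<partial>lborel))" for D
  have hit_mono: "hit D'" if "hit D" "D \<subseteq> D'" "D' \<in> sets S" for D D'
    unfolding hit_def
  proof
    fix x assume "x \<in> space S"
    then have "0 < (\<integral>\<^sup>+t\<in>{0..}. emeasure (P t x) D \<partial>lborel)" using that by (simp add: hit_def)
    also have "\<dots> \<le> (\<integral>\<^sup>+t\<in>{0..}. emeasure (P t x) D' \<partial>lborel)"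
      using that sets_P by (intro nn_integral_mono mult_right_mono emeasure_mono) auto
    finally show "0 < (\<integral>\<^sup>+t\<in>{0..}. emeasure (P t x) D' \<partial>lborel)" .
  qed
  define \<C> where "\<C> = {E \<in> sets S. \<forall>D\<in>sets S. D \<subseteq> E \<longrightarrow> 0 < emeasure m D \<longrightarrow> hit D}"
  have \<C>_sets: "E \<in> sets S" if "E \<in> \<C>" for E using that by (simp add: \<C>_def)
  define s where "s = (SUP E\<in>\<C>. measure m E)"
  have bdd: "bdd_above (measure m ` \<C>)" by (rule bdd_aboveI[of _ "measure m (space m)"]) (auto intro: m.bounded_measure)
  have ne: "{} \<in> \<C>" by (auto simp: \<C>_def)
  have "\<exists>E\<in>\<C>. s - 1 / real (Suc n) < measure m E" for n
  proof -
    have "s - 1 / real (Suc n) < s" by simp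
    then show ?thesis unfolding s_def using less_cSUP_iff[OF _ bdd] ne by blast
  qed
  then obtain E where E: "\<And>n. E n \<in> \<C>" "\<And>n. s - 1 / real (Suc n) < measure m (E n)" by metis
  define E' where "E' = (\<Union>n. E n)"
  have E'_sets [measurable]: "E' \<in> sets m" using \<C>_sets[OF E(1)] by (auto simp: E'_def m(2))
  have E'_hit: "hit D" if D: "D \<in> sets S" "0 < emeasure m (D \<inter> E')" for D
  proof -
    have "\<exists>n. 0 < emeasure m (D \<inter> E n)"
    proof (rule ccontr)
      assume "\<not> ?thesis"
      then have "D \<inter> E n \<in> null_sets m" for n
        using D(1) \<C>_sets[OF E(1)[of n]] by (auto simp: null_sets_def m(2) zero_less_iff_neq_zero)
      then have "(\<Union>n. D \<inter> E n) \<in> null_sets m" by (rule null_sets_UN)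
      then show False using D(2) by (simp add: E'_def null_sets_def)
    qed
    then obtain n where n: "0 < emeasure m (D \<inter> E n)" by blast
    have "D \<inter> E n \<in> sets S" using D(1) \<C>_sets[OF E(1)] by blast
    then have "hit (D \<inter> E n)" using E(1)[of n] n by (simp add: \<C>_def)
    then show ?thesis by (rule hit_mono) (use D in auto)
  qed
  have s_le: "s \<le> measure m E'"
  proof (rule LIMSEQ_le_const2)
    show "(\<lambda>n. s - 1 / real (Suc n)) \<longlonglongrightarrow> s"
      using tendsto_diff[OF tendsto_const[of s] LIMSEQ_Suc[OF lim_1_over_n]] by simp
    have "measure m (E n) \<le> measure m E'" for n by (rule m.finite_measure_mono) (auto simp: E'_def E'_sets[unfolded E'_def])
    then show "\<exists>N. \<forall>n\<ge>N. s - 1 / real (Suc n) \<le> measure m E'"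
      using E(2) by (meson less_imp_le order_trans)
  qed
  define \<psi> where "\<psi> = density m (indicator E')"
  have \<psi>: "emeasure \<psi> D = emeasure m (D \<inter> E')" if "D \<in> sets S" for D
  proof -
    have D [measurable]: "D \<in> sets m" using that m(2) by simp
    have "emeasure \<psi> D = (\<integral>\<^sup>+x. indicator E' x * indicator D x \<partial>m)"
      unfolding \<psi>_def by (rule emeasure_density) measurable
    also have "\<dots> = (\<integral>\<^sup>+x. indicator (D \<inter> E') x \<partial>m)"
      by (intro nn_integral_cong) (auto simp: indicator_def)
    also have "\<dots> = emeasure m (D \<inter> E')" by (rule nn_integral_indicator) measurable
    finally show ?thesis .
  qed
  have sets_\<psi>: "sets \<psi> = sets S" by (simp add: \<psi>_def m(2))
  have irr: "irreducible_wrt S P \<psi>"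
    unfolding irreducible_wrt_def
  proof (intro conjI ballI impI)
    have "finite_measure \<psi>"
    proof
      have "space \<psi> = space S" using sets_eq_imp_space_eq[OF sets_\<psi>] .
      then show "emeasure \<psi> (space \<psi>) \<noteq> \<infinity>" using \<psi>[of "space S"] m.emeasure_finite by simp
    qed
    then show "sigma_finite_measure \<psi>" by (rule finite_measure.axioms)
    show "0 < (\<integral>\<^sup>+t\<in>{0..}. emeasure (P t x) D \<partial>lborel)"
      if "x \<in> space S" "D \<in> sets S" "0 < emeasure \<psi> D" for x D
      using E'_hit[of D] that \<psi>[of D] by (simp add: hit_def)
  qed (rule sets_\<psi>)
  have "absolutely_continuous \<psi> \<phi>" if \<phi>: "irreducible_wrt S P \<phi>" for \<phi>
    unfolding absolutely_continuous_def
  proof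
    fix D assume "D \<in> null_sets \<psi>"
    then have D: "D \<in> sets S" "emeasure m (D \<inter> E') = 0" using \<psi>[of D] by (auto simp: null_sets_def sets_\<psi>)
    have sets_\<phi>: "sets \<phi> = sets S" using \<phi> by (simp add: irreducible_wrt_def)
    define f where "f = RN_deriv m \<phi>"
    have f [measurable]: "f \<in> borel_measurable m" by (simp add: f_def)
    have dens: "emeasure \<phi> G = (\<integral>\<^sup>+x. f x * indicator G x \<partial>m)" if "G \<in> sets S" for G
    proof -
      have "density m f = \<phi>" unfolding f_def
        by (rule m.density_RN_deriv[OF dom[OF \<phi>]]) (simp add: sets_\<phi> m(2))
      then show ?thesis using that m(2) f emeasure_density[of f m G] by simp
    qed
    \<comment> \<open>The part of \<open>D\<close> on which \<open>\<phi>\<close> has positive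
      density. Every \<open>m\<close>-non-null subset of it is charged by \<open>\<phi>\<close> and
      hence hit, so if \<open>G\<close> were not \<open>m\<close>-null, \<open>G \<union> E'\<close>
      would exceed the supremum \<open>s\<close>.\<close>
    define G where "G = {x \<in> space m. x \<in> D \<and> 0 < f x}"
    have G [measurable]: "G \<in> sets m" using D(1) m(2) unfolding G_def by measurable
    have "emeasure m G = 0"
    proof (rule ccontr)
      assume "emeasure m G \<noteq> 0"
      then have Gpos: "0 < measure m G"
        by (simp add: m.emeasure_eq_measure zero_less_measure_iff)
      have "G \<union> E' \<in> \<C>"
        unfolding \<C>_def
      proof (intro CollectI conjI ballI impI)
        show "G \<union> E' \<in> sets S" using G E'_sets m(2) by auto
        fix H assume H: "H \<in> sets S" "H \<subseteq> G \<union> E'" "0 < emeasure m H"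
        show "hit H"
        proof (cases "0 < emeasure m (H \<inter> E')")
          case True
          then show ?thesis using E'_hit H by blast
        next
          case False
          have HG: "H \<inter> G \<in> sets S" using H G m(2) by auto
          have HE: "H \<inter> E' \<in> sets S" using H E'_sets m(2) by auto
          have "emeasure m H \<le> emeasure m ((H \<inter> G) \<union> (H \<inter> E'))"
            by (intro emeasure_mono) (use H HG HE m(2) in auto)
          also have "\<dots> \<le> emeasure m (H \<inter> G) + emeasure m (H \<inter> E')"
            by (rule emeasure_subadditive) (use HG HE m(2) in auto)
          finally have pos: "0 < emeasure m (H \<inter> G)" using False H(3)
            by (cases "emeasure m (H \<inter> G) = 0") (auto simp: zero_less_iff_neq_zero)
          have "emeasure \<phi> (H \<inter> G) \<noteq> 0"
          proof
            assume "emeasure \<phi> (H \<inter> G) = 0"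
            then have "(\<integral>\<^sup>+x. f x * indicator (H \<inter> G) x \<partial>m) = 0" using dens[OF HG] by simp
            moreover have "(\<lambda>x. f x * indicator (H \<inter> G) x) \<in> borel_measurable m"
              by (intro borel_measurable_times_ennreal f borel_measurable_indicator) (simp add: HG m(2))
            ultimately have "AE x in m. f x * indicator (H \<inter> G) x = 0"
              by (simp add: nn_integral_0_iff_AE)
            then have "AE x in m. x \<notin> H \<inter> G"
              by eventually_elim (auto simp: G_def indicator_def split: if_splits)
            then show False using pos HG m(2) AE_iff_null_sets[of "H \<inter> G" m] by (auto simp: null_sets_def)
          qed
          then have "hit (H \<inter> G)"
            using \<phi> HG unfolding irreducible_wrt_def hit_def by (simp add: zero_less_iff_neq_zero)
          then show ?thesis by (rule hit_mono) (use H in auto)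
        qed
      qed
      then have "measure m (G \<union> E') \<le> s" unfolding s_def by (rule cSUP_upper[OF _ bdd])
      moreover have "measure m (G \<union> E') = measure m G + measure m E'"
      proof -
        have "emeasure m (G \<inter> E') \<le> emeasure m (D \<inter> E')"
          by (rule emeasure_mono) (use D(1) m(2) E'_sets in \<open>auto simp: G_def\<close>)
        then have GE: "measure m (G \<inter> E') = 0" using D(2) by (simp add: measure_def)
        have "measure m (G \<union> E') = measure m G + measure m (E' - G)"
          by (rule m.finite_measure_Union'[OF G E'_sets])
        also have "measure m (E' - G) = measure m E' - measure m (E' \<inter> G)"
          by (rule m.finite_measure_Diff'[OF E'_sets G])
        finally show ?thesis using GE by (simp add: Int_commute)
      qed
      ultimately show False using Gpos s_le by simp
    qed
    then have "AE x in m. x \<notin> G" using AE_iff_null_sets[of G m] by (auto simp: null_sets_def)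
    then have "AE x in m. f x * indicator D x = 0"
      using AE_space by eventually_elim (auto simp: G_def indicator_def zero_less_iff_neq_zero)
    then have "(\<integral>\<^sup>+x. f x * indicator D x \<partial>m) = 0" by (subst nn_integral_cong_AE[of _ "\<lambda>_. 0"]) auto
    then have "emeasure \<phi> D = 0" using dens[OF D(1)] by simp
    then show "D \<in> null_sets \<phi>" using D(1) by (simp add: null_sets_def sets_\<phi>)
  qed
  then show ?thesis using irr by (auto simp: maximal_irreducibility_measure_def)
qed


section \<open>Small sets\<close>

text \<open>For almost every \<open>x\<close> in \<open>B\<close> the sets where \<open>a x\<close>
  is below 1 / (n + 1) shrink to a null set, so their measure is eventually below \<open>w\<close>.
  Since n ranges over a countable set, some single n works for a non-null set of
  \<open>x\<close>.\<close>

lemma uniformly_positive_set: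
  fixes \<mu> :: "'a measure" and \<Theta> :: "'b measure" and a :: "'a \<Rightarrow> 'b \<Rightarrow> ennreal"
  assumes \<mu>: "B \<in> sets \<mu>" "0 < emeasure \<mu> B"
    and \<Theta>: "finite_measure \<Theta>" and w: "0 < w"
    and a [measurable]: "(\<lambda>z. a (fst z) (snd z)) \<in> borel_measurable (\<mu> \<Otimes>\<^sub>M \<Theta>)"
    and pos: "AE x in \<mu>. x \<in> B \<longrightarrow> (AE p in \<Theta>. 0 < a x p)"
  obtains \<delta> D where "(0 :: real) < \<delta>" "D \<in> sets \<mu>" "D \<subseteq> B" "0 < emeasure \<mu> D"
    "\<And>x. x \<in> D \<Longrightarrow> emeasure \<Theta> {p \<in> space \<Theta>. a x p < ennreal \<delta>} < w"
proof -
  interpret finite_measure \<Theta> by (rule \<Theta>)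
  define G where "G n x = {p \<in> space \<Theta>. a x p < ennreal (1 / real (Suc n))}" for n x
  define D where "D n = {x \<in> space \<mu>. x \<in> B \<and> emeasure \<Theta> (G n x) < w}" for n
  have ax [measurable]: "a x \<in> borel_measurable \<Theta>" if "x \<in> space \<mu>" for x
    using measurable_compose[OF measurable_Pair1'[OF that] a] by simp
  have [measurable]: "(\<lambda>x. emeasure \<Theta> (G n x)) \<in> borel_measurable \<mu>" for n
  proof -
    have "(\<lambda>x. \<integral>\<^sup>+p. (if a x p < ennreal (1 / real (Suc n)) then 1 else 0) \<partial>\<Theta>) \<in> borel_measurable \<mu>"
      by measurable
    moreover have "(\<integral>\<^sup>+p. (if a x p < ennreal (1 / real (Suc n)) then 1 else 0) \<partial>\<Theta>) = emeasure \<Theta> (G n x)"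
      if "x \<in> space \<mu>" for x
    proof -
      note [measurable] = ax[OF that]
      have "(\<integral>\<^sup>+p. (if a x p < ennreal (1 / real (Suc n)) then 1 else 0) \<partial>\<Theta>) = (\<integral>\<^sup>+p. indicator (G n x) p \<partial>\<Theta>)"
        by (intro nn_integral_cong) (simp add: G_def indicator_def)
      also have "\<dots> = emeasure \<Theta> (G n x)" unfolding G_def by (rule nn_integral_indicator) measurable
      finally show ?thesis .
    qed
    ultimately show ?thesis by (rule measurable_cong[THEN iffD1, rotated])
  qed
  have D_sets: "D n \<in> sets \<mu>" for n using \<mu>(1) unfolding D_def by measurable
  have "\<exists>n. 0 < emeasure \<mu> (D n)"
  proof (rule ccontr)
    assume "\<not> ?thesis"
    then have "D n \<in> null_sets \<mu>" for n using D_sets by (auto simp: null_sets_def zero_less_iff_neq_zero)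
    then have "(\<Union>n. D n) \<in> null_sets \<mu>" by (rule null_sets_UN)
    then have "AE x in \<mu>. x \<notin> (\<Union>n. D n)" by (rule AE_not_in)
    then have "AE x in \<mu>. x \<notin> B"
      using pos AE_space
    proof eventually_elim
      case (elim x)
      show ?case
      proof
        assume xB: "x \<in> B"
        note [measurable] = ax[OF elim(3)]
        have G_sets: "G n x \<in> sets \<Theta>" for n unfolding G_def by measurable
        have "(\<lambda>n. emeasure \<Theta> (G n x)) \<longlonglongrightarrow> emeasure \<Theta> (\<Inter>n. G n x)"
        proof (rule Lim_emeasure_decseq)
          show "decseq (\<lambda>n. G n x)"
          proof (rule decseq_SucI, safe)
            fix n p assume p: "p \<in> G (Suc n) x"
            have "ennreal (1 / real (Suc (Suc n))) \<le> ennreal (1 / real (Suc n))"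
              by (rule ennreal_leI) (simp add: field_simps)
            then show "p \<in> G n x" using p by (auto simp: G_def intro: less_le_trans)
          qed
        qed (use G_sets in auto)
        moreover have "emeasure \<Theta> (\<Inter>n. G n x) = 0"
        proof -
          have "AE p in \<Theta>. 0 < a x p" using elim(2) xB by blast
          then have "AE p in \<Theta>. p \<notin> (\<Inter>n. G n x)"
          proof eventually_elim
            case (elim p)
            show ?case
            proof
              assume p: "p \<in> (\<Inter>n. G n x)"
              have "a x p \<le> 0"
              proof (rule LIMSEQ_le_const)
                show "(\<lambda>n. ennreal (1 / real (Suc n))) \<longlonglongrightarrow> 0"
                  using tendsto_ennrealI[OF LIMSEQ_Suc[OF lim_1_over_n]] by simp
                show "\<exists>N. \<forall>n\<ge>N. a x p \<le> ennreal (1 / real (Suc n))"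
                  using p by (auto simp: G_def intro: less_imp_le)
              qed
              then show False using elim by simp
            qed
          qed
          then show ?thesis using G_sets AE_iff_null_sets[of "\<Inter>n. G n x" \<Theta>] by (auto simp: null_sets_def)
        qed
        ultimately have "(\<lambda>n. emeasure \<Theta> (G n x)) \<longlonglongrightarrow> 0" by simp
        then have "\<forall>\<^sub>F n in sequentially. emeasure \<Theta> (G n x) < w" using w by (rule order_tendstoD)
        then obtain n where "emeasure \<Theta> (G n x) < w" by (auto simp: eventually_sequentially)
        then show False using elim(1,3) xB by (auto simp: D_def)
      qed
    qed
    then show False using \<mu> AE_iff_null_sets[of B \<mu>] by (auto simp: null_sets_def)
  qed
  then obtain n where n: "0 < emeasure \<mu> (D n)" by blast
  show ?thesis
    by (rule that[of "1 / real (Suc n)" "D n"]) (use n D_sets in \<open>auto simp: D_def G_def\<close>)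
qed

text \<open>Each exceptional set takes less than a quarter of the total mass, so both lower bounds
  hold together on at least half of it.\<close>

lemma nn_integral_product_lower_bound:
  assumes fin: "finite_measure \<Theta>" and w: "emeasure \<Theta> (space \<Theta>) = ennreal w"
    and [measurable]: "a \<in> borel_measurable \<Theta>" "b \<in> borel_measurable \<Theta>"
    and a: "emeasure \<Theta> {p \<in> space \<Theta>. a p < ennreal \<delta>} < ennreal (w / 4)"
    and b: "emeasure \<Theta> {p \<in> space \<Theta>. b p < ennreal \<delta>'} < ennreal (w / 4)"
  shows "ennreal \<delta> * ennreal \<delta>' * ennreal (w / 2) \<le> (\<integral>\<^sup>+p. a p * b p \<partial>\<Theta>)"
proof -
  interpret finite_measure \<Theta> by (rule fin)
  define G where "G = {p \<in> space \<Theta>. ennreal \<delta> \<le> a p \<and> ennreal \<delta>' \<le> b p}"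
  have [measurable]: "G \<in> sets \<Theta>" unfolding G_def by measurable
  let ?A = "{p \<in> space \<Theta>. a p < ennreal \<delta>}" and ?B = "{p \<in> space \<Theta>. b p < ennreal \<delta>'}"
  have w0: "0 < w" using a by (cases "0 < w") (auto simp: ennreal_neg)
  have "emeasure \<Theta> (space \<Theta>) \<le> emeasure \<Theta> (G \<union> (?A \<union> ?B))"
    by (intro emeasure_mono) (auto simp: G_def not_less)
  also have "\<dots> \<le> emeasure \<Theta> G + (emeasure \<Theta> ?A + emeasure \<Theta> ?B)"
    by (intro order_trans[OF emeasure_subadditive] add_left_mono emeasure_subadditive) measurable
  also have "\<dots> \<le> emeasure \<Theta> G + (ennreal (w / 4) + ennreal (w / 4))"
    using a b by (intro add_left_mono add_mono less_imp_le)
  also have "\<dots> = ennreal (measure \<Theta> G + w / 2)"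
    using w0 by (simp add: emeasure_eq_measure ennreal_plus[symmetric] del: ennreal_plus)
  finally have "w / 2 \<le> measure \<Theta> G" unfolding w using w0 by (subst (asm) ennreal_le_iff) auto
  then have "ennreal (w / 2) \<le> emeasure \<Theta> G" by (simp add: emeasure_eq_measure ennreal_leI)
  then have "ennreal \<delta> * ennreal \<delta>' * ennreal (w / 2) \<le> (\<integral>\<^sup>+p. ennreal \<delta> * ennreal \<delta>' * indicator G p \<partial>\<Theta>)"
    by (simp add: nn_integral_cmult mult_left_mono)
  also have "\<dots> \<le> (\<integral>\<^sup>+p. a p * b p \<partial>\<Theta>)"
    by (intro nn_integral_mono) (auto simp: G_def indicator_def intro!: mult_mono)
  finally show ?thesis .
qed


section \<open>The order on symmetric matrices and Lebesgue measure\<close>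

text \<open>Cauchy-Schwarz bounds the form of \<open>S\<close> by \<open>norm S * K\<close> times
  the squared length. One \<open>\<delta>\<close> serves every scale \<open>e\<close>.\<close>

lemma identity_minus_small_posdef:
  obtains \<delta> where "0 < \<delta>"
    "\<And>e S. S \<in> symmetric_matrices \<Longrightarrow> norm S < e * \<delta> \<Longrightarrow> 0 < e \<Longrightarrow> e *\<^sub>R mat 1 - S \<in> (posdef :: (real^'d^'d) set)"
proof -
  obtain K where K: "K > 0" "\<And>(S :: real^'d^'d) v. norm (S *v v) \<le> norm S * norm v * K"
    using bounded_bilinear.pos_bounded[OF bounded_bilinear_matrix_vector_mult] by blast
  show ?thesis
  proof (rule that[of "1 / K"])
    fix e and S :: "real^'d^'d" assume S: "S \<in> symmetric_matrices" "norm S < e * (1 / K)" "0 < e"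
    have sym: "e *\<^sub>R mat 1 - S \<in> symmetric_matrices"
      by (intro symmetric_diff symmetric_scaleR S) (simp add: symmetric_matrices_def)
    have "0 < v \<bullet> ((e *\<^sub>R mat 1 - S) *v v)" if "v \<noteq> 0" for v
    proof -
      have "v \<bullet> (S *v v) \<le> norm v * norm (S *v v)" by (rule norm_cauchy_schwarz)
      also have "\<dots> \<le> norm v * (norm S * norm v * K)" by (intro mult_left_mono K(2)) simp
      also have "\<dots> = (norm S * K) * (v \<bullet> v)" by (simp add: dot_square_norm power2_eq_square)
      also have "\<dots> < e * (v \<bullet> v)" using S K(1) that by (intro mult_strict_right_mono) (simp_all add: field_simps)
      finally show ?thesis
        by (simp add: matrix_vector_mult_diff_rdistrib inner_diff_right scaleR_matrix_vector_assoc[symmetric])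
    qed
    then show "e *\<^sub>R mat 1 - S \<in> posdef" using sym by (simp add: posdef_def)
  qed (use K in simp)
qed

lemma mat_1_posdef: "0 < c \<Longrightarrow> c *\<^sub>R mat 1 \<in> (posdef :: (real^'d^'d) set)"
  by (simp add: posdef_def symmetric_matrices_def transpose_scaleR scaleR_matrix_vector_assoc[symmetric])

text \<open>The smallest eigenvalue of \<open>z\<close>, the negative of the top eigenvalue of
  \<open>- z\<close>, is positive; any smaller 1 / (k + 1) can be subtracted.\<close>

lemma posdef_minus_small_psd:
  assumes z: "z \<in> (posdef :: (real^'d^'d) set)"
  shows "\<exists>k. z - (1 / real (Suc k)) *\<^sub>R mat 1 \<in> psd"
proof -
  have "- z \<in> symmetric_matrices"
    using posdef_symmetric[OF z] by (simp add: symmetric_matrices_def transpose_minus)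
  then obtain \<mu> v where v: "norm v = 1" "- z *v v = \<mu> *\<^sub>R v" "\<And>w. w \<bullet> (- z *v w) \<le> \<mu> * (w \<bullet> w)"
    using symmetric_top_eigenvector by blast
  have vv: "v \<bullet> v = 1" using v(1) by (simp add: dot_square_norm)
  have "v \<bullet> (- z *v v) = \<mu>" using v(2) vv by simp
  moreover have "0 < v \<bullet> (z *v v)" using posdef_pos[OF z, of v] v(1) by force
  ultimately have "\<mu> < 0" by (simp add: matrix_vector_mult.minus_left)
  then obtain k where k: "1 / real (Suc k) < - \<mu>"
    using reals_Archimedean[of "- \<mu>"] by (auto simp: inverse_eq_divide)
  have sym: "z - (1 / real (Suc k)) *\<^sub>R mat 1 \<in> symmetric_matrices"
    by (intro symmetric_diff[OF posdef_symmetric[OF z]] symmetric_scaleR) (simp add: symmetric_matrices_def)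
  have "0 \<le> w \<bullet> ((z - (1 / real (Suc k)) *\<^sub>R mat 1) *v w)" for w
  proof -
    have "(1 / real (Suc k)) * (w \<bullet> w) \<le> - \<mu> * (w \<bullet> w)" using k by (intro mult_right_mono) auto
    also have "\<dots> \<le> w \<bullet> (z *v w)" using v(3)[of w] by (simp add: matrix_vector_mult.minus_left)
    finally show ?thesis
      by (simp add: matrix_vector_mult_diff_rdistrib inner_diff_right scaleR_matrix_vector_assoc[symmetric])
  qed
  then show ?thesis using sym by (auto simp: psd_def)
qed

text \<open>The boundary of the cone is null: moving in the direction of the identity from a
  boundary point leads at once into the open cone, so each such line meets the boundary at most
  once. Fubini over shifts along this direction concludes.\<close>

lemma AE_psd_posdef: "AE S in lebesgue_symmetric. S \<in> psd \<longrightarrow> S \<in> (posdef :: (real^'d^'d) set)"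
proof -
  interpret sym: sigma_finite_measure "lebesgue_symmetric :: (real^'d^'d) measure" by (rule sym.sigma_finite)
  interpret P: pair_sigma_finite "lebesgue_symmetric :: (real^'d^'d) measure" "lborel :: real measure" ..
  define Z :: "(real^'d^'d) set" where "Z = psd - posdef"
  have Z [measurable]: "Z \<in> sets borel" unfolding Z_def by measurable
  define f :: "real^'d^'d \<Rightarrow> ennreal" where "f = indicator Z"
  have [measurable]: "f \<in> borel_measurable borel" unfolding f_def by measurable
  have I: "c *\<^sub>R mat 1 \<in> symmetric_matrices" for c :: real
    by (intro symmetric_scaleR) (simp add: symmetric_matrices_def)
  have inner: "(\<integral>\<^sup>+c. f (S + c *\<^sub>R mat 1) * indicator {0..1} c \<partial>lborel) = 0" for S :: "real^'d^'d"
  proof -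
    have one: "c = c'" if c: "S + c *\<^sub>R mat 1 \<in> Z" "S + c' *\<^sub>R mat 1 \<in> Z" for c c'
    proof (rule ccontr)
      have no: False if "a < b" "S + a *\<^sub>R mat 1 \<in> Z" "S + b *\<^sub>R mat 1 \<in> Z" for a b
      proof -
        have "(b - a) *\<^sub>R mat 1 + (S + a *\<^sub>R mat 1) \<in> posdef"
          by (rule posdef_psd_add) (use that in \<open>auto simp: Z_def mat_1_posdef\<close>)
        then show False using that(3) by (simp add: Z_def algebra_simps)
      qed
      assume "c \<noteq> c'"
      then show False using no[of c c'] no[of c' c] c by (cases "c < c'") auto
    qed
    have "countable {c. S + c *\<^sub>R mat 1 \<in> Z}"
    proof (cases "\<exists>c. S + c *\<^sub>R mat 1 \<in> Z")
      case True
      then obtain c where "S + c *\<^sub>R mat 1 \<in> Z" by blast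
      then have "{c. S + c *\<^sub>R mat 1 \<in> Z} \<subseteq> {c}" using one by blast
      then show ?thesis by (meson countable_finite finite.intros finite_subset)
    qed simp
    then have "AE c in lborel. c \<notin> {c. S + c *\<^sub>R mat 1 \<in> Z}"
      by (intro AE_not_in countable_imp_null_set_lborel)
    then have "AE c in lborel. f (S + c *\<^sub>R mat 1) * indicator {0..1} c = 0"
      by eventually_elim (simp add: f_def)
    then show ?thesis by (subst nn_integral_cong_AE[of _ "\<lambda>_. 0"]) auto
  qed
  \<comment> \<open>The unit interval of shifts has length 1 and each shift preserves the measure,
    so averaging over shifts does not change the value.\<close>
  have "emeasure lebesgue_symmetric Z = (\<integral>\<^sup>+c. emeasure lebesgue_symmetric Z * indicator {0..1 :: real} c \<partial>lborel)"
    by (simp add: nn_integral_cmult)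
  also have "\<dots> = (\<integral>\<^sup>+c. (\<integral>\<^sup>+S. f (S + c *\<^sub>R mat 1) * indicator {0..1} c \<partial>lebesgue_symmetric) \<partial>(lborel :: real measure))"
  proof (rule nn_integral_cong)
    fix c :: real
    have "(\<integral>\<^sup>+S. f (S + c *\<^sub>R mat 1) \<partial>lebesgue_symmetric) = (\<integral>\<^sup>+S. f S \<partial>lebesgue_symmetric)"
      by (rule sym.nn_integral_translate[OF I]) measurable
    then show "emeasure lebesgue_symmetric Z * indicator {0..1} c = (\<integral>\<^sup>+S. f (S + c *\<^sub>R mat 1) * indicator {0..1} c \<partial>lebesgue_symmetric)"
      by (simp add: nn_integral_multc f_def)
  qed
  also have "\<dots> = (\<integral>\<^sup>+S. (\<integral>\<^sup>+c. f (S + c *\<^sub>R mat 1) * indicator {0..1} c \<partial>lborel) \<partial>lebesgue_symmetric)"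
    by (rule P.Fubini') measurable
  also have "\<dots> = 0" by (simp add: inner)
  finally have "Z \<in> null_sets lebesgue_symmetric" by (simp add: null_sets_def)
  from AE_not_in[OF this] show ?thesis by eventually_elim (simp add: Z_def)
qed

lemma psd_borel_sets: "D \<in> sets psd_borel \<longleftrightarrow> D \<in> sets borel \<and> D \<subseteq> psd"
  unfolding psd_borel_def by (subst sets_restrict_space_iff) auto

lemma space_psd_borel: "space psd_borel = psd"
  by (simp add: psd_borel_def space_restrict_space)

lemma sets_lebesgue_psd: "sets lebesgue_psd = sets psd_borel"
  unfolding lebesgue_psd_def psd_borel_def by (rule sets_restrict_space_cong) simp

lemma emeasure_lebesgue_psd: "D \<subseteq> psd \<Longrightarrow> emeasure lebesgue_psd D = emeasure lebesgue_symmetric D"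
  unfolding lebesgue_psd_def by (rule emeasure_restrict_space) simp_all

lemma sigma_finite_lebesgue_psd: "sigma_finite_measure lebesgue_psd"
  unfolding lebesgue_psd_def by (rule sigma_finite_measure_restrict_space[OF sym.sigma_finite]) simp

lemma emeasure_symmetric_ball_pos:
  assumes "S \<in> symmetric_matrices" "0 < r"
  shows "0 < emeasure lebesgue_symmetric (ball S r \<inter> symmetric_matrices :: (real^'d^'d) set)"
proof -
  have [measurable]: "(symmetric_matrices :: (real^'d^'d) set) \<in> sets borel"
    using closed_subspace[OF subspace_symmetric_matrices] by (rule borel_closed)
  have "0 < emeasure lebesgue_symmetric (ball 0 r :: (real^'d^'d) set)" by (rule sym.pos_ball[OF assms(2)])
  also have "\<dots> = (\<integral>\<^sup>+x. indicator (ball 0 r) x \<partial>(lebesgue_symmetric :: (real^'d^'d) measure))"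
    by (rule nn_integral_indicator[symmetric]) simp
  also have "\<dots> = (\<integral>\<^sup>+x. indicator (ball S r) (x + S) \<partial>(lebesgue_symmetric :: (real^'d^'d) measure))"
    by (intro nn_integral_cong) (auto simp: indicator_def dist_norm)
  also have "\<dots> = emeasure lebesgue_symmetric (ball S r :: (real^'d^'d) set)"
    by (subst sym.nn_integral_translate[OF assms(1)]) (auto intro!: borel_measurable_indicator)
  also have "\<dots> = emeasure lebesgue_symmetric (ball S r \<inter> symmetric_matrices :: (real^'d^'d) set)"
    by (rule emeasure_eq_AE) (use sym.AE_V in auto)
  finally show ?thesis .
qed

section \<open>The volatility process\<close>

text \<open>The hypotheses of the final theorem with the existential witnesses fixed: counting
  process, jump sizes and the minorizing density. Stability enters as decay of the
  exponential.\<close>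

locale mucogarch = prob_space M for M :: "'w measure" +
  fixes rate :: real and N :: "real \<Rightarrow> 'w \<Rightarrow> nat" and X :: "nat \<Rightarrow> 'w \<Rightarrow> real^'d" and F :: "(real^'d) measure"
    and L :: "real \<Rightarrow> 'w \<Rightarrow> real^'d" and A B C :: "real^'d^'d" and dens :: "real^'d \<Rightarrow> ennreal"
    and Y :: "real^'d^'d \<Rightarrow> real \<Rightarrow> 'w \<Rightarrow> real^'d^'d"
  assumes rate: "0 < rate"
    and N: "poisson_process M rate N"
    and X: "indep_vars (\<lambda>_. borel) X UNIV" "\<And>i. distr M borel (X i) = F"
    and indep: "indep_set
          (sets (vimage_algebra (space M) (\<lambda>w. \<lambda>t\<in>{0..}. N t w) (PiM {0..} (\<lambda>_. count_space UNIV))))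
          (sets (vimage_algebra (space M) (\<lambda>w i. X i w) (PiM UNIV (\<lambda>_. borel))))"
    and L: "AE w in M. \<forall>t\<ge>0. L t w = (\<Sum>i<N t w. X i w)"
    and A: "invertible A" and C: "C \<in> posdef"
    and stable: "(mat_exp B \<longlongrightarrow> 0) at_top"
    and dens: "dens \<in> borel_measurable borel" "AE v in lborel. 0 < dens v"
      "\<And>\<phi>. \<phi> \<in> borel_measurable borel \<Longrightarrow> (\<integral>\<^sup>+v. dens v * \<phi> v \<partial>lborel) \<le> (\<integral>\<^sup>+v. \<phi> v \<partial>F)"
    and Y: "\<And>x. x \<in> psd \<Longrightarrow> mucogarch_volatility M L A B C x (Y x)"
begin

abbreviation transition :: "real \<Rightarrow> real^'d^'d \<Rightarrow> (real^'d^'d) measure" where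
  "transition \<equiv> mucogarch_transition M Y"

abbreviation transport :: "real \<Rightarrow> real^'d^'d \<Rightarrow> real^'d^'d" where
  "transport t x \<equiv> mat_exp B t ** x ** transpose (mat_exp B t)"

definition path_law :: "(real \<Rightarrow> nat) measure" where
  "path_law = distr M count_paths (\<lambda>w. \<lambda>t\<in>{0..}. N t w)"

lemma sets_path_law [measurable_cong, simp]: "sets path_law = sets count_paths"
  by (simp add: path_law_def)

lemma measurable_N: "0 \<le> t \<Longrightarrow> N t \<in> measurable M (count_space UNIV)"
  using N by (simp add: poisson_process_def)

lemma measurable_path: "(\<lambda>w. \<lambda>t\<in>{0..}. N t w) \<in> measurable M count_paths"
  unfolding count_paths_def by (rule measurable_restrict) (simp add: measurable_N)

lemma prob_path_law: "prob_space path_law"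
  unfolding path_law_def by (rule prob_space_distr[OF measurable_path])

lemma measurable_X: "X i \<in> borel_measurable M"
  using X(1) by (auto simp: indep_vars_def)

lemma sets_F: "sets F = sets borel"
  using X(2)[of 0] by (metis sets_distr)

lemma prob_F: "prob_space F"
  using prob_space_distr[OF measurable_X[of 0]] X(2)[of 0] by simp

lemma jump_chain: "jump_chain F A C dens"
  by (intro jump_chain.intro prob_F sets_F A C dens)

lemma measurable_Y: "x \<in> psd \<Longrightarrow> 0 \<le> t \<Longrightarrow> Y x t \<in> measurable M psd_borel"
  using Y by (simp add: mucogarch_volatility_def)

lemma sets_transition: "sets (transition t x) = sets psd_borel"
  by (simp add: mucogarch_transition_def)

lemma path_law_cell_pos:
  assumes "0 < t" "0 < n"
  shows "0 < emeasure path_law (one_jump_per_cell t n)"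
proof -
  have "emeasure path_law (one_jump_per_cell t n) = emeasure M ((\<lambda>w. \<lambda>t\<in>{0..}. N t w) -` one_jump_per_cell t n \<inter> space M)"
    unfolding path_law_def using assms by (intro emeasure_distr measurable_path measurable_one_jump_per_cell) simp
  also have "(\<lambda>w. \<lambda>t\<in>{0..}. N t w) -` one_jump_per_cell t n \<inter> space M
      = {w \<in> space M. (\<lambda>t\<in>{0..}. N t w) \<in> one_jump_per_cell t n}" by auto
  finally show ?thesis using prob_one_jump_per_cell[OF N rate assms] by simp
qed

lemma AE_volatility:
  assumes x: "x \<in> psd" and t: "0 < t" and n: "0 < n"
  shows "AE w in M. (\<lambda>t\<in>{0..}. N t w) \<in> one_jump_per_cell t n \<longrightarrow>
    Y x t w = transported A B C t (\<lambda>i. jump_time t i (\<lambda>t\<in>{0..}. N t w)) (\<lambda>i. X i w) (transport t x) n"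
proof -
  have vol: "AE w in M. cadlag (\<lambda>t. Y x t w) \<and> Y x 0 w = x \<and>
        (\<forall>t\<ge>0. Y x t w = Y x 0 w +
           integral {0..t} (\<lambda>s. B ** left_lim (\<lambda>r. Y x r w) s + left_lim (\<lambda>r. Y x r w) s ** transpose B) +
           pure_jump_integral
             (\<lambda>s. A ** psd_sqrt (C + left_lim (\<lambda>r. Y x r w) s))
             (discontinuous_qv (\<lambda>r. L r w))
             (\<lambda>s. psd_sqrt (C + left_lim (\<lambda>r. Y x r w) s) ** transpose A) t)"
    using Y[OF x] by (simp add: mucogarch_volatility_def)
  from AE_counting_path[OF N rate] L vol show ?thesis
  proof eventually_elim
    case (elim w)
    show ?case
    proof
      let ?\<eta> = "\<lambda>t\<in>{0..}. N t w"
      assume cell: "?\<eta> \<in> one_jump_per_cell t n"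
      interpret jump_times "\<lambda>k. if k = 0 then 0 else jump_time t (k - 1) ?\<eta>" n t ?\<eta>
        by (rule jump_times_of_path[OF elim(1) cell t n])
      have "Y x t w = transported A B C t (\<lambda>i. if Suc i = 0 then 0 else jump_time t (Suc i - 1) ?\<eta>)
          (\<lambda>i. X i w) (transport t x) n"
        by (rule volatility_eq_transported[OF x posdef_psd[OF C], where l = "\<lambda>r. L r w" and y = "\<lambda>r. Y x r w"])
          (use elim in auto)
      then show "Y x t w = transported A B C t (\<lambda>i. jump_time t i ?\<eta>) (\<lambda>i. X i w) (transport t x) n"
        by simp
    qed
  qed
qed

lemma measurable_transported_path:
  assumes t: "0 \<le> t"
  shows "(\<lambda>z. transported A B C t (\<lambda>i. jump_time t i (fst z)) (snd z) y n)
    \<in> borel_measurable (count_paths \<Otimes>\<^sub>M PiM {..<n} (\<lambda>_. borel :: (real^'d) measure))"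
proof -
  interpret J: jump_chain F A B C t dens by (rule jump_chain)
  show ?thesis
  proof (rule J.measurable_transported)
    fix i assume "i < n"
    then have [measurable]: "(\<lambda>v. v i) \<in> borel_measurable (PiM {..<n} (\<lambda>_. borel :: (real^'d) measure))"
      by (intro measurable_component_singleton) simp
    show "(\<lambda>z. snd z i) \<in> borel_measurable (count_paths \<Otimes>\<^sub>M PiM {..<n} (\<lambda>_. borel :: (real^'d) measure))" by measurable
    have [measurable]: "jump_time t i \<in> borel_measurable count_paths" using t by (intro measurable_jump_time)
    show "(\<lambda>z. jump_time t i (fst z)) \<in> borel_measurable (count_paths \<Otimes>\<^sub>M PiM {..<n} (\<lambda>_. borel :: (real^'d) measure))" by measurable
  qed
qed

lemma sets_PiM_F: "sets (PiM I (\<lambda>_. F)) = sets (PiM I (\<lambda>_. borel))"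
  by (intro sets_PiM_cong) (auto simp: sets_F)

lemma measurable_jump_ops_path:
  assumes t: "0 \<le> t" and \<phi> [measurable]: "\<phi> \<in> borel_measurable borel"
  shows "(\<lambda>\<eta>. jump_chain.jump_ops F A B C t (\<lambda>i. jump_time t i \<eta>) n \<phi> y) \<in> borel_measurable count_paths"
proof -
  interpret J: jump_chain F A B C t dens by (rule jump_chain)
  interpret Pr: product_prob_space "\<lambda>_. F" "{..<n}" by standard
  note [measurable] = measurable_transported_path[OF t, of y n]
  note [measurable_cong] = sets_PiM_F[of "{..<n}"]
  have "(\<lambda>\<eta>. \<integral>\<^sup>+v. \<phi> (transported A B C t (\<lambda>i. jump_time t i \<eta>) v y n) \<partial>PiM {..<n} (\<lambda>_. F)) \<in> borel_measurable count_paths"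
    by (intro Pr.P.borel_measurable_nn_integral) (simp add: case_prod_beta)
  then show ?thesis by (simp add: J.nn_integral_transported)
qed

text \<open>Only the paths with one jump per cell are kept. On them the volatility is a function of
  the path and of n jump sizes, and the product law lets the sizes be integrated out for a fixed
  path.\<close>

theorem transition_lower_bound:
  assumes x: "x \<in> psd" and t: "0 < t" and n: "0 < n" and D: "D \<in> sets psd_borel"
  shows "(\<integral>\<^sup>+\<eta>. indicator (one_jump_per_cell t n) \<eta> *
      jump_chain.jump_ops F A B C t (\<lambda>i. jump_time t i \<eta>) n (indicator D) (transport t x) \<partial>path_law)
    \<le> emeasure (transition t x) D"
proof -
  interpret J: jump_chain F A B C t dens by (rule jump_chain)
  let ?P = "PiM {..<n} (\<lambda>_. F)" and ?H = "one_jump_per_cell t n" and ?y = "transport t x"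
  let ?T = "\<lambda>\<eta> v. transported A B C t (\<lambda>i. jump_time t i \<eta>) v ?y n"
  have D' [measurable]: "D \<in> sets borel" using D by (simp add: psd_borel_sets)
  have [measurable]: "?H \<in> sets count_paths" using t by (intro measurable_one_jump_per_cell) simp
  have sP [measurable_cong]: "sets ?P = sets (PiM {..<n} (\<lambda>_. borel))"
    by (rule sets_PiM_F)
  interpret R: prob_space path_law by (rule prob_path_law)
  interpret Pr: product_prob_space "\<lambda>_. F" "{..<n}" by standard
  have [measurable]: "(\<lambda>z. ?T (fst z) (snd z)) \<in> borel_measurable (count_paths \<Otimes>\<^sub>M PiM {..<n} (\<lambda>_. borel))"
    using t by (intro measurable_transported_path) simp
  define S where "S = {z \<in> space (count_paths \<Otimes>\<^sub>M PiM {..<n} (\<lambda>_. borel)). fst z \<in> ?H \<and> ?T (fst z) (snd z) \<in> D}"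
  have S [measurable]: "S \<in> sets (count_paths \<Otimes>\<^sub>M PiM {..<n} (\<lambda>_. borel))" unfolding S_def by measurable
  let ?Z = "\<lambda>w. (\<lambda>t\<in>{0..}. N t w, \<lambda>i\<in>{..<n}. X i w)"
  have Z: "?Z \<in> measurable M (count_paths \<Otimes>\<^sub>M PiM {..<n} (\<lambda>_. borel))"
    by (intro measurable_Pair measurable_path measurable_restrict measurable_X)
  have law: "distr M (count_paths \<Otimes>\<^sub>M PiM {..<n} (\<lambda>_. borel)) ?Z = path_law \<Otimes>\<^sub>M ?P"
    unfolding path_law_def by (rule compound_poisson_law[OF measurable_N X indep n])
  have "(\<integral>\<^sup>+\<eta>. indicator ?H \<eta> * J.jump_ops (\<lambda>i. jump_time t i \<eta>) n (indicator D) ?y \<partial>path_law)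
      = (\<integral>\<^sup>+\<eta>. (\<integral>\<^sup>+v. indicator S (\<eta>, v) \<partial>?P) \<partial>path_law)"
  proof (rule nn_integral_cong)
    fix \<eta> assume \<eta>: "\<eta> \<in> space path_law"
    then have \<eta>': "\<eta> \<in> space count_paths" using sets_eq_imp_space_eq[OF sets_path_law] by simp
    have "(\<integral>\<^sup>+v. indicator S (\<eta>, v) \<partial>?P) = (\<integral>\<^sup>+v. indicator ?H \<eta> * indicator D (?T \<eta> v) \<partial>?P)"
    proof (rule nn_integral_cong)
      fix v assume "v \<in> space ?P"
      then have "v \<in> space (PiM {..<n} (\<lambda>_. borel))" using sets_eq_imp_space_eq[OF sP] by simp
      then show "indicator S (\<eta>, v) = indicator ?H \<eta> * (indicator D (?T \<eta> v) :: ennreal)"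
        using \<eta>' by (auto simp: S_def indicator_def space_pair_measure)
    qed
    also have "\<dots> = indicator ?H \<eta> * (\<integral>\<^sup>+v. indicator D (?T \<eta> v) \<partial>?P)"
      by (cases "\<eta> \<in> ?H") simp_all
    also have "(\<integral>\<^sup>+v. indicator D (?T \<eta> v) \<partial>?P) = J.jump_ops (\<lambda>i. jump_time t i \<eta>) n (indicator D) ?y"
      by (rule J.nn_integral_transported) measurable
    finally show "indicator ?H \<eta> * J.jump_ops (\<lambda>i. jump_time t i \<eta>) n (indicator D) ?y = (\<integral>\<^sup>+v. indicator S (\<eta>, v) \<partial>?P)" ..
  qed
  also have "\<dots> = (\<integral>\<^sup>+z. indicator S z \<partial>(path_law \<Otimes>\<^sub>M ?P))"
    by (rule Pr.P.nn_integral_fst) measurable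
  also have "\<dots> = emeasure (path_law \<Otimes>\<^sub>M ?P) S" by (rule nn_integral_indicator) measurable
  also have "\<dots> = emeasure M (?Z -` S \<inter> space M)"
    unfolding law[symmetric] by (rule emeasure_distr[OF Z S])
  also have "\<dots> \<le> emeasure M (Y x t -` D \<inter> space M)"
  proof (rule emeasure_mono_AE)
    show "AE w in M. w \<in> ?Z -` S \<inter> space M \<longrightarrow> w \<in> Y x t -` D \<inter> space M"
      using AE_volatility[OF x t n]
    proof eventually_elim
      case (elim w)
      have "?T (\<lambda>t\<in>{0..}. N t w) (\<lambda>i\<in>{..<n}. X i w) = ?T (\<lambda>t\<in>{0..}. N t w) (\<lambda>i. X i w)"
        by (rule J.transported_cong) simp
      then show ?case using elim by (auto simp: S_def)
    qed
    show "Y x t -` D \<inter> space M \<in> sets M" using measurable_sets[OF measurable_Y[OF x] D] t by simp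
  qed
  also have "\<dots> = emeasure (transition t x) D"
    unfolding mucogarch_transition_def using t by (intro emeasure_distr[symmetric] measurable_Y x D) simp
  finally show ?thesis .
qed

text \<open>A jointly measurable version. The default value 0, used on a null set and at negative
  times, lies in the cone.\<close>

lemma transition_jointly_measurable:
  assumes x: "x \<in> psd"
  obtains Z where "Z \<in> measurable (borel \<Otimes>\<^sub>M M) psd_borel"
    "\<And>t. 0 \<le> t \<Longrightarrow> AE w in M. Z (t, w) = Y x t w"
proof -
  have psd_sub: "f \<in> measurable M psd_borel \<longleftrightarrow> f \<in> borel_measurable M \<and> f \<in> space M \<rightarrow> psd" for f :: "'w \<Rightarrow> real^'d^'d"
    unfolding psd_borel_def by (rule measurable_restrict_space2_iff)
  have "AE w in M. cadlag (\<lambda>t. Y x t w)" using Y[OF x] by (auto simp: mucogarch_volatility_def)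
  then obtain N0 where N0: "N0 \<in> null_sets M"
    "(\<lambda>z. if snd z \<in> N0 \<or> fst z < 0 then 0 else Y x (fst z) (snd z)) \<in> borel_measurable (borel \<Otimes>\<^sub>M M)"
    using jointly_measurable_cadlag[of "Y x" M] measurable_Y[OF x] psd_sub by blast
  show ?thesis
  proof (rule that)
    show "(\<lambda>z. if snd z \<in> N0 \<or> fst z < 0 then 0 else Y x (fst z) (snd z)) \<in> measurable (borel \<Otimes>\<^sub>M M) psd_borel"
      unfolding psd_borel_def measurable_restrict_space2_iff
    proof (intro conjI N0(2) Pi_I)
      fix z :: "real \<times> 'w" assume z: "z \<in> space (borel \<Otimes>\<^sub>M M)"
      have "(0 :: real^'d^'d) \<in> psd" by (simp add: psd_def symmetric_matrices_def transpose_zero)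
      moreover have "Y x (fst z) (snd z) \<in> psd" if "0 \<le> fst z"
        using measurable_space[OF measurable_Y[OF x that], of "snd z"] z
        by (auto simp: space_psd_borel space_pair_measure)
      ultimately show "(if snd z \<in> N0 \<or> fst z < 0 then 0 else Y x (fst z) (snd z)) \<in> psd" by auto
    qed
    show "AE w in M. (if snd (t, w) \<in> N0 \<or> fst (t, w) < 0 then 0 else Y x (fst (t, w)) (snd (t, w))) = Y x t w"
      if "0 \<le> t" for t
      using AE_not_in[OF N0(1)] by eventually_elim (use that in simp)
  qed
qed

lemma transition_eq_integral:
  assumes Z [measurable]: "Z \<in> measurable (borel \<Otimes>\<^sub>M M) psd_borel"
    and AE: "\<And>t. 0 \<le> t \<Longrightarrow> AE w in M. Z (t, w) = Y x t w"
    and x: "x \<in> psd" and D [measurable]: "D \<in> sets psd_borel" and t: "0 \<le> t"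
  shows "emeasure (transition t x) D = (\<integral>\<^sup>+w. indicator D (Z (t, w)) \<partial>M)"
proof -
  note [measurable] = measurable_Y[OF x t]
  have "emeasure (transition t x) D = (\<integral>\<^sup>+y. indicator D y \<partial>transition t x)"
    unfolding mucogarch_transition_def by simp
  also have "\<dots> = (\<integral>\<^sup>+w. indicator D (Y x t w) \<partial>M)"
    unfolding mucogarch_transition_def by (rule nn_integral_distr) measurable
  also have "\<dots> = (\<integral>\<^sup>+w. indicator D (Z (t, w)) \<partial>M)"
    by (rule nn_integral_cong_AE) (use AE[OF t] in eventually_elim, simp)
  finally show ?thesis .
qed

lemma measurable_transition:
  assumes x: "x \<in> psd" and D [measurable]: "D \<in> sets psd_borel"
  shows "(\<lambda>t. emeasure (transition t x) D * indicator {0..} t) \<in> borel_measurable borel"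
proof -
  obtain Z where Z [measurable]: "Z \<in> measurable (borel \<Otimes>\<^sub>M M) psd_borel"
    "\<And>t. 0 \<le> t \<Longrightarrow> AE w in M. Z (t, w) = Y x t w"
    using transition_jointly_measurable[OF x] by blast
  have "(\<lambda>t. (\<integral>\<^sup>+w. indicator D (Z (t, w)) \<partial>M) * indicator {0..} t) \<in> borel_measurable borel"
    by measurable
  also have "(\<lambda>t. (\<integral>\<^sup>+w. indicator D (Z (t, w)) \<partial>M) * indicator {0..} t) = (\<lambda>t. emeasure (transition t x) D * indicator {0..} t)"
    using transition_eq_integral[OF Z x D] by (auto simp: fun_eq_iff indicator_def)
  finally show ?thesis .
qed

text \<open>\<open>m\<close> weights the law of the process started at 0 by a strictly positive
  integrable function of time. An \<open>m\<close>-null set has zero occupation time from the state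
  0, and no irreducibility measure can charge it.\<close>

lemma dominating_measure:
  obtains m where "finite_measure m" "sets m = sets psd_borel"
    "\<And>\<phi>. irreducible_wrt psd_borel transition \<phi> \<Longrightarrow> absolutely_continuous m \<phi>"
proof -
  have x: "(0 :: real^'d^'d) \<in> psd" by (simp add: psd_def symmetric_matrices_def transpose_zero)
  obtain Z where Z [measurable]: "Z \<in> measurable (borel \<Otimes>\<^sub>M M) psd_borel"
    and AE: "\<And>t. 0 \<le> t \<Longrightarrow> AE w in M. Z (t, w) = Y 0 t w"
    using transition_jointly_measurable[OF x] by blast
  obtain h :: "real \<Rightarrow> ennreal" where h [measurable]: "h \<in> borel_measurable borel"
    and fin: "integral\<^sup>N lborel h \<noteq> \<infinity>" and pos: "\<And>t. 0 < h t"
    using sigma_finite_measure.Ex_finite_integrable_function[OF sigma_finite_lborel] by auto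
  define \<nu> where "\<nu> = density lborel h"
  have s\<nu> [measurable_cong]: "sets \<nu> = sets borel" by (simp add: \<nu>_def)
  interpret nu: finite_measure \<nu>
    by (rule finite_measureI) (use fin in \<open>simp add: \<nu>_def emeasure_density\<close>)
  define m where "m = distr (\<nu> \<Otimes>\<^sub>M M) psd_borel Z"
  have Z': "Z \<in> measurable (\<nu> \<Otimes>\<^sub>M M) psd_borel" by measurable
  have m: "emeasure m D = (\<integral>\<^sup>+t. h t * (\<integral>\<^sup>+w. indicator D (Z (t, w)) \<partial>M) \<partial>lborel)"
    if D [measurable]: "D \<in> sets psd_borel" for D
  proof -
    have "emeasure m D = (\<integral>\<^sup>+z. indicator D z \<partial>m)" using D by (simp add: m_def)
    also have "\<dots> = (\<integral>\<^sup>+z. indicator D (Z z) \<partial>(\<nu> \<Otimes>\<^sub>M M))"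
      unfolding m_def by (rule nn_integral_distr[OF Z']) measurable
    also have "\<dots> = (\<integral>\<^sup>+t. (\<integral>\<^sup>+w. indicator D (Z (t, w)) \<partial>M) \<partial>\<nu>)"
      by (rule nn_integral_fst[symmetric]) measurable
    also have "\<dots> = (\<integral>\<^sup>+t. h t * (\<integral>\<^sup>+w. indicator D (Z (t, w)) \<partial>M) \<partial>lborel)"
      unfolding \<nu>_def by (rule nn_integral_density) measurable
    finally show ?thesis .
  qed
  show ?thesis
  proof (rule that)
    show "finite_measure m"
    proof (rule finite_measureI)
      have "emeasure m (space m) = emeasure (\<nu> \<Otimes>\<^sub>M M) (space (\<nu> \<Otimes>\<^sub>M M))"
        unfolding m_def by (subst emeasure_distr[OF Z']) (auto intro!: arg_cong2[where f = emeasure] measurable_space[OF Z'])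
      also have "\<dots> = emeasure \<nu> (space \<nu>)"
        by (simp add: space_pair_measure emeasure_pair_measure_Times emeasure_space_1)
      finally show "emeasure m (space m) \<noteq> \<infinity>" using nu.emeasure_finite by simp
    qed
    show "sets m = sets psd_borel" by (simp add: m_def)
    fix \<phi> assume \<phi>: "irreducible_wrt psd_borel transition \<phi>"
    show "absolutely_continuous m \<phi>"
      unfolding absolutely_continuous_def
    proof
      fix D assume "D \<in> null_sets m"
      then have D [measurable]: "D \<in> sets psd_borel" and z: "emeasure m D = 0"
        by (auto simp: m_def null_sets_def)
      have "(\<integral>\<^sup>+t. h t * (\<integral>\<^sup>+w. indicator D (Z (t, w)) \<partial>M) \<partial>lborel) = 0" using m[OF D] z by simp
      then have "AE t in lborel. h t * (\<integral>\<^sup>+w. indicator D (Z (t, w)) \<partial>M) = 0"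
        by (subst (asm) nn_integral_0_iff_AE) measurable
      then have "AE t in lborel. emeasure (transition t 0) D * indicator {0..} t = 0"
      proof eventually_elim
        case (elim t)
        then show ?case
          using pos[of t] transition_eq_integral[OF Z AE x D, of t] by (auto simp: indicator_def)
      qed
      then have "(\<integral>\<^sup>+t\<in>{0..}. emeasure (transition t 0) D \<partial>lborel) = 0"
        by (subst nn_integral_cong_AE[of _ "\<lambda>_. 0"]) auto
      then have "\<not> 0 < emeasure \<phi> D"
        using \<phi> x D unfolding irreducible_wrt_def space_psd_borel by fastforce
      then show "D \<in> null_sets \<phi>"
        using \<phi> D by (auto simp: irreducible_wrt_def null_sets_def zero_less_iff_neq_zero)
    qed
  qed
qed

text \<open>The threshold is uniform over a bounded set of states: irreducibility uses it for one
  state, the small set for a whole ball.\<close>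

lemma transport_small:
  assumes e: "0 < e"
  obtains T where "0 < T"
    "\<And>t x. T \<le> t \<Longrightarrow> x \<in> psd \<Longrightarrow> norm x \<le> r \<Longrightarrow> e *\<^sub>R mat 1 - transport t x \<in> posdef"
proof -
  obtain \<delta> where \<delta>: "0 < \<delta>" "\<And>e S. S \<in> symmetric_matrices \<Longrightarrow> norm S < e * \<delta> \<Longrightarrow> 0 < e \<Longrightarrow>
      e *\<^sub>R mat 1 - S \<in> (posdef :: (real^'d^'d) set)"
    using identity_minus_small_posdef by blast
  obtain K where K: "K > 0" "\<And>(a :: real^'d^'d) (b :: real^'d^'d). norm (a ** b) \<le> norm a * norm b * K"
    using bounded_bilinear.pos_bounded[OF bounded_bilinear_matrix_matrix_mult] by blast
  have "((\<lambda>t. norm (mat_exp B t) * \<bar>r\<bar> * K * norm (transpose (mat_exp B t)) * K) \<longlongrightarrow>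
      norm (0 :: real^'d^'d) * \<bar>r\<bar> * K * norm (transpose (0 :: real^'d^'d)) * K) at_top"
    by (intro tendsto_intros stable bounded_linear.tendsto[OF bounded_linear_transpose])
  then have "\<forall>\<^sub>F t in at_top. norm (mat_exp B t) * \<bar>r\<bar> * K * norm (transpose (mat_exp B t)) * K < e * \<delta>"
    using e \<delta>(1) by (intro order_tendstoD) auto
  then obtain T0 where T0: "\<And>t. T0 \<le> t \<Longrightarrow> norm (mat_exp B t) * \<bar>r\<bar> * K * norm (transpose (mat_exp B t)) * K < e * \<delta>"
    by (auto simp: eventually_at_top_linorder)
  show ?thesis
  proof (rule that[of "max T0 1"])
    fix t and x :: "real^'d^'d" assume t: "max T0 1 \<le> t" and x: "x \<in> psd" "norm x \<le> r"
    have "norm (transport t x) \<le> norm (mat_exp B t ** x) * norm (transpose (mat_exp B t)) * K" by (rule K(2))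
    also have "\<dots> \<le> (norm (mat_exp B t) * norm x * K) * norm (transpose (mat_exp B t)) * K"
      using K(1) by (intro mult_right_mono K(2)) auto
    also have "\<dots> \<le> (norm (mat_exp B t) * \<bar>r\<bar> * K) * norm (transpose (mat_exp B t)) * K"
      using K(1) x(2) by (intro mult_right_mono mult_left_mono) auto
    also have "\<dots> < e * \<delta>" using T0[of t] t by simp
    finally show "e *\<^sub>R mat 1 - transport t x \<in> posdef"
      by (intro \<delta>(2) psd_symmetric psd_congruence x e)
  qed simp
qed

lemma measurable_\<kappa>_path:
  assumes t: "0 \<le> t" and \<eta>: "\<eta> \<in> measurable Q count_paths"
    and y: "y \<in> borel_measurable Q" "z \<in> borel_measurable Q"
  shows "(\<lambda>q. jump_chain.\<kappa> A B C t dens (\<lambda>i. jump_time t (j + i) (\<eta> q)) (y q) (z q)) \<in> borel_measurable Q"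
proof -
  interpret J: jump_chain F A B C t dens by (rule jump_chain)
  show ?thesis
    by (rule J.measurable_\<kappa>[OF _ y]) (rule measurable_compose[OF \<eta> measurable_jump_time[OF t]])
qed

theorem transition_pos:
  assumes x: "x \<in> psd" and t: "0 < t" and D: "D \<in> sets psd_borel"
    and pos: "0 < emeasure lebesgue_symmetric {z \<in> D. z - transport t x \<in> posdef}"
  shows "0 < emeasure (transition t x) D"
proof -
  interpret J: jump_chain F A B C t dens by (rule jump_chain)
  interpret S: sigma_finite_measure "lebesgue_symmetric :: (real^'d^'d) measure" by (rule sym.sigma_finite)
  have D' [measurable]: "D \<in> sets borel" using D by (simp add: psd_borel_sets)
  let ?H = "one_jump_per_cell t CARD('d)" and ?y = "transport t x"
  have H [measurable]: "?H \<in> sets count_paths" using t by (intro measurable_one_jump_per_cell) simp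
  have y: "?y \<in> psd" by (intro psd_congruence x)
  define I where "I \<eta> = (\<integral>\<^sup>+z. J.\<kappa> (\<lambda>i. jump_time t i \<eta>) ?y z * indicator D z \<partial>lebesgue_symmetric)" for \<eta>
  have [measurable]: "(\<lambda>q. J.\<kappa> (\<lambda>i. jump_time t i (fst q)) ?y (snd q)) \<in> borel_measurable (path_law \<Otimes>\<^sub>M lebesgue_symmetric)"
    using measurable_\<kappa>_path[of t fst "path_law \<Otimes>\<^sub>M lebesgue_symmetric" "\<lambda>_. ?y" snd 0] t by simp
  have I [measurable]: "I \<in> borel_measurable path_law"
    unfolding I_def by (intro S.borel_measurable_nn_integral) (simp add: case_prod_beta)
  \<comment> \<open>The integral is positive for every path, whatever its jump times, so positive
    probability of the event alone gives a positive total.\<close>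
  have I_pos: "I \<eta> \<noteq> 0" for \<eta>
  proof
    assume z: "I \<eta> = 0"
    have [measurable]: "(\<lambda>z. J.\<kappa> (\<lambda>i. jump_time t i \<eta>) ?y z) \<in> borel_measurable borel"
      by (rule J.measurable_\<kappa>) measurable
    have "AE z in lebesgue_symmetric. J.\<kappa> (\<lambda>i. jump_time t i \<eta>) ?y z * indicator D z = 0"
      using z unfolding I_def by (subst (asm) nn_integral_0_iff_AE) auto
    then have "AE z in lebesgue_symmetric. z \<notin> {z \<in> D. z - ?y \<in> posdef}"
      using J.\<kappa>_pos[OF y, of "\<lambda>i. jump_time t i \<eta>"]
      by eventually_elim (auto simp: indicator_def split: if_splits)
    moreover have Dy: "{z \<in> D. z - ?y \<in> posdef} \<in> sets lebesgue_symmetric"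
    proof -
      have "{z \<in> D. z - ?y \<in> posdef} = D \<inter> {z \<in> space borel. z - ?y \<in> posdef}" by auto
      also have "\<dots> \<in> sets borel" by measurable
      finally show ?thesis by simp
    qed
    ultimately have "{z \<in> D. z - ?y \<in> posdef} \<in> null_sets lebesgue_symmetric"
      using AE_iff_null_sets[OF Dy] by blast
    then show False using pos by (simp add: null_sets_def)
  qed
  have "0 < (\<integral>\<^sup>+\<eta>. indicator ?H \<eta> * I \<eta> \<partial>path_law)"
  proof (rule ccontr)
    assume "\<not> ?thesis"
    then have "(\<integral>\<^sup>+\<eta>. indicator ?H \<eta> * I \<eta> \<partial>path_law) = 0"
      by (simp add: zero_less_iff_neq_zero)
    then have "AE \<eta> in path_law. indicator ?H \<eta> * I \<eta> = 0"
      by (subst (asm) nn_integral_0_iff_AE) measurable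
    then have "AE \<eta> in path_law. \<eta> \<notin> ?H"
      by eventually_elim (use I_pos in \<open>auto simp: indicator_def split: if_splits\<close>)
    then have "emeasure path_law ?H = 0" using AE_iff_null_sets[of ?H path_law] H by (auto simp: null_sets_def)
    then show False using path_law_cell_pos[OF t, of "CARD('d)"] by simp
  qed
  also have "(\<integral>\<^sup>+\<eta>. indicator ?H \<eta> * I \<eta> \<partial>path_law)
      \<le> (\<integral>\<^sup>+\<eta>. indicator ?H \<eta> * J.jump_ops (\<lambda>i. jump_time t i \<eta>) CARD('d) (indicator D) ?y \<partial>path_law)"
    unfolding I_def by (intro nn_integral_mono mult_left_mono J.jump_ops_density y) auto
  also have "\<dots> \<le> emeasure (transition t x) D"
    by (rule transition_lower_bound[OF x t _ D]) simp
  finally show ?thesis .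
qed

theorem irreducible: "irreducible_wrt psd_borel transition lebesgue_psd"
  unfolding irreducible_wrt_def
proof (intro conjI ballI impI)
  show "sigma_finite_measure (lebesgue_psd :: (real^'d^'d) measure)" by (rule sigma_finite_lebesgue_psd)
  show "sets (lebesgue_psd :: (real^'d^'d) measure) = sets psd_borel" by (rule sets_lebesgue_psd)
  fix x :: "real^'d^'d" and D :: "(real^'d^'d) set" assume "x \<in> space psd_borel" and D: "D \<in> sets psd_borel" and pos: "0 < emeasure lebesgue_psd D"
  then have x: "x \<in> psd" by (simp add: space_psd_borel)
  have D' [measurable]: "D \<in> sets borel" and Dpsd: "D \<subseteq> psd" using D by (simp_all add: psd_borel_sets)
  \<comment> \<open>Up to a null set the \<open>G k\<close> exhaust \<open>D\<close>. On
    \<open>G k\<close> every point dominates a fixed multiple of the identity, below which the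
    transported start eventually falls.\<close>
  define G where "G k = {z \<in> D. z - (1 / real (Suc k)) *\<^sub>R mat 1 \<in> psd}" for k
  have G: "G k \<in> sets borel" for k
  proof -
    have "G k = D \<inter> {z \<in> space borel. z - (1 / real (Suc k)) *\<^sub>R mat 1 \<in> psd}" by (auto simp: G_def)
    also have "\<dots> \<in> sets borel" by measurable
    finally show ?thesis .
  qed
  have "\<exists>k. 0 < emeasure lebesgue_symmetric (G k)"
  proof (rule ccontr)
    assume "\<not> ?thesis"
    then have "G k \<in> null_sets lebesgue_symmetric" for k using G by (auto simp: null_sets_def zero_less_iff_neq_zero)
    then have "(\<Union>k. G k) \<in> null_sets lebesgue_symmetric" by (rule null_sets_UN)
    then have "AE z in lebesgue_symmetric. z \<notin> (\<Union>k. G k)" by (rule AE_not_in)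
    then have "AE z in lebesgue_symmetric. z \<notin> D"
      using AE_psd_posdef
    proof eventually_elim
      case (elim z)
      show ?case
      proof
        assume zD: "z \<in> D"
        then have z: "z \<in> posdef" using elim(2) Dpsd by auto
        have "\<exists>k. z - (1 / real (Suc k)) *\<^sub>R mat 1 \<in> psd" by (rule posdef_minus_small_psd[OF z])
        then show False using elim(1) zD by (auto simp: G_def)
      qed
    qed
    then have "emeasure lebesgue_symmetric D = 0" using AE_iff_null_sets[of D lebesgue_symmetric] by (auto simp: null_sets_def)
    then show False using pos emeasure_lebesgue_psd[OF Dpsd] by simp
  qed
  then obtain k where k: "0 < emeasure lebesgue_symmetric (G k)" by blast
  obtain T where T: "0 < T" "\<And>t y. T \<le> t \<Longrightarrow> y \<in> psd \<Longrightarrow> norm y \<le> norm x \<Longrightarrow>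
      (1 / real (Suc k)) *\<^sub>R mat 1 - transport t y \<in> posdef"
    using transport_small[of "1 / real (Suc k)" "norm x"] by auto
  have P: "0 < emeasure (transition t x) D" if t: "T \<le> t" for t
  proof (rule transition_pos[OF x _ D])
    have "z - transport t x \<in> posdef" if "z \<in> G k" for z
      using posdef_psd_add[OF T(2)[OF t x order_refl], of "z - (1 / real (Suc k)) *\<^sub>R mat 1"] that
      by (simp add: G_def)
    then have "G k \<subseteq> {z \<in> D. z - transport t x \<in> posdef}" by (auto simp: G_def)
    moreover have "{z \<in> D. z - transport t x \<in> posdef} \<in> sets lebesgue_symmetric"
    proof -
      have "{z \<in> D. z - transport t x \<in> posdef} = D \<inter> {z \<in> space borel. z - transport t x \<in> posdef}" by auto
      also have "\<dots> \<in> sets borel" by measurable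
      finally show ?thesis by simp
    qed
    ultimately show "0 < emeasure lebesgue_symmetric {z \<in> D. z - transport t x \<in> posdef}"
      using k by (meson emeasure_mono less_le_trans)
  qed (use T(1) t in simp)
  show "0 < (\<integral>\<^sup>+t\<in>{0..}. emeasure (transition t x) D \<partial>lborel)"
  proof (rule ccontr)
    assume "\<not> ?thesis"
    then have "(\<integral>\<^sup>+t\<in>{0..}. emeasure (transition t x) D \<partial>lborel) = 0" by (simp add: zero_less_iff_neq_zero)
    then have "AE t in lborel. emeasure (transition t x) D * indicator {0..} t = 0"
      by (subst (asm) nn_integral_0_iff_AE) (simp_all add: measurable_transition[OF x D])
    then have "AE t in lborel. t \<notin> {T..T + 1}"
      by eventually_elim (use P T(1) in \<open>force simp: indicator_def\<close>)
    then have "emeasure lborel {T..T + 1} = 0" using AE_iff_null_sets[of "{T..T + 1}" lborel] by (auto simp: null_sets_def)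
    then show False by simp
  qed
qed

text \<open>Two blocks of as many jumps as the dimension: the first block has a density \<open>k1\<close> from the transported
  state to an intermediate \<open>y\<close>, the second a density \<open>k2\<close> from \<open>y\<close> to \<open>z\<close>.  Neither is bounded below, but for
  suitable sets of starting and final points both exceed a constant outside a small part of the
  space of jump times and intermediate points, so the two good parts always overlap.\<close>

theorem small_set_exists:
  obtains D T where "small_set psd_borel transition D" "0 < emeasure lebesgue_psd D" "0 \<le> T"
    "\<And>t x. T \<le> t \<Longrightarrow> x \<in> D \<Longrightarrow> 0 < emeasure (transition t x) D"
proof -
  interpret S: sigma_finite_measure "lebesgue_symmetric :: (real^'d^'d) measure" by (rule sym.sigma_finite)
  obtain \<delta> where \<delta>: "0 < \<delta>" "\<And>e S. S \<in> symmetric_matrices \<Longrightarrow> norm S < e * \<delta> \<Longrightarrow> 0 < e \<Longrightarrow>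
      e *\<^sub>R mat 1 - S \<in> (posdef :: (real^'d^'d) set)"
    using identity_minus_small_posdef by blast
  have I: "c *\<^sub>R mat 1 \<in> (symmetric_matrices :: (real^'d^'d) set)" for c :: real
    by (intro symmetric_scaleR) (simp add: symmetric_matrices_def)
  have sym_sets [measurable]: "(symmetric_matrices :: (real^'d^'d) set) \<in> sets borel"
    using closed_subspace[OF subspace_symmetric_matrices] by (rule borel_closed)
  \<comment> \<open>The radius places the ball strictly between \<open>c - 1\<close> and
    \<open>c + 1\<close> times the identity. With centre 2 this leaves room below for the
    transported starting point; with centre 4 it puts the final points above the intermediate
    ones.\<close>
  define Bl :: "real \<Rightarrow> (real^'d^'d) set" where "Bl c = ball (c *\<^sub>R mat 1) \<delta> \<inter> symmetric_matrices" for c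
  have Bl_sets [measurable]: "Bl c \<in> sets borel" for c unfolding Bl_def by measurable
  have Bl_lower: "z - (c - 1) *\<^sub>R mat 1 \<in> posdef" and Bl_upper: "(c + 1) *\<^sub>R mat 1 - z \<in> posdef" if z: "z \<in> Bl c" for z c
  proof -
    have s: "z - c *\<^sub>R mat 1 \<in> symmetric_matrices" "c *\<^sub>R mat 1 - z \<in> symmetric_matrices"
      using z I by (auto simp: Bl_def intro: symmetric_diff)
    have n: "norm (z - c *\<^sub>R mat 1) < 1 * \<delta>" "norm (c *\<^sub>R mat 1 - z) < 1 * \<delta>"
      using z by (auto simp: Bl_def dist_norm norm_minus_commute)
    show "z - (c - 1) *\<^sub>R mat 1 \<in> posdef" using \<delta>(2)[OF s(2) n(2)] by (simp add: algebra_simps)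
    show "(c + 1) *\<^sub>R mat 1 - z \<in> posdef" using \<delta>(2)[OF s(1) n(1)] by (simp add: algebra_simps)
  qed
  have Bl_psd: "Bl c \<subseteq> psd" if "1 \<le> c" for c
  proof
    fix z assume "z \<in> Bl c"
    then have "z - (c - 1) *\<^sub>R mat 1 \<in> posdef" by (rule Bl_lower)
    moreover have "(c - 1) *\<^sub>R mat 1 \<in> (psd :: (real^'d^'d) set)"
      using that by (simp add: psd_def I scaleR_matrix_vector_assoc[symmetric])
    ultimately have "z - (c - 1) *\<^sub>R mat 1 + (c - 1) *\<^sub>R mat 1 \<in> psd" by (intro psd_add[OF posdef_psd])
    then show "z \<in> psd" by simp
  qed
  have Bl_pos: "0 < emeasure lebesgue_symmetric (Bl c)" for c
    unfolding Bl_def by (rule emeasure_symmetric_ball_pos[OF I \<delta>(1)])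
  have Bl_norm: "norm z \<le> \<bar>c\<bar> * norm (mat 1 :: real^'d^'d) + \<delta>" if "z \<in> Bl c" for z c
  proof -
    have "norm z \<le> norm (c *\<^sub>R mat 1 :: real^'d^'d) + norm (z - c *\<^sub>R mat 1)" by (metis norm_triangle_sub)
    then show ?thesis using that by (simp add: Bl_def dist_norm norm_minus_commute)
  qed
  have Bl_fin: "emeasure lebesgue_symmetric (Bl c) < \<infinity>" for c
  proof -
    have "Bl c \<subseteq> ball 0 (\<bar>c\<bar> * norm (mat 1 :: real^'d^'d) + \<delta> + 1)" using Bl_norm by force
    then have "emeasure lebesgue_symmetric (Bl c) \<le> emeasure lebesgue_symmetric (ball 0 (\<bar>c\<bar> * norm (mat 1 :: real^'d^'d) + \<delta> + 1) :: (real^'d^'d) set)"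
      by (intro emeasure_mono) auto
    then show ?thesis using sym.finite_ball le_less_trans by blast
  qed
  \<comment> \<open>The norm bound is \<open>Bl_norm\<close> for \<open>Bl 2\<close>. This
    \<open>T\<close> serves both as the time of the minorization and as the threshold for
    returns.\<close>
  obtain T where T: "0 < T" "\<And>t x. T \<le> t \<Longrightarrow> x \<in> psd \<Longrightarrow> norm x \<le> \<bar>2\<bar> * norm (mat 1 :: real^'d^'d) + \<delta> \<Longrightarrow>
      1 *\<^sub>R mat 1 - transport t x \<in> posdef"
    using transport_small[of 1 "\<bar>2\<bar> * norm (mat 1 :: real^'d^'d) + \<delta>"] by auto
  have above: "z - transport t x \<in> posdef" if "T \<le> t" "x \<in> Bl 2" "z \<in> Bl 2" for t x z
  proof -
    have "1 *\<^sub>R mat 1 - transport t x \<in> posdef"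
      using that Bl_psd[of 2] Bl_norm[of x 2] by (intro T(2)) auto
    from posdef_psd_add[OF this posdef_psd[OF Bl_lower[OF that(3)]]] show ?thesis by simp
  qed
  have above': "z - y \<in> posdef" if "y \<in> Bl 2" "z \<in> Bl 4" for y z
    using posdef_psd_add[OF Bl_upper[OF that(1)] posdef_psd[OF Bl_lower[OF that(2)]]] by simp

  interpret J: jump_chain F A B C T dens by (rule jump_chain)
  define n where "n = CARD('d)"
  let ?H = "one_jump_per_cell T (n + n)"
  have H [measurable]: "?H \<in> sets count_paths" using T(1) by (intro measurable_one_jump_per_cell) simp
  \<comment> \<open>The product of \<open>\<alpha>\<close> and \<open>\<beta>\<close> describes the
    jump times of 2 d jumps and the intermediate state after the first d; \<open>w\<close> is its
    total mass.\<close>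
  define \<alpha> where "\<alpha> = density path_law (indicator ?H)"
  define \<beta> :: "(real^'d^'d) measure" where "\<beta> = density lebesgue_symmetric (indicator (Bl 2))"
  have s\<alpha> [measurable_cong, simp]: "sets \<alpha> = sets count_paths" and s\<beta> [measurable_cong, simp]: "sets \<beta> = sets borel"
    by (simp_all add: \<alpha>_def \<beta>_def)
  interpret R: prob_space path_law by (rule prob_path_law)
  have \<alpha>_H: "emeasure \<alpha> (space \<alpha>) = emeasure path_law ?H"
    unfolding \<alpha>_def using H by (subst emeasure_density) (auto simp: nn_integral_indicator[symmetric] sets_eq_imp_space_eq[OF sets_path_law]
        simp del: nn_integral_indicator intro!: nn_integral_cong split: split_indicator)
  have \<beta>_Bl: "emeasure \<beta> (space \<beta>) = emeasure lebesgue_symmetric (Bl 2)"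
    unfolding \<beta>_def by (subst emeasure_density) auto
  interpret a: finite_measure \<alpha> by (rule finite_measureI) (simp add: \<alpha>_H)
  interpret b: finite_measure \<beta> by (rule finite_measureI) (use Bl_fin[of 2] in \<open>simp add: \<beta>_Bl\<close>)
  interpret ab: pair_sigma_finite \<alpha> \<beta> ..
  interpret sab: pair_sigma_finite "\<alpha> \<Otimes>\<^sub>M \<beta>" "lebesgue_symmetric :: (real^'d^'d) measure"
    by (intro pair_sigma_finite.intro ab.sigma_finite_measure_axioms sym.sigma_finite)
  have w_eq: "emeasure (\<alpha> \<Otimes>\<^sub>M \<beta>) (space (\<alpha> \<Otimes>\<^sub>M \<beta>)) = emeasure path_law ?H * emeasure lebesgue_symmetric (Bl 2)"
    unfolding space_pair_measure \<alpha>_H[symmetric] \<beta>_Bl[symmetric]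
    by (rule b.emeasure_pair_measure_Times[OF sets.top sets.top])
  have fin_ab: "finite_measure (\<alpha> \<Otimes>\<^sub>M \<beta>)"
    by (rule finite_measureI) (use Bl_fin[of 2] R.emeasure_finite in \<open>simp add: w_eq ennreal_mult_eq_top_iff less_top[symmetric]\<close>)
  define w where "w = measure (\<alpha> \<Otimes>\<^sub>M \<beta>) (space (\<alpha> \<Otimes>\<^sub>M \<beta>))"
  have w: "emeasure (\<alpha> \<Otimes>\<^sub>M \<beta>) (space (\<alpha> \<Otimes>\<^sub>M \<beta>)) = ennreal w"
    unfolding w_def by (rule finite_measure.emeasure_eq_measure[OF fin_ab])
  have w_pos: "0 < w"
  proof -
    have "0 < emeasure path_law ?H" by (rule path_law_cell_pos[OF T(1)]) (simp add: n_def)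
    then have "0 < ennreal w" using Bl_pos[of 2] unfolding w[symmetric] w_eq by (simp add: ennreal_zero_less_mult_iff)
    then show ?thesis by simp
  qed
  text \<open>The balls around \<open>2\<close> and \<open>4\<close> times the identity are ordered in the Loewner order, which is what
    positivity of the densities needs.\<close>
  define k1 where "k1 x p = J.\<kappa> (\<lambda>i. jump_time T (0 + i) (fst p)) (transport T x) (snd p)" for x p
  \<comment> \<open>The second block uses the jump times with indices from \<open>n\<close> on. The
    final point \<open>z\<close> is the first argument because uniformity is sought over final
    points.\<close>
  define k2 where "k2 z p = J.\<kappa> (\<lambda>i. jump_time T (n + i) (fst p)) (snd p) z" for z :: "real^'d^'d" and p
  have T0: "0 \<le> T" using T(1) by simp
  have k1_meas: "(\<lambda>q. k1 (f q) (g q)) \<in> borel_measurable Q"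
    if [measurable]: "f \<in> borel_measurable Q" "g \<in> measurable Q (count_paths \<Otimes>\<^sub>M borel)"
    for f :: "'q \<Rightarrow> real^'d^'d" and g and Q :: "'q measure"
    unfolding k1_def by (rule measurable_\<kappa>_path[OF T0]) measurable
  have k2_meas: "(\<lambda>q. k2 (f q) (g q)) \<in> borel_measurable Q"
    if [measurable]: "f \<in> borel_measurable Q" "g \<in> measurable Q (count_paths \<Otimes>\<^sub>M borel)"
    for f :: "'q \<Rightarrow> real^'d^'d" and g and Q :: "'q measure"
    unfolding k2_def by (rule measurable_\<kappa>_path[OF T0]) measurable
  have AE_ab: "AE p in \<alpha> \<Otimes>\<^sub>M \<beta>. P p"
    if P: "\<And>\<eta>. AE y in lebesgue_symmetric. y \<in> Bl 2 \<longrightarrow> P (\<eta>, y)" and [measurable]: "Measurable.pred (count_paths \<Otimes>\<^sub>M borel) P" for P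
  proof (rule ab.AE_pair_measure)
    show "{x \<in> space (\<alpha> \<Otimes>\<^sub>M \<beta>). P x} \<in> sets (\<alpha> \<Otimes>\<^sub>M \<beta>)" by measurable
    show "AE x in \<alpha>. AE y in \<beta>. P (x, y)"
    proof (rule AE_I2)
      fix \<eta>
      show "AE y in \<beta>. P (\<eta>, y)"
        unfolding \<beta>_def by (subst AE_density) (use P[of \<eta>] in \<open>auto simp: indicator_def\<close>)
    qed
  qed
  obtain \<delta>1 D where D: "0 < \<delta>1" "D \<in> sets lebesgue_symmetric" "D \<subseteq> Bl 2" "0 < emeasure lebesgue_symmetric D"
    "\<And>x. x \<in> D \<Longrightarrow> emeasure (\<alpha> \<Otimes>\<^sub>M \<beta>) {p \<in> space (\<alpha> \<Otimes>\<^sub>M \<beta>). k1 x p < ennreal \<delta>1} < ennreal (w / 4)"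
  proof (rule uniformly_positive_set[of "Bl 2" lebesgue_symmetric "\<alpha> \<Otimes>\<^sub>M \<beta>" "ennreal (w / 4)" k1])
    show "(\<lambda>z. k1 (fst z) (snd z)) \<in> borel_measurable (lebesgue_symmetric \<Otimes>\<^sub>M (\<alpha> \<Otimes>\<^sub>M \<beta>))"
      by (rule k1_meas) measurable
    show "AE x in lebesgue_symmetric. x \<in> Bl 2 \<longrightarrow> (AE p in \<alpha> \<Otimes>\<^sub>M \<beta>. 0 < k1 x p)"
    proof (rule AE_I2, rule impI)
      fix x assume x: "x \<in> Bl 2"
      have [measurable]: "k1 x \<in> borel_measurable (count_paths \<Otimes>\<^sub>M borel)"
        using k1_meas[of "\<lambda>_. x" "count_paths \<Otimes>\<^sub>M borel" "\<lambda>p. p"] by simp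
      have "transport T x \<in> psd" using x Bl_psd[of 2] by (intro psd_congruence) auto
      note pos = J.\<kappa>_pos[OF this]
      show "AE p in \<alpha> \<Otimes>\<^sub>M \<beta>. 0 < k1 x p"
      proof (rule AE_ab)
        fix \<eta>
        show "AE y in lebesgue_symmetric. y \<in> Bl 2 \<longrightarrow> 0 < k1 x (\<eta>, y)"
          using pos[of "\<lambda>i. jump_time T (0 + i) \<eta>"]
          by eventually_elim (use above[OF order_refl x] in \<open>auto simp: k1_def\<close>)
      qed measurable
    qed
  qed (use Bl_pos w_pos fin_ab in auto)
  obtain \<delta>2 D' where D': "0 < \<delta>2" "D' \<in> sets lebesgue_symmetric" "D' \<subseteq> Bl 4" "0 < emeasure lebesgue_symmetric D'"
    "\<And>z. z \<in> D' \<Longrightarrow> emeasure (\<alpha> \<Otimes>\<^sub>M \<beta>) {p \<in> space (\<alpha> \<Otimes>\<^sub>M \<beta>). k2 z p < ennreal \<delta>2} < ennreal (w / 4)"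
  proof (rule uniformly_positive_set[of "Bl 4" lebesgue_symmetric "\<alpha> \<Otimes>\<^sub>M \<beta>" "ennreal (w / 4)" k2])
    show "(\<lambda>z. k2 (fst z) (snd z)) \<in> borel_measurable (lebesgue_symmetric \<Otimes>\<^sub>M (\<alpha> \<Otimes>\<^sub>M \<beta>))"
      by (rule k2_meas) measurable
    \<comment> \<open>\<open>\<kappa>\<close> is positive for almost every end point with the other
      data fixed, while the uniform bound asks for a fixed end point; Fubini exchanges the
      two.\<close>
    have "AE p in \<alpha> \<Otimes>\<^sub>M \<beta>. AE z in lebesgue_symmetric. z \<in> Bl 4 \<longrightarrow> 0 < k2 z p"
    proof (rule AE_mp[OF AE_ab])
      show "AE y in lebesgue_symmetric. y \<in> Bl 2 \<longrightarrow> snd (\<eta>, y) \<in> Bl 2" for \<eta> :: "real \<Rightarrow> nat" by simp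
      show "AE p in \<alpha> \<Otimes>\<^sub>M \<beta>. snd p \<in> Bl 2 \<longrightarrow> (AE z in lebesgue_symmetric. z \<in> Bl 4 \<longrightarrow> 0 < k2 z p)"
      proof (rule AE_I2, rule impI)
        fix p :: "(real \<Rightarrow> nat) \<times> (real^'d^'d)" assume p: "snd p \<in> Bl 2"
        have "snd p \<in> psd" using p Bl_psd[of 2] by auto
        from J.\<kappa>_pos[OF this, of "\<lambda>i. jump_time T (n + i) (fst p)"]
        show "AE z in lebesgue_symmetric. z \<in> Bl 4 \<longrightarrow> 0 < k2 z p"
          by eventually_elim (use above'[OF p] in \<open>auto simp: k2_def\<close>)
      qed
    qed measurable
    moreover have "Measurable.pred ((\<alpha> \<Otimes>\<^sub>M \<beta>) \<Otimes>\<^sub>M lebesgue_symmetric) (\<lambda>q. snd q \<in> Bl 4 \<longrightarrow> 0 < k2 (snd q) (fst q))"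
    proof -
      have [measurable]: "(\<lambda>q. k2 (snd q) (fst q)) \<in> borel_measurable ((\<alpha> \<Otimes>\<^sub>M \<beta>) \<Otimes>\<^sub>M lebesgue_symmetric)"
        by (rule k2_meas) measurable
      show ?thesis by measurable
    qed
    ultimately have "AE z in lebesgue_symmetric. AE p in \<alpha> \<Otimes>\<^sub>M \<beta>. z \<in> Bl 4 \<longrightarrow> 0 < k2 z p"
      using sab.AE_commute[of "\<lambda>p z. z \<in> Bl 4 \<longrightarrow> 0 < k2 z p"] by (simp add: pred_def)
    then show "AE z in lebesgue_symmetric. z \<in> Bl 4 \<longrightarrow> (AE p in \<alpha> \<Otimes>\<^sub>M \<beta>. 0 < k2 z p)"
      by eventually_elim auto
  qed (use Bl_pos w_pos fin_ab in auto)
  note [measurable] = D(2) D'(2)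
  \<comment> \<open>Both densities exceed their bounds \<open>\<delta>1\<close> and
    \<open>\<delta>2\<close> on at least half of the total mass.\<close>
  define c where "c = ennreal \<delta>1 * ennreal \<delta>2 * ennreal (w / 2)"
  have c_pos: "0 < c" using D(1) D'(1) w_pos by (simp add: c_def ennreal_zero_less_mult_iff)
  have D_psd: "D \<subseteq> psd" and D'_psd: "D' \<subseteq> psd" using D(3) D'(3) Bl_psd[of 2] Bl_psd[of 4] by auto
  have minor: "c * emeasure lebesgue_symmetric (E \<inter> D') \<le> emeasure (transition T x) E"
    if x: "x \<in> D" and E: "E \<in> sets psd_borel" for x E
  proof -
    have E' [measurable]: "E \<in> sets borel" using E by (simp add: psd_borel_sets)
    have xB: "x \<in> Bl 2" "x \<in> psd" using x D(3) D_psd by auto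
    have y: "transport T x \<in> psd" by (intro psd_congruence xB)
    define \<phi> where "\<phi> = (indicator E :: real^'d^'d \<Rightarrow> ennreal)"
    have [measurable]: "\<phi> \<in> borel_measurable borel" unfolding \<phi>_def by measurable
    have k1 [measurable]: "k1 x \<in> borel_measurable (\<alpha> \<Otimes>\<^sub>M \<beta>)"
      using k1_meas[of "\<lambda>_. x" "\<alpha> \<Otimes>\<^sub>M \<beta>" "\<lambda>p. p"] by simp
    have k2 [measurable]: "(\<lambda>q. k2 (snd q) (fst q)) \<in> borel_measurable ((\<alpha> \<Otimes>\<^sub>M \<beta>) \<Otimes>\<^sub>M lebesgue_symmetric)"
      by (rule k2_meas) measurable
    have "c * emeasure lebesgue_symmetric (E \<inter> D') = (\<integral>\<^sup>+z. c * indicator (E \<inter> D') z \<partial>lebesgue_symmetric)"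
      by (rule nn_integral_cmult_indicator[symmetric]) measurable
    also have "\<dots> \<le> (\<integral>\<^sup>+z. (\<integral>\<^sup>+p. k1 x p * (k2 z p * \<phi> z) \<partial>(\<alpha> \<Otimes>\<^sub>M \<beta>)) \<partial>lebesgue_symmetric)"
    proof (rule nn_integral_mono)
      fix z :: "real^'d^'d"
      show "c * indicator (E \<inter> D') z \<le> (\<integral>\<^sup>+p. k1 x p * (k2 z p * \<phi> z) \<partial>(\<alpha> \<Otimes>\<^sub>M \<beta>))"
      proof (cases "z \<in> E \<inter> D'")
        case True
        have [measurable]: "k2 z \<in> borel_measurable (\<alpha> \<Otimes>\<^sub>M \<beta>)"
          using k2_meas[of "\<lambda>_. z" "\<alpha> \<Otimes>\<^sub>M \<beta>" "\<lambda>p. p"] by simp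
        have "c \<le> (\<integral>\<^sup>+p. k1 x p * k2 z p \<partial>(\<alpha> \<Otimes>\<^sub>M \<beta>))"
          unfolding c_def by (rule nn_integral_product_lower_bound[OF fin_ab w]) (use D(5)[OF x] D'(5)[of z] True in auto)
        then show ?thesis using True by (simp add: \<phi>_def)
      qed simp
    qed
    also have "\<dots> = (\<integral>\<^sup>+p. (\<integral>\<^sup>+z. k1 x p * (k2 z p * \<phi> z) \<partial>lebesgue_symmetric) \<partial>(\<alpha> \<Otimes>\<^sub>M \<beta>))"
      by (rule sab.Fubini') measurable
    also have "\<dots> = (\<integral>\<^sup>+\<eta>. (\<integral>\<^sup>+y. (\<integral>\<^sup>+z. k1 x (\<eta>, y) * (k2 z (\<eta>, y) * \<phi> z) \<partial>lebesgue_symmetric) \<partial>\<beta>) \<partial>\<alpha>)"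
      by (rule b.nn_integral_fst[symmetric]) measurable
    also have "\<dots> \<le> (\<integral>\<^sup>+\<eta>. J.jump_ops (\<lambda>i. jump_time T i \<eta>) (n + n) \<phi> (transport T x) \<partial>\<alpha>)"
    proof (rule nn_integral_mono)
      fix \<eta> assume "\<eta> \<in> space \<alpha>"
      then have \<eta>: "\<eta> \<in> space count_paths" using sets_eq_imp_space_eq[OF s\<alpha>] by simp
      \<comment> \<open>The effect of the second block, as a test function of the intermediate
        state. The first block then acts on it, and \<open>jump_ops_add\<close> joins the
        two.\<close>
      define \<psi> where "\<psi> y = J.jump_ops (\<lambda>i. jump_time T (n + i) \<eta>) n \<phi> y" for y
      have [measurable]: "\<psi> \<in> borel_measurable borel"
        unfolding \<psi>_def by (rule J.measurable_jump_ops) measurable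
      define g where "g y = J.\<kappa> (\<lambda>i. jump_time T i \<eta>) (transport T x) y" for y
      have [measurable]: "g \<in> borel_measurable borel"
        unfolding g_def by (rule J.measurable_\<kappa>) measurable
      have k2z: "(\<lambda>z. k2 z (\<eta>, y)) \<in> borel_measurable borel" for y
        unfolding k2_def by (rule J.measurable_\<kappa>) measurable
      have "(\<integral>\<^sup>+y. (\<integral>\<^sup>+z. k1 x (\<eta>, y) * (k2 z (\<eta>, y) * \<phi> z) \<partial>lebesgue_symmetric) \<partial>\<beta>)
          = (\<integral>\<^sup>+y. k1 x (\<eta>, y) * (\<integral>\<^sup>+z. k2 z (\<eta>, y) * \<phi> z \<partial>lebesgue_symmetric) \<partial>\<beta>)"
        by (intro nn_integral_cong nn_integral_cmult borel_measurable_times_ennreal)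
          (simp_all add: k2z cong: measurable_cong_sets)
      also have "\<dots> \<le> (\<integral>\<^sup>+y. g y * \<psi> y \<partial>\<beta>)"
      proof (rule nn_integral_mono_AE)
        have "AE y in \<beta>. y \<in> Bl 2" unfolding \<beta>_def by (subst AE_density) (auto simp: indicator_def)
        then show "AE y in \<beta>. k1 x (\<eta>, y) * (\<integral>\<^sup>+z. k2 z (\<eta>, y) * \<phi> z \<partial>lebesgue_symmetric) \<le> g y * \<psi> y"
        proof eventually_elim
          case (elim y)
          then have "y \<in> psd" using Bl_psd[of 2] by auto
          then have "(\<integral>\<^sup>+z. k2 z (\<eta>, y) * \<phi> z \<partial>lebesgue_symmetric) \<le> \<psi> y"
            unfolding \<psi>_def k2_def n_def fst_conv snd_conv by (rule J.jump_ops_density) measurable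
          then show ?case by (simp add: k1_def g_def mult_left_mono)
        qed
      qed
      also have "\<dots> = (\<integral>\<^sup>+y. indicator (Bl 2) y * (g y * \<psi> y) \<partial>lebesgue_symmetric)"
        unfolding \<beta>_def by (rule nn_integral_density) measurable
      also have "\<dots> \<le> (\<integral>\<^sup>+y. g y * \<psi> y \<partial>lebesgue_symmetric)"
        by (intro nn_integral_mono) (auto simp: indicator_def)
      also have "\<dots> \<le> J.jump_ops (\<lambda>i. jump_time T i \<eta>) CARD('d) \<psi> (transport T x)"
        unfolding g_def by (rule J.jump_ops_density[OF y]) measurable
      also have "\<dots> = J.jump_ops (\<lambda>i. jump_time T i \<eta>) (n + n) \<phi> (transport T x)"
        unfolding J.jump_ops_add by (simp add: n_def \<psi>_def[abs_def])
      finally show "(\<integral>\<^sup>+y. (\<integral>\<^sup>+z. k1 x (\<eta>, y) * (k2 z (\<eta>, y) * \<phi> z) \<partial>lebesgue_symmetric) \<partial>\<beta>)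
          \<le> J.jump_ops (\<lambda>i. jump_time T i \<eta>) (n + n) \<phi> (transport T x)" .
    qed
    also have "\<dots> = (\<integral>\<^sup>+\<eta>. indicator ?H \<eta> * J.jump_ops (\<lambda>i. jump_time T i \<eta>) (n + n) \<phi> (transport T x) \<partial>path_law)"
      unfolding \<alpha>_def
      by (rule nn_integral_density) (simp_all add: measurable_jump_ops_path[OF T0] cong: measurable_cong_sets)
    also have "\<dots> \<le> emeasure (transition T x) E"
      unfolding \<phi>_def by (rule transition_lower_bound[OF xB(2) T(1) _ E]) (simp add: n_def)
    finally show ?thesis .
  qed
  have D_sets: "D \<in> sets psd_borel" using D_psd D(2) by (simp add: psd_borel_sets)
  show ?thesis
  proof (rule that[of D T])
    show "small_set psd_borel transition D"
      unfolding small_set_def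
    proof (intro conjI exI[of _ T] exI[of _ "density lebesgue_psd (\<lambda>z. c * indicator D' z)"] ballI)
      show "D \<in> sets psd_borel" by (rule D_sets)
      show "D \<noteq> {}" using D(4) by auto
      let ?\<nu> = "density lebesgue_psd (\<lambda>z. c * indicator D' z)"
      show "sets ?\<nu> = sets psd_borel" by (simp add: sets_lebesgue_psd)
      have \<nu>: "emeasure ?\<nu> E = c * emeasure lebesgue_symmetric (E \<inter> D')" if E: "E \<in> sets psd_borel" for E
      proof -
        have D's: "D' \<in> sets lebesgue_psd" "E \<in> sets lebesgue_psd" "E \<inter> D' \<in> sets lebesgue_psd"
          using D'_psd D'(2) E by (auto simp: sets_lebesgue_psd psd_borel_sets)
        have "emeasure ?\<nu> E = (\<integral>\<^sup>+z. c * indicator D' z * indicator E z \<partial>lebesgue_psd)"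
          using D's by (intro emeasure_density borel_measurable_times_ennreal borel_measurable_indicator) auto
        also have "\<dots> = (\<integral>\<^sup>+z. c * indicator (E \<inter> D') z \<partial>lebesgue_psd)"
          by (intro nn_integral_cong) (auto simp: indicator_def)
        also have "\<dots> = c * emeasure lebesgue_psd (E \<inter> D')" by (rule nn_integral_cmult_indicator[OF D's(3)])
        also have "emeasure lebesgue_psd (E \<inter> D') = emeasure lebesgue_symmetric (E \<inter> D')"
          using D'_psd by (intro emeasure_lebesgue_psd) auto
        finally show ?thesis .
      qed
      have "space psd_borel \<inter> D' = D'" using D'_psd by (auto simp: space_psd_borel)
      then show "emeasure ?\<nu> (space psd_borel) \<noteq> 0"
        using \<nu>[of "space psd_borel"] c_pos D'(4) by (simp add: zero_less_iff_neq_zero)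
      show "emeasure ?\<nu> E \<le> emeasure (transition T x) E" if "x \<in> D" "E \<in> sets psd_borel" for x E
        using minor[OF that] \<nu>[OF that(2)] by simp
    qed (rule T(1))
    show "0 < emeasure lebesgue_psd D" using D(4) emeasure_lebesgue_psd[OF D_psd] by simp
    show "0 < emeasure (transition t x) D" if t: "T \<le> t" and x: "x \<in> D" for t x
    proof (rule transition_pos[OF _ _ D_sets])
      \<comment> \<open>From time \<open>T\<close> on, every transported point of \<open>D\<close>
        lies below every point of \<open>D\<close>, so all of \<open>D\<close> is reachable.\<close>
      have "{z \<in> D. z - transport t x \<in> posdef} = D" using above[OF t] x D(3) by blast
      then show "0 < emeasure lebesgue_symmetric {z \<in> D. z - transport t x \<in> posdef}" using D(4) by simp
    qed (use x D_psd t T(1) in auto)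
  qed (rule T0)
qed

text \<open>Lebesgue measure on the cone is an irreducibility measure, hence absolutely continuous
  with respect to the maximal one; the small set of positive Lebesgue measure is therefore charged
  by \<open>\<psi>\<close>.\<close>

theorem aperiodic: "aperiodic_process psd_borel transition"
proof -
  obtain m where "finite_measure m" "sets m = sets psd_borel"
    "\<And>\<phi>. irreducible_wrt psd_borel transition \<phi> \<Longrightarrow> absolutely_continuous m \<phi>"
    using dominating_measure by blast
  then obtain \<psi> where \<psi>: "maximal_irreducibility_measure psd_borel transition \<psi>"
    using maximal_irreducibility_measure_exists[where P = transition, OF sets_transition] by blast
  then have ac: "absolutely_continuous \<psi> lebesgue_psd" and sets: "sets \<psi> = sets psd_borel"
    using irreducible by (auto simp: maximal_irreducibility_measure_def irreducible_wrt_def)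
  obtain D T where D: "small_set psd_borel transition D" "0 < emeasure lebesgue_psd D" "0 \<le> T"
    "\<And>t x. T \<le> t \<Longrightarrow> x \<in> D \<Longrightarrow> 0 < emeasure (transition t x) D"
    using small_set_exists by blast
  have "0 < emeasure \<psi> D"
  proof (rule ccontr)
    assume "\<not> ?thesis"
    then have "D \<in> null_sets \<psi>" using D(1) sets by (simp add: null_sets_def small_set_def zero_less_iff_neq_zero)
    then have "D \<in> null_sets lebesgue_psd" using ac by (auto simp: absolutely_continuous_def)
    then show False using D(2) by (simp add: null_sets_def)
  qed
  then show ?thesis using \<psi> D unfolding aperiodic_process_def by blast
qed

end

theorem theorem5p1:
  fixes M :: "'w measure"
    and rate :: real
    and F :: "(real^'d) measure"
    and L :: "real \<Rightarrow> 'w \<Rightarrow> real^'d"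
    and A B C :: "real^'d^'d"
    and Y :: "real^'d^'d \<Rightarrow> real \<Rightarrow> 'w \<Rightarrow> real^'d^'d"
  assumes "prob_space M"
    and "0 < rate"
    and "compound_poisson M rate F L"
    and "\<exists>Fa Fs. lebesgue_decomposition lborel F Fa Fs \<and>
           emeasure Fa (space Fa) \<noteq> 0 \<and> equivalent_measures Fa lborel"
    and "invertible A"
    and "\<And>z. complex_eigenvalue B z \<Longrightarrow> Re z < 0"
    and "C \<in> posdef"
    and "\<And>x. x \<in> psd \<Longrightarrow> mucogarch_volatility M L A B C x (Y x)"
  shows "irreducible_wrt psd_borel (mucogarch_transition M Y) lebesgue_psd \<and>
         aperiodic_process psd_borel (mucogarch_transition M Y)"
proof -
  obtain N X where NX: "poisson_process M rate N" "prob_space.indep_vars M (\<lambda>_. borel) X (UNIV :: nat set)"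
      "\<And>i. distr M borel (X i) = F"
      "prob_space.indep_set M
          (sets (vimage_algebra (space M) (\<lambda>w. \<lambda>t\<in>{0..}. N t w) (PiM {0..} (\<lambda>_. count_space UNIV))))
          (sets (vimage_algebra (space M) (\<lambda>w i. X i w) (PiM UNIV (\<lambda>_. borel))))"
      "AE w in M. \<forall>t\<ge>0. L t w = (\<Sum>i<N t w. X i w)"
    using assms(3) unfolding compound_poisson_def by blast
  obtain Fa Fs where "lebesgue_decomposition lborel F Fa Fs" "equivalent_measures Fa lborel"
    using assms(4) by blast
  then obtain dens where dens: "dens \<in> borel_measurable borel" "AE v in lborel. 0 < dens v"
      "\<And>\<phi>. \<phi> \<in> borel_measurable borel \<Longrightarrow> (\<integral>\<^sup>+v. dens v * \<phi> v \<partial>lborel) \<le> (\<integral>\<^sup>+v. \<phi> v \<partial>F)"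
    using absolutely_continuous_part_density by blast
  interpret mucogarch M rate N X F L A B C dens Y
    by (intro mucogarch.intro mucogarch_axioms.intro assms NX dens mat_exp_tendsto_0)
  show ?thesis using irreducible aperiodic by blast
qed

end
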